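(* Let $\alpha\in(1,2]$ and let $\mathbf{S}(n)=\sum_{i=1}^n\mathbf{Y}_i$, $\mathbf{S}(0)=0$, be a random walk in $\mathbb{R}^d$ with i.i.d. steps with mean $\mu=\mathbb{E}[\mathbf{Y}_1]\neq0$, such that $$\frac{\mathbf{S}(n)-n\mu}{b_n}\xrightarrow[n\to\infty]{\mathcal{D}}\mathbf{X}(1)$$ for a sequence $b_n>0$ and an $\alpha$-stable Lévy process $\{\mathbf{X}(t)\}_{t\ge0}$ in $\mathbb{R}^d$. Let $\{\bar e_1,\dots,\bar e_d\}$ be an orthonormal basis of $\mathbb{R}^d$ with $\bar e_1=\mu/\|\mu\|$, let $\phi:\mathbb{R}^d\to\mathbb{R}^d$, $\phi(x)=(\langle x,\bar e_1\rangle,\dots,\langle x,\bar e_d\rangle)$, and define $\psi_n:\mathbb{R}^d\to\mathbb{R}^d$ by $$\psi_n(x_1,\dots,x_d)=\phi\Bigl(\frac{x_1}{n},\frac{x_2}{b_n},\dots,\frac{x_d}{b_n}\Bigr)$$ and the process $\widetilde{\mathbf{X}}(t)=\bigl(\|\mu\|t,\langle\mathbf{X}(t),\bar e_2\rangle,\dots,\langle\mathbf{X}(t),\bar e_d\rangle\bigr)$, $t\ge0$. Then $$\psi_n\bigl(\mathrm{conv}\{\mathbf{S}(0),\ldots,\mathbf{S}(n)\}\bigr)\;\Longrightarrow\;\mathrm{conv}\,\widetilde{\mathbf{X}}[0,1]\qquad(n\to\infty)$$ in the sense of weak convergence in $(\mathcal{K}_0^d,\mathrm{dist}_{\mathcal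{H}})$.
   Context: $\mathcal{K}^d_0$ is the set of convex bodies (compact convex subsets) of $\mathbb{R}^d$ containing $0$, with Hausdorff metric $\mathrm{dist}_{\mathcal{H}}$. $\mathrm{conv}$ is the convex hull and, for a càdlàg process, $\widetilde{\mathbf{X}}[0,1]=\mathrm{cl}\{\widetilde{\mathbf{X}}(t):t\in[0,1]\}$. For a set $A$, $\psi_n(A)=\{\psi_n(x):x\in A\}$. In the normalization $b_n=n^{1/\alpha}\ell(n)$ with $\ell$ slowly varying at infinity. $\xrightarrow{\mathcal{D}}$ is convergence in distribution.
   Formalization: In the definition of ψ_n the entries x_1,…,x_d are taken as the coordinates of the point in the basis ē_1,…,ē_d, i.e. ψ_n(x) = (⟨x,ē_1⟩/n, ⟨x,ē_2⟩/b_n, …, ⟨x,ē_d⟩/b_n); with standard coordinates the claim fails unless μ lies along the first axis. *)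

theory Defs
  imports "HOL-Probability.Probability"
begin

section \<open>The space of convex bodies containing the origin\<close>

definition convex_bodies0 :: "'a::euclidean_space set set" where
  "convex_bodies0 = {K. convex K \<and> compact K \<and> 0 \<in> K}"

text \<open>
  As for \<^const>\<open>infdist\<close> and \<^const>\<open>setdist\<close>, the value is \<open>0\<close> by convention where the usual
  formula makes no sense (empty or unbounded arguments).
\<close>
definition hausdorff_dist :: "'a::metric_space set \<Rightarrow> 'a set \<Rightarrow> real" where
  "hausdorff_dist A B =
    (if A \<noteq> {} \<and> B \<noteq> {} \<and> bounded A \<and> bounded B
     then max (SUP a\<in>A. infdist a B) (SUP b\<in>B. infdist b A) else 0)"

lemma bdd_above_infdist:
  fixes A B :: "'a::metric_space set"
  assumes "bounded A"
  shows "bdd_above ((\<lambda>a. infdist a B) ` A)"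
proof (cases "B = {}")
  case True
  then show ?thesis by (auto simp: infdist_def intro!: bdd_aboveI)
next
  case False
  then obtain b where b: "b \<in> B" by blast
  from assms obtain r where r: "\<And>a. a \<in> A \<Longrightarrow> dist b a \<le> r"
    using bounded_any_center[of A b] by blast
  show ?thesis
  proof (rule bdd_aboveI2)
    fix a assume "a \<in> A"
    then show "infdist a B \<le> r"
      using infdist_le[OF b, of a] r[of a] by (simp add: dist_commute)
  qed
qed

lemma hausdorff_dist_le_iff:
  fixes A B :: "'a::metric_space set"
  assumes "bounded A" "bounded B" "A \<noteq> {}" "B \<noteq> {}"
  shows "hausdorff_dist A B \<le> r \<longleftrightarrow>
    (\<forall>a\<in>A. infdist a B \<le> r) \<and> (\<forall>b\<in>B. infdist b A \<le> r)"
  using assms by (simp add: hausdorff_dist_def cSUP_le_iff bdd_above_infdist)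

lemma infdist_le_hausdorff_dist:
  assumes "bounded A" "bounded B" "B \<noteq> {}" "a \<in> A"
  shows "infdist a B \<le> hausdorff_dist A B"
  using hausdorff_dist_le_iff[of A B "hausdorff_dist A B"] assms by auto

lemma hausdorff_dist_nonneg: "0 \<le> hausdorff_dist A B"
proof (cases "A \<noteq> {} \<and> B \<noteq> {} \<and> bounded A \<and> bounded B")
  case True
  then obtain a where "a \<in> A" by blast
  with True show ?thesis
    using infdist_le_hausdorff_dist[of A B a] infdist_nonneg[of a B] by linarith
next
  case False
  then show ?thesis unfolding hausdorff_dist_def by auto
qed

lemma hausdorff_dist_commute: "hausdorff_dist A B = hausdorff_dist B A"
  by (auto simp: hausdorff_dist_def max.commute)

lemma infdist_triangle_hausdorff:
  fixes B C :: "'a::heine_borel set"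
  assumes "bounded B" "bounded C" "compact B" "B \<noteq> {}" "C \<noteq> {}"
  shows "infdist a C \<le> infdist a B + hausdorff_dist B C"
proof -
  obtain b where b: "b \<in> B" "infdist a B = dist a b"
    using infdist_attains_inf[of B a] assms by (auto simp: compact_imp_closed)
  show ?thesis
    using infdist_triangle[of a C b] infdist_le_hausdorff_dist[of B C b] b assms by linarith
qed

lemma Metric_space_convex_bodies0:
  "Metric_space (convex_bodies0 :: 'a::euclidean_space set set) hausdorff_dist"
proof
  have props: "compact A" "bounded A" "closed A" "A \<noteq> {}" if "A \<in> convex_bodies0" for A :: "'a set"
    using that by (auto simp: convex_bodies0_def compact_imp_closed compact_imp_bounded)
  show "0 \<le> hausdorff_dist A B" for A B :: "'a set"
    by (rule hausdorff_dist_nonneg)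
  show "hausdorff_dist A B = hausdorff_dist B A" for A B :: "'a set"
    by (rule hausdorff_dist_commute)
  show "hausdorff_dist A B = 0 \<longleftrightarrow> A = B"
    if A: "A \<in> convex_bodies0" and B: "B \<in> convex_bodies0" for A B :: "'a set"
  proof
    assume "hausdorff_dist A B = 0"
    then have *: "\<forall>a\<in>A. infdist a B \<le> 0" "\<forall>b\<in>B. infdist b A \<le> 0"
      using hausdorff_dist_le_iff[of A B 0] props[OF A] props[OF B] by auto
    have "A \<subseteq> B"
      using *(1) in_closed_iff_infdist_zero[OF props(3,4)[OF B]] infdist_nonneg[of _ B]
      by (auto intro: antisym)
    moreover have "B \<subseteq> A"
      using *(2) in_closed_iff_infdist_zero[OF props(3,4)[OF A]] infdist_nonneg[of _ A]
      by (auto intro: antisym)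
    ultimately show "A = B" by blast
  next
    assume "A = B"
    then have "hausdorff_dist A B \<le> 0"
      using hausdorff_dist_le_iff[of A B 0] props[OF A] by simp
    then show "hausdorff_dist A B = 0"
      using hausdorff_dist_nonneg[of A B] by simp
  qed
  show "hausdorff_dist A C \<le> hausdorff_dist A B + hausdorff_dist B C"
    if A: "A \<in> convex_bodies0" and B: "B \<in> convex_bodies0" and C: "C \<in> convex_bodies0"
    for A B C :: "'a set"
    unfolding hausdorff_dist_le_iff[OF props(2)[OF A] props(2)[OF C] props(4)[OF A] props(4)[OF C]]
  proof (intro conjI ballI)
    fix a assume "a \<in> A"
    then show "infdist a C \<le> hausdorff_dist A B + hausdorff_dist B C"
      using infdist_triangle_hausdorff[of B C a] infdist_le_hausdorff_dist[of A B a]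
        props[OF A] props[OF B] props[OF C] by simp
  next
    fix c assume "c \<in> C"
    then show "infdist c A \<le> hausdorff_dist A B + hausdorff_dist B C"
      using infdist_triangle_hausdorff[of B A c] infdist_le_hausdorff_dist[of C B c]
        props[OF A] props[OF B] props[OF C]
      by (simp add: hausdorff_dist_commute[of B A] hausdorff_dist_commute[of C B])
  qed
qed

definition convex_body_metric :: "'a::euclidean_space set metric" where
  "convex_body_metric = metric (convex_bodies0, hausdorff_dist)"

lemma mspace_convex_body_metric [simp]: "mspace convex_body_metric = convex_bodies0"
  by (simp add: convex_body_metric_def Metric_space.mspace_metric Metric_space_convex_bodies0)

lemma mdist_convex_body_metric [simp]: "mdist convex_body_metric = hausdorff_dist"
  by (simp add: convex_body_metric_def Metric_space.mdist_metric Metric_space_convex_bodies0)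


section \<open>Convergence in distribution in a topological space\<close>

definition borel_sigma :: "'c topology \<Rightarrow> 'c measure" where
  "borel_sigma T = sigma (topspace T) {U. openin T U}"

lemma borel_sigma_euclidean: "borel_sigma euclidean = borel"
  by (simp add: borel_sigma_def borel_def)

text \<open>
  Being random elements of the space (in particular, taking values in it) is part of the
  definition. The limit may live on a different probability space.
\<close>
definition converges_in_distribution ::
  "'c topology \<Rightarrow> 'a measure \<Rightarrow> (nat \<Rightarrow> 'a \<Rightarrow> 'c) \<Rightarrow> 'b measure \<Rightarrow> ('b \<Rightarrow> 'c) \<Rightarrow> bool" where
  "converges_in_distribution T M Z N W \<longleftrightarrow>
    (\<forall>n. Z n \<in> M \<rightarrow>\<^sub>M borel_sigma T) \<and> W \<in> N \<rightarrow>\<^sub>M borel_sigma T \<and>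
    (\<forall>f. continuous_map T euclideanreal f \<and> bounded (f ` topspace T) \<longrightarrow>
      (\<lambda>n. \<integral>\<omega>. f (Z n \<omega>) \<partial>M) \<longlonglongrightarrow> (\<integral>\<omega>. f (W \<omega>) \<partial>N))"


section \<open>Stable Levy processes\<close>

definition cadlag :: "(real \<Rightarrow> 'a::topological_space) \<Rightarrow> bool" where
  "cadlag x \<longleftrightarrow> (\<forall>t\<ge>0. (x \<longlongrightarrow> x t) (at_right t)) \<and> (\<forall>t>0. \<exists>l. (x \<longlongrightarrow> l) (at_left t))"

text \<open>
  The time set is \<open>{0..}\<close>; values at negative times play no role. All paths start at the origin
  and are cadlag (stochastic continuity follows).
\<close>
definition levy_process :: "'b measure \<Rightarrow> (real \<Rightarrow> 'b \<Rightarrow> 'a::euclidean_space) \<Rightarrow> bool" where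
  "levy_process N X \<longleftrightarrow>
    prob_space N \<and>
    (\<forall>t\<ge>0. X t \<in> borel_measurable N) \<and>
    (\<forall>\<omega>\<in>space N. X 0 \<omega> = 0 \<and> cadlag (\<lambda>t. X t \<omega>)) \<and>
    (\<forall>(m::nat) (t :: nat \<Rightarrow> real). 0 \<le> t 0 \<and> mono t \<longrightarrow>
      prob_space.indep_vars N (\<lambda>_. borel) (\<lambda>i \<omega>. X (t (Suc i)) \<omega> - X (t i) \<omega>) {..<m}) \<and>
    (\<forall>s t. 0 \<le> s \<and> s \<le> t \<longrightarrow>
      distr N borel (\<lambda>\<omega>. X t \<omega> - X s \<omega>) = distr N borel (X (t - s)))"

text \<open>
  If \<open>Z\<close> and \<open>Z'\<close> are independent with law \<open>P\<close>, then \<open>c *\<^sub>R Z + c' *\<^sub>R Z'\<close> has the law of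
  \<open>(c powr \<alpha> + c' powr \<alpha>) powr (1 / \<alpha>) *\<^sub>R Z + v\<close> for some vector \<open>v\<close>.
\<close>
definition stable_law :: "real \<Rightarrow> 'a::euclidean_space measure \<Rightarrow> bool" where
  "stable_law \<alpha> P \<longleftrightarrow>
    0 < \<alpha> \<and> \<alpha> \<le> 2 \<and> prob_space P \<and> sets P = sets borel \<and>
    (\<forall>c c'. 0 < c \<and> 0 < c' \<longrightarrow>
      (\<exists>v. distr (P \<Otimes>\<^sub>M P) borel (\<lambda>(z, z'). c *\<^sub>R z + c' *\<^sub>R z') =
           distr P borel (\<lambda>z. (c powr \<alpha> + c' powr \<alpha>) powr (1 / \<alpha>) *\<^sub>R z + v)))"

definition stable_levy_process ::
  "real \<Rightarrow> 'b measure \<Rightarrow> (real \<Rightarrow> 'b \<Rightarrow> 'a::euclidean_space) \<Rightarrow> bool" where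
  "stable_levy_process \<alpha> N X \<longleftrightarrow> levy_process N X \<and> stable_law \<alpha> (distr N borel (X 1))"

definition slowly_varying :: "(real \<Rightarrow> real) \<Rightarrow> bool" where
  "slowly_varying l \<longleftrightarrow>
    l \<in> borel_measurable borel \<and> (\<forall>\<^sub>F x in at_top. 0 < l x) \<and>
    (\<forall>c>0. ((\<lambda>x. l (c * x) / l x) \<longlongrightarrow> 1) at_top)"


section \<open>Random walks and the anisotropic rescaling\<close>

text \<open>The steps are \<open>Y 1\<close>, \<open>Y 2\<close>, and so on; \<open>Y 0\<close> is not used.\<close>
definition iid_steps :: "'a measure \<Rightarrow> (nat \<Rightarrow> 'a \<Rightarrow> 'c::euclidean_space) \<Rightarrow> bool" where
  "iid_steps M Y \<longleftrightarrow>
    prob_space M \<and> prob_space.indep_vars M (\<lambda>_. borel) Y {1..} \<and>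
    (\<forall>i\<ge>1. distr M borel (Y i) = distr M borel (Y 1))"

definition random_walk :: "(nat \<Rightarrow> 'a \<Rightarrow> 'c::euclidean_space) \<Rightarrow> nat \<Rightarrow> 'a \<Rightarrow> 'c" where
  "random_walk Y n \<omega> = (\<Sum>i=1..n. Y i \<omega>)"

text \<open>
  An orthonormal basis of \<open>real ^ 'n\<close> is a family of \<open>CARD('n)\<close> orthonormal vectors, indexed by
  \<open>'n\<close>. As the index type carries no order, the role of the first index is played below by a
  distinguished index \<open>o1 :: 'n\<close>.
\<close>
definition orthonormal_basis :: "('n::finite \<Rightarrow> real ^ 'n) \<Rightarrow> bool" where
  "orthonormal_basis e \<longleftrightarrow> (\<forall>i j. e i \<bullet> e j = (if i = j then 1 else 0))"

definition basis_coords :: "('n::finite \<Rightarrow> real ^ 'n) \<Rightarrow> real ^ 'n \<Rightarrow> real ^ 'n" where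
  "basis_coords e x = (\<chi> i. x \<bullet> e i)"

text \<open>
  The numbers that \<open>rescale\<close> divides by \<open>n\<close> (index \<open>o1\<close>) and by \<open>b n\<close> (all other indices)
  are the coordinates of \<open>x\<close> with respect to the basis \<open>e\<close>, not the standard coordinates:
  the walk drifts along \<open>e o1\<close>, and only in this direction is it of order \<open>n\<close>.
\<close>
definition rescale ::
  "('n::finite \<Rightarrow> real ^ 'n) \<Rightarrow> 'n \<Rightarrow> (nat \<Rightarrow> real) \<Rightarrow> nat \<Rightarrow> real ^ 'n \<Rightarrow> real ^ 'n" where
  "rescale e o1 b n x =
    basis_coords e (\<Sum>i\<in>UNIV. ((x \<bullet> e i) / (if i = o1 then real n else b n)) *\<^sub>R e i)"

definition limit_process ::
  "('n::finite \<Rightarrow> real ^ 'n) \<Rightarrow> 'n \<Rightarrow> real ^ 'n \<Rightarrow> (real \<Rightarrow> 'b \<Rightarrow> real ^ 'n) \<Rightarrow>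
    real \<Rightarrow> 'b \<Rightarrow> real ^ 'n" where
  "limit_process e o1 \<mu> X t \<omega> = (\<chi> i. if i = o1 then norm \<mu> * t else X t \<omega> \<bullet> e i)"

end

theory Submission
  imports Defs
begin

text \<open>
  The rescaled walk is a triangular array with i.i.d. rows whose row sums converge to \<open>Xt 1\<close>,
  and \<open>Xt\<close> is itself a Levy process. As the \<open>n\<close>-th powers of the step characteristic
  functions \<open>c n\<close> converge locally uniformly to a nowhere vanishing limit \<open>exp \<circ> L\<close>, connectedness
  gives \<open>c n = exp \<circ> ((L + o(1)) / n)\<close>, so increments over \<open>k\<close> steps converge in law whenever
  \<open>k / n\<close> converges. Hence the hulls of the walk on a grid of \<open>m\<close> times converge to the hulls
  of the path on the grid \<open>{0, 1/m, \<dots>, 1}\<close>, and the latter converge pathwise as \<open>m\<close> grows.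
  Finally the set of all values of the walk is close to the set of its values on the grid: a ball
  visited by the walk is first entered at a stopping time, with high probability the walk moves
  little between then and the next grid time, and finitely many small balls suffice.
\<close>

section \<open>Random elements of a metric space\<close>

text \<open>A union bound over times would fail: about \<open>n / m\<close> walk times lie between
  two grid times, each with its own exceptional event. The events of entering a fixed set for the
  first time at time \<open>k\<close> are disjoint and independent of the later increment, so a set
  costs one \<delta> instead of one per time. The outcome is weaker than closeness at equal times:
  each value of the walk is near some grid value. The Hausdorff distance of hulls asks for no more.

  The constants have to be chosen in the order radius, cover, \<delta>, \<open>m\<close>,
  \<open>n\<close>. The radius must not depend on \<open>m\<close>; it is read off the hull of the
  whole limit path, which contains all grid hulls of that path.

  The row sums converge because the coordinate along the drift obeys the law of large numbers, the
  other coordinates, orthogonal to the drift, obey the assumed limit theorem, and a constant limit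
  in one coordinate makes the convergence joint.

  Bounded Lipschitz test functions are used because weak convergence is uniform over them for fixed
  constants and because integrating out a coordinate preserves the class.\<close>

lemma (in Metric_space) continuous_map_Lipschitz:
  fixes f :: "'a \<Rightarrow> real"
  assumes "\<And>x y. x \<in> M \<Longrightarrow> y \<in> M \<Longrightarrow> \<bar>f x - f y\<bar> \<le> L * d x y"
  shows "continuous_map mtopology euclideanreal f"
proof -
  have "\<exists>\<delta>>0. \<forall>x. x \<in> M \<and> d a x < \<delta> \<longrightarrow> dist (f a) (f x) < \<epsilon>" if "a \<in> M" "\<epsilon> > 0" for a \<epsilon>
  \<comment> \<open>The \<open>+ 1\<close> keeps the radius positive: \<open>L\<close> carries no
    sign assumption and may be 0.\<close>
  proof (intro exI[of _ "\<epsilon> / (\<bar>L\<bar> + 1)"] conjI allI impI)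
    show "0 < \<epsilon> / (\<bar>L\<bar> + 1)" using that by (simp add: divide_pos_pos add_nonneg_pos)
    fix x assume x: "x \<in> M \<and> d a x < \<epsilon> / (\<bar>L\<bar> + 1)"
    then have "d a x * (\<bar>L\<bar> + 1) < \<epsilon>"
      by (simp add: pos_less_divide_eq add_nonneg_pos)
    moreover have "\<bar>f a - f x\<bar> \<le> L * d a x" using assms that x by blast
    moreover have "L * d a x \<le> d a x * (\<bar>L\<bar> + 1)"
      using mult_right_mono[OF abs_ge_self[of L], of "d a x"] nonneg[of a x]
      unfolding distrib_left mult.commute[of "d a x"] by linarith
    ultimately show "dist (f a) (f x) < \<epsilon>" by (simp add: dist_real_def)
  qed
  then show ?thesis
    using metric_continuous_map[OF Met_TC.Metric_space_axioms, of f] by auto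
qed

text \<open>\<open>g k\<close> is the infimal convolution of \<open>f\<close> with the cone
  \<open>k * d\<close>: penalising distance makes it \<open>k\<close>-Lipschitz. Approximation from
  below is what lower bounds on limits of expectations require.\<close>

lemma (in Metric_space) Lipschitz_approximation:
  fixes f :: "'a \<Rightarrow> real"
  assumes cont: "continuous_map mtopology euclideanreal f" and bd: "\<And>x. x \<in> M \<Longrightarrow> \<bar>f x\<bar> \<le> B"
  obtains g where "\<And>k x. x \<in> M \<Longrightarrow> g k x \<le> f x" "\<And>k x. x \<in> M \<Longrightarrow> \<bar>g k x\<bar> \<le> B"
    "\<And>k x y. x \<in> M \<Longrightarrow> y \<in> M \<Longrightarrow> \<bar>g k x - g k y\<bar> \<le> real k * d x y"
    "\<And>x. x \<in> M \<Longrightarrow> (\<lambda>k. g k x) \<longlonglongrightarrow> f x"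
proof -
  define g where "g k x = (INF y\<in>M. f y + real k * d x y)" for k x
  have lb: "- B \<le> f y + real k * d x y" if "y \<in> M" for x y k
    using bd[OF that] nonneg[of x y] mult_nonneg_nonneg[of "real k" "d x y"] by linarith
  have bdd: "bdd_below ((\<lambda>y. f y + real k * d x y) ` M)" for k x
    using lb by (auto intro!: bdd_belowI)
  have up: "g k x \<le> f y + real k * d x y" if "y \<in> M" for k x y
    unfolding g_def by (rule cINF_lower[OF bdd that])
  have up': "g k x \<le> f x" if "x \<in> M" for k x
    using up[OF that, of k x] that by simp
  have low: "- B \<le> g k x" if "x \<in> M" for k x
    unfolding g_def using lb that by (intro cINF_greatest) auto
  have one: "g k x - g k y \<le> real k * d x y" if "x \<in> M" "y \<in> M" for k x y
  proof -
    have "g k x - real k * d x y \<le> g k y" unfolding g_def[of k y]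
    proof (rule cINF_greatest)
      fix z assume z: "z \<in> M"
      have "real k * d x z \<le> real k * (d x y + d y z)"
        using triangle that z by (intro mult_left_mono) auto
      then show "g k x - real k * d x y \<le> f z + real k * d y z"
        using up[OF z, of k x] by (simp add: distrib_left)
    qed (use that in auto)
    then show ?thesis by simp
  qed
  show thesis
  proof (rule that)
    show "\<bar>g k x\<bar> \<le> B" if "x \<in> M" for k x
      using up'[OF that, of k] low[OF that, of k] bd[OF that] by linarith
    show "\<bar>g k x - g k y\<bar> \<le> real k * d x y" if "x \<in> M" "y \<in> M" for k x y
      using one[OF that, of k] one[OF that(2,1), of k] commute[of x y] by (simp add: abs_le_iff)
    show "(\<lambda>k. g k x) \<longlonglongrightarrow> f x" if x: "x \<in> M" for x
    proof (rule LIMSEQ_I)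
      fix e :: real assume e: "e > 0"
      from cont have "\<exists>\<delta>>0. \<forall>y. y \<in> M \<and> d x y < \<delta> \<longrightarrow> dist (f x) (f y) < e/2"
        using metric_continuous_map[OF Met_TC.Metric_space_axioms, of f] x e by (auto dest!: bspec[of _ _ x] spec[of _ "e/2"])
      then obtain \<delta> where \<delta>: "\<delta> > 0" "\<And>y. y \<in> M \<Longrightarrow> d x y < \<delta> \<Longrightarrow> \<bar>f x - f y\<bar> < e/2"
        by (auto simp: dist_real_def)
      \<comment> \<open>From distance \<delta> on, the penalty is at least \<open>2 * B\<close>, the
        largest possible oscillation of \<open>f\<close>, so only points near \<open>x\<close>
        compete in the infimum.\<close>
      obtain K :: nat where K: "2 * B / \<delta> \<le> real K" using real_arch_simple by blast
      show "\<exists>no. \<forall>k\<ge>no. norm (g k x - f x) < e"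
      proof (intro exI allI impI)
        fix k assume "k \<ge> K"
        then have k: "2 * B \<le> real k * \<delta>"
          using K \<delta>(1) by (simp add: pos_divide_le_eq) (smt (verit) mult_right_mono of_nat_mono)
        have "f x - e/2 \<le> g k x" unfolding g_def
        proof (rule cINF_greatest)
          fix y assume y: "y \<in> M"
          show "f x - e / 2 \<le> f y + real k * d x y"
          proof (cases "d x y < \<delta>")
            case True
            with \<delta>(2)[OF y True] mult_nonneg_nonneg[of "real k" "d x y"] nonneg[of x y]
          show ?thesis by linarith
          next
            case False
            then have "real k * \<delta> \<le> real k * d x y" by (intro mult_left_mono) auto
            then show ?thesis using k bd[OF x] bd[OF y] e by linarith
          qed
        qed (use x in auto)
        then show "norm (g k x - f x) < e" using up'[OF x, of k] e by simp
      qed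
    qed
  qed (fact up')
qed

section \<open>Borel sets of a topological space and limits of random elements\<close>

lemma space_borel_sigma [simp]: "space (borel_sigma T) = topspace T"
  unfolding borel_sigma_def by (rule space_measure_of) (auto dest: openin_subset)

lemma sets_borel_sigma: "sets (borel_sigma T) = sigma_sets (topspace T) {U. openin T U}"
  unfolding borel_sigma_def by (rule sets_measure_of) (auto dest: openin_subset)

lemma measurable_borel_sigmaI:
  assumes "\<And>x. x \<in> space M \<Longrightarrow> f x \<in> topspace T"
    and "\<And>U. openin T U \<Longrightarrow> f -` U \<inter> space M \<in> sets M"
  shows "f \<in> M \<rightarrow>\<^sub>M borel_sigma T"
  unfolding borel_sigma_def using assms
  by (intro measurable_measure_of) (auto dest: openin_subset)

lemma continuous_map_borel_sigma_measurable:
  assumes "continuous_map T euclidean f"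
  shows "f \<in> borel_sigma T \<rightarrow>\<^sub>M borel"
proof (rule borel_measurableI)
  fix S :: "'b set" assume "open S"
  then have "openin T {x \<in> topspace T. f x \<in> S}"
    using assms by (simp add: continuous_map_def)
  then have "{x \<in> topspace T. f x \<in> S} \<in> sets (borel_sigma T)"
    unfolding sets_borel_sigma by (intro sigma_sets.Basic) simp
  then show "f -` S \<inter> space (borel_sigma T) \<in> sets (borel_sigma T)"
    by (simp add: vimage_def Int_def conj_commute)
qed

text \<open>The limit lies in an open \<open>U\<close> iff the approximants are eventually in one of
  countably many open sets \<open>G p\<close>, each of which keeps a margin to the complement of
  \<open>U\<close>.\<close>

lemma (in Metric_space) measurable_borel_sigma_limit:
  assumes meas: "\<And>k. W k \<in> N \<rightarrow>\<^sub>M borel_sigma mtopology"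
    and V: "\<And>x. x \<in> space N \<Longrightarrow> V x \<in> M"
    and lim: "\<And>x. x \<in> space N \<Longrightarrow> (\<lambda>k. d (W k x) (V x)) \<longlonglongrightarrow> 0"
  shows "V \<in> N \<rightarrow>\<^sub>M borel_sigma mtopology"
proof (rule measurable_borel_sigmaI)
  show "V x \<in> topspace mtopology" if "x \<in> space N" for x using V that by simp
  fix U assume U: "openin mtopology U"
  have WM: "W k x \<in> M" if "x \<in> space N" for k x
    using measurable_space[OF meas that] by simp
  \<comment> \<open>The balls keep their doubles inside \<open>U\<close>: a limit of points of
    \<open>G p\<close> need not belong to \<open>G p\<close>, but it lies in one of the doubled
    balls.\<close>
  define G where "G p = (\<Union>x\<in>{x\<in>M. mball x (2 / Suc p) \<subseteq> U}. mball x (1 / Suc p))" for p :: nat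
  have "V x \<in> U \<longleftrightarrow> (\<exists>p K. \<forall>k\<ge>K. W k x \<in> G p)" if x: "x \<in> space N" for x
  proof
    assume "V x \<in> U"
    then obtain r where r: "r > 0" "mball (V x) r \<subseteq> U" using U by (auto simp: openin_mtopology)
    obtain p :: nat where p: "inverse (real (Suc p)) < r / 2"
      using reals_Archimedean[of "r/2"] r by auto
    have "mball (V x) (2 / Suc p) \<subseteq> mball (V x) r"
      using p by (intro mball_subset_concentric) (simp add: field_simps)
    with r(2) have sub: "mball (V x) (2 / Suc p) \<subseteq> U" by (rule order.trans[rotated])
    have "\<forall>\<^sub>F k in sequentially. d (W k x) (V x) < 1 / Suc p"
      using lim[OF x] by (rule order_tendstoD) simp
    then obtain K where K: "\<And>k. k \<ge> K \<Longrightarrow> d (W k x) (V x) < 1 / Suc p"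
      by (auto simp: eventually_sequentially)
    have "W k x \<in> G p" if "k \<ge> K" for k
      unfolding G_def using sub V[OF x] WM[OF x] K[OF that] commute
      by (auto intro!: bexI[of _ "V x"])
    then show "\<exists>p K. \<forall>k\<ge>K. W k x \<in> G p" by blast
  next
    assume "\<exists>p K. \<forall>k\<ge>K. W k x \<in> G p"
    then obtain p K where K: "\<And>k. k \<ge> K \<Longrightarrow> W k x \<in> G p" by blast
    have "\<forall>\<^sub>F k in sequentially. d (W k x) (V x) < 1 / Suc p"
      using lim[OF x] by (rule order_tendstoD) simp
    then have "\<forall>\<^sub>F k in sequentially. d (W k x) (V x) < 1 / Suc p \<and> W k x \<in> G p"
      using eventually_ge_at_top[of K] by eventually_elim (use K in auto)
    then obtain k where k: "d (W k x) (V x) < 1 / Suc p" "W k x \<in> G p"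
      by (auto dest!: eventually_happens)
    then obtain y where y: "y \<in> M" "mball y (2 / Suc p) \<subseteq> U" "d y (W k x) < 1 / Suc p"
      by (auto simp: G_def)
    have "d y (V x) \<le> d y (W k x) + d (W k x) (V x)"
      using triangle y(1) WM V x by blast
    also have "\<dots> < 2 / Suc p" using k(1) y(3) by (simp add: field_simps)
    finally show "V x \<in> U" using y V[OF x] by auto
  qed
  then have "V -` U \<inter> space N = (\<Union>p. \<Union>K. \<Inter>k\<in>{K..}. W k -` G p \<inter> space N)"
    by (auto simp: Ball_def) blast+
  moreover have "W k -` G p \<inter> space N \<in> sets N" for k p
  proof (rule measurable_sets[OF meas])
    have "openin mtopology (G p)" unfolding G_def by (intro openin_Union) auto
    then show "G p \<in> sets (borel_sigma mtopology)" by (auto simp: sets_borel_sigma)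
  qed
  ultimately show "V -` U \<inter> space N \<in> sets N"
    by (simp only:) (intro sets.countable_UN sets.countable_INT' image_subsetI; auto)
qed

text \<open>Lipschitz approximation of a continuous \<open>f\<close> from below bounds the limit
  inferior of the expectations from below; the same bound for \<open>- f\<close> is the upper
  half.\<close>

lemma (in Metric_space) converges_in_distribution_Lipschitz:
  assumes "prob_space P" "prob_space N"
    and Z: "\<And>n. Z n \<in> P \<rightarrow>\<^sub>M borel_sigma mtopology" and W: "W \<in> N \<rightarrow>\<^sub>M borel_sigma mtopology"
    and lim: "\<And>f L B. (\<And>x y. x \<in> M \<Longrightarrow> y \<in> M \<Longrightarrow> \<bar>f x - f y\<bar> \<le> L * d x y) \<Longrightarrow>
      (\<And>x. x \<in> M \<Longrightarrow> \<bar>f x\<bar> \<le> B) \<Longrightarrow>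
      (\<lambda>n. \<integral>\<omega>. f (Z n \<omega>) \<partial>P) \<longlonglongrightarrow> (\<integral>\<omega>. f (W \<omega>) \<partial>N)"
  shows "converges_in_distribution mtopology P Z N W"
proof -
  interpret P: prob_space P by fact
  interpret N: prob_space N by fact
  have int: "integrable P (\<lambda>\<omega>. f (Z n \<omega>))" "integrable N (\<lambda>\<omega>. f (W \<omega>))"
    if "continuous_map mtopology euclideanreal f" "\<And>x. x \<in> M \<Longrightarrow> \<bar>f x\<bar> \<le> B" for f B n
  proof -
    note [measurable] = continuous_map_borel_sigma_measurable[OF that(1)] Z W
    show "integrable P (\<lambda>\<omega>. f (Z n \<omega>))"
      using measurable_space[OF Z] that(2) by (intro P.integrable_const_bound[of _ B] AE_I2) auto
    show "integrable N (\<lambda>\<omega>. f (W \<omega>))"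
      using measurable_space[OF W] that(2) by (intro N.integrable_const_bound[of _ B] AE_I2) auto
  qed
  have key: "\<forall>\<^sub>F n in sequentially. (\<integral>\<omega>. f (W \<omega>) \<partial>N) - e < (\<integral>\<omega>. f (Z n \<omega>) \<partial>P)"
    if f: "continuous_map mtopology euclideanreal f" "\<And>x. x \<in> M \<Longrightarrow> \<bar>f x\<bar> \<le> B" and e: "e > 0" for f B e
  proof -
    obtain g where g: "\<And>k x. x \<in> M \<Longrightarrow> g k x \<le> f x" "\<And>k x. x \<in> M \<Longrightarrow> \<bar>g k x\<bar> \<le> B"
      "\<And>k x y. x \<in> M \<Longrightarrow> y \<in> M \<Longrightarrow> \<bar>g k x - g k y\<bar> \<le> real k * d x y"
      "\<And>x. x \<in> M \<Longrightarrow> (\<lambda>k. g k x) \<longlonglongrightarrow> f x"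
      using Lipschitz_approximation[OF f] by metis
    have gc: "continuous_map mtopology euclideanreal (g k)" for k
      by (rule continuous_map_Lipschitz[of _ "real k"]) (rule g(3))
    note [measurable] = continuous_map_borel_sigma_measurable[OF f(1)]
      continuous_map_borel_sigma_measurable[OF gc] Z W
    have "(\<lambda>k. \<integral>\<omega>. g k (W \<omega>) \<partial>N) \<longlonglongrightarrow> (\<integral>\<omega>. f (W \<omega>) \<partial>N)"
      using g measurable_space[OF W]
      by (intro integral_dominated_convergence[where w="\<lambda>_. B"] AE_I2) auto
    then have "\<forall>\<^sub>F k in sequentially. (\<integral>\<omega>. f (W \<omega>) \<partial>N) - e < (\<integral>\<omega>. g k (W \<omega>) \<partial>N)"
      by (rule order_tendstoD) (use e in simp)
    then obtain k where k: "(\<integral>\<omega>. f (W \<omega>) \<partial>N) - e < (\<integral>\<omega>. g k (W \<omega>) \<partial>N)"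
      by (auto dest!: eventually_happens)
    have "(\<lambda>n. \<integral>\<omega>. g k (Z n \<omega>) \<partial>P) \<longlonglongrightarrow> (\<integral>\<omega>. g k (W \<omega>) \<partial>N)"
      by (rule lim[of "g k" "real k" B]) (use g in auto)
    then have "\<forall>\<^sub>F n in sequentially. (\<integral>\<omega>. f (W \<omega>) \<partial>N) - e < (\<integral>\<omega>. g k (Z n \<omega>) \<partial>P)"
      using k by (rule order_tendstoD)
    then show ?thesis
    proof eventually_elim
      case (elim n)
      also have "(\<integral>\<omega>. g k (Z n \<omega>) \<partial>P) \<le> (\<integral>\<omega>. f (Z n \<omega>) \<partial>P)"
        using int(1)[OF gc g(2)] int(1)[OF f] g(1) measurable_space[OF Z]
        by (intro integral_mono) auto
      finally show ?case .
    qed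
  qed
  have "(\<lambda>n. \<integral>\<omega>. f (Z n \<omega>) \<partial>P) \<longlonglongrightarrow> (\<integral>\<omega>. f (W \<omega>) \<partial>N)"
    if f: "continuous_map mtopology euclideanreal f" "bounded (f ` M)" for f
  proof -
    obtain B where B: "\<And>x. x \<in> M \<Longrightarrow> \<bar>f x\<bar> \<le> B" using f(2) by (auto simp: bounded_iff)
    have fm: "continuous_map mtopology euclideanreal (\<lambda>x. - f x)"
      using f(1) by (intro continuous_intros)
    show ?thesis
    proof (rule tendstoI)
      fix e :: real assume e: "e > 0"
      have "\<forall>\<^sub>F n in sequentially. (\<integral>\<omega>. f (W \<omega>) \<partial>N) - e < (\<integral>\<omega>. f (Z n \<omega>) \<partial>P)"
        by (rule key[OF f(1) _ e, of B]) (use B in simp)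
      moreover have "\<forall>\<^sub>F n in sequentially. (\<integral>\<omega>. - f (W \<omega>) \<partial>N) - e < (\<integral>\<omega>. - f (Z n \<omega>) \<partial>P)"
        by (rule key[OF fm _ e, of B]) (use B in simp)
      ultimately show "\<forall>\<^sub>F n in sequentially. dist (\<integral>\<omega>. f (Z n \<omega>) \<partial>P) (\<integral>\<omega>. f (W \<omega>) \<partial>N) < e"
        by eventually_elim (auto simp: dist_real_def abs_if)
    qed
  qed
  then show ?thesis using Z W by (auto simp: converges_in_distribution_def)
qed

section \<open>Hulls of finite sets and of cadlag paths\<close>

lemma convex_hull_finite_in_convex_bodies0:
  fixes v :: "'i \<Rightarrow> 'c::euclidean_space"
  assumes "finite I"
  shows "convex hull (insert 0 (v ` I)) \<in> convex_bodies0"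
  using assms by (auto simp: convex_bodies0_def intro: finite_imp_compact_convex_hull hull_inc)

text \<open>The Minkowski sum of a convex hull with the ball of radius \<open>r\<close> is convex,
  so it contains the other hull as soon as it contains the generators of that hull.\<close>

lemma hausdorff_dist_convex_hull_le:
  fixes A B :: "'c::euclidean_space set"
  assumes "bounded A" "bounded B" "A \<noteq> {}" "B \<noteq> {}"
    and AB: "\<And>a. a \<in> A \<Longrightarrow> \<exists>b\<in>B. dist a b \<le> r"
    and BA: "\<And>b. b \<in> B \<Longrightarrow> \<exists>a\<in>A. dist a b \<le> r"
  shows "hausdorff_dist (convex hull A) (convex hull B) \<le> r"
proof -
  have *: "infdist x (convex hull D) \<le> r"
    if CD: "\<And>c. c \<in> C \<Longrightarrow> \<exists>d\<in>D. dist c d \<le> r" and x: "x \<in> convex hull C"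
    for C D :: "'c set" and x
  proof -
    have "C \<subseteq> {d + y | d y. d \<in> convex hull D \<and> y \<in> cball 0 r}" (is "_ \<subseteq> ?T")
    proof
      fix c assume "c \<in> C"
      then obtain d where d: "d \<in> D" "dist c d \<le> r" using CD by blast
      then have "c = d + (c - d)" "d \<in> convex hull D" "c - d \<in> cball 0 r"
        by (auto intro: hull_inc simp: dist_norm norm_minus_commute)
      then show "c \<in> ?T" by blast
    qed
    moreover have "convex ?T"
    proof -
      have "?T = (\<Union>d\<in>convex hull D. \<Union>y\<in>cball 0 r. {d + y})" by fastforce
      then show ?thesis using convex_sums[of "convex hull D" "cball 0 r"] by simp
    qed
    ultimately have "convex hull C \<subseteq> ?T" by (rule hull_minimal)
    with x obtain d y where dy: "d \<in> convex hull D" "norm y \<le> r" "x = d + y" by auto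
    have "infdist x (convex hull D) \<le> dist x d" by (rule infdist_le[OF dy(1)])
    then show ?thesis using dy by (simp add: dist_norm)
  qed
  show ?thesis
    using assms *[of A B] *[of B A]
    by (subst hausdorff_dist_le_iff) (auto simp: bounded_convex_hull convex_hull_eq_empty dist_commute)
qed

lemma hausdorff_dist_convex_hull_image_le:
  fixes v w :: "'i \<Rightarrow> 'c::euclidean_space"
  assumes "finite I" "\<And>i. i \<in> I \<Longrightarrow> dist (v i) (w i) \<le> r" "0 \<le> r"
  shows "hausdorff_dist (convex hull (insert 0 (v ` I))) (convex hull (insert 0 (w ` I))) \<le> r"
  using assms by (intro hausdorff_dist_convex_hull_le) (auto simp: finite_imp_bounded)

text \<open>By the bound for generators the hull depends continuously on the family of generators,
  so open sets of bodies pull back to open sets of families.\<close>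

lemma measurable_convex_hull:
  fixes V :: "nat \<Rightarrow> 'a \<Rightarrow> 'c::euclidean_space"
  assumes I: "finite I" and V: "\<And>i. i \<in> I \<Longrightarrow> V i \<in> borel_measurable M"
  shows "(\<lambda>\<omega>. convex hull (insert 0 ((\<lambda>i. V i \<omega>) ` I)))
    \<in> M \<rightarrow>\<^sub>M borel_sigma (mtopology_of convex_body_metric)"
proof (rule measurable_borel_sigmaI)
  interpret K: Metric_space "convex_bodies0 :: 'c set set" hausdorff_dist
    by (rule Metric_space_convex_bodies0)
  have top: "mtopology_of (convex_body_metric :: 'c set metric) = K.mtopology"
    by (simp add: mtopology_of_def)
  define H where "H v = convex hull (insert 0 (v ` I))" for v :: "nat \<Rightarrow> 'c"
  have H: "H v \<in> convex_bodies0" for v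
    unfolding H_def by (rule convex_hull_finite_in_convex_bodies0[OF I])
  show "convex hull (insert 0 ((\<lambda>i. V i \<omega>) ` I)) \<in> topspace (mtopology_of convex_body_metric)" for \<omega>
    using convex_hull_finite_in_convex_bodies0[OF I] by (simp add: top)
  fix U :: "'c set set" assume "openin (mtopology_of convex_body_metric) U"
  then have U: "openin K.mtopology U" by (simp add: top)
  have "open {v. H v \<in> U}"
  proof (subst open_subopen, intro ballI)
    fix v assume "v \<in> {v. H v \<in> U}"
    then obtain r where r: "r > 0" "K.mball (H v) r \<subseteq> U"
      using U by (auto simp: K.openin_mtopology)
    \<comment> \<open>Only the finitely many coordinates in \<open>I\<close> are constrained, so
      this neighbourhood is open in the product topology.\<close>
    let ?T = "\<Inter>i\<in>I. {w :: nat \<Rightarrow> 'c. dist (v i) (w i) < r / 2}"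
    have "open ?T"
      using I by (intro open_INT ballI open_Collect_less continuous_intros
          continuous_on_product_coordinates)
    moreover have "v \<in> ?T" using r by simp
    moreover have "?T \<subseteq> {v. H v \<in> U}"
    proof
      fix w assume w: "w \<in> ?T"
      have "hausdorff_dist (H v) (H w) \<le> r / 2"
        unfolding H_def using w r I by (intro hausdorff_dist_convex_hull_image_le) auto
      then have "H w \<in> K.mball (H v) r" using H r by simp
      then show "w \<in> {v. H v \<in> U}" using r by auto
    qed
    ultimately show "\<exists>T. open T \<and> v \<in> T \<and> T \<subseteq> {v. H v \<in> U}" by blast
  qed
  then have "{v. H v \<in> U} \<in> sets borel" by simp
  \<comment> \<open>Measurability of \<open>V i\<close> is known for \<open>i\<close> in
    \<open>I\<close> only; the remaining coordinates, which the hull does not see, are set to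
    0.\<close>
  moreover have "(\<lambda>\<omega> i. if i \<in> I then V i \<omega> else 0) \<in> borel_measurable M"
  proof (rule measurable_coordinatewise_then_product)
    show "(\<lambda>\<omega>. if i \<in> I then V i \<omega> else 0) \<in> borel_measurable M" for i
      using V by (cases "i \<in> I") auto
  qed
  ultimately have "(\<lambda>\<omega> i. if i \<in> I then V i \<omega> else 0) -` {v. H v \<in> U} \<inter> space M \<in> sets M"
    by (rule measurable_sets[rotated])
  moreover have "H (\<lambda>i. if i \<in> I then V i \<omega> else 0) = convex hull (insert 0 ((\<lambda>i. V i \<omega>) ` I))" for \<omega>
    unfolding H_def by (intro arg_cong[where f="\<lambda>S. convex hull (insert 0 S)"] image_cong) auto
  ultimately show "(\<lambda>\<omega>. convex hull (insert 0 ((\<lambda>i. V i \<omega>) ` I))) -` U \<inter> space M \<in> sets M"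
    by (simp add: vimage_def)
qed

text \<open>The distance to \<open>{0}\<close> is the radius of \<open>K\<close> about the origin.
  It measures the size of a random body by a continuous functional.\<close>

lemma norm_le_hausdorff_dist_0:
  fixes K :: "'c::euclidean_space set"
  assumes "K \<in> convex_bodies0" "x \<in> K"
  shows "norm x \<le> hausdorff_dist {0} K"
  using assms infdist_le_hausdorff_dist[of K "{0}" x]
  by (auto simp: hausdorff_dist_commute convex_bodies0_def compact_imp_bounded)

lemma hausdorff_dist_0_le:
  fixes K :: "'c::euclidean_space set"
  assumes "K \<in> convex_bodies0" "\<And>x. x \<in> K \<Longrightarrow> norm x \<le> r"
  shows "hausdorff_dist {0} K \<le> r"
proof -
  have K: "bounded K" "0 \<in> K" "K \<noteq> {}" using assms by (auto simp: convex_bodies0_def compact_imp_bounded)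
  then have "0 \<le> r" using assms(2)[of 0] by simp
  with K assms(2) show ?thesis by (subst hausdorff_dist_le_iff) auto
qed

text \<open>Near each time the path stays in two unit balls, one around its value and one around its
  left limit; compactness of \<open>{0..T}\<close> does the rest.\<close>

lemma cadlag_bounded:
  fixes x :: "real \<Rightarrow> 'c::metric_space"
  assumes "cadlag x"
  shows "bounded (x ` {0..T})"
proof -
  have loc: "\<exists>U. open U \<and> t \<in> U \<and> bounded (x ` (U \<inter> {0..}))" if t: "t \<ge> 0" for t
  proof -
    have "(x \<longlongrightarrow> x t) (at_right t)" using assms t by (auto simp: cadlag_def)
    then have "\<forall>\<^sub>F s in at_right t. dist (x s) (x t) < 1" by (rule tendstoD) simp
    then obtain b where b: "b > t" "\<And>s. t < s \<Longrightarrow> s < b \<Longrightarrow> dist (x s) (x t) < 1"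
      by (auto simp: eventually_at_right_field)
    obtain a l where a: "a < t" "\<And>s. s \<ge> 0 \<Longrightarrow> a < s \<Longrightarrow> s < t \<Longrightarrow> dist (x s) l < 1"
    proof (cases "t > 0")
      case True
      then obtain l where "(x \<longlongrightarrow> l) (at_left t)" using assms by (auto simp: cadlag_def)
      then have "\<forall>\<^sub>F s in at_left t. dist (x s) l < 1" by (rule tendstoD) simp
      then show thesis using that by (auto simp: eventually_at_left_field)
    next
      case False
      \<comment> \<open>Here \<open>t\<close> is 0: no left limit is available, but no time in
        \<open>{0..}\<close> lies to the left either, so any negative \<open>a\<close> will
        do.\<close>
      with t that[of "t - 1" "x t"] show thesis by auto
    qed
    have "x ` ({a<..<b} \<inter> {0..}) \<subseteq> ball (x t) 1 \<union> ball l 1"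
    proof (rule image_subsetI)
      fix s assume "s \<in> {a<..<b} \<inter> {0..}"
      then show "x s \<in> ball (x t) 1 \<union> ball l 1" using a(2)[of s] b(2)[of s]
        by (cases s t rule: linorder_cases) (auto simp: dist_commute)
    qed
    then have "bounded (x ` ({a<..<b} \<inter> {0..}))"
      by (rule bounded_subset[rotated]) simp
    then show ?thesis using a b by (intro exI[of _ "{a<..<b}"]) auto
  qed
  then obtain U where U: "\<And>t. t \<ge> 0 \<Longrightarrow> open (U t) \<and> t \<in> U t \<and> bounded (x ` (U t \<inter> {0..}))"
    by metis
  obtain C where C: "C \<subseteq> {0..T}" "finite C" "{0..T} \<subseteq> (\<Union>t\<in>C. U t)"
    by (rule compactE_image[OF compact_Icc, of "{0..T}" U 0 T]) (use U in \<open>auto intro!: \<close>)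
  have "x ` {0..T} \<subseteq> (\<Union>t\<in>C. x ` (U t \<inter> {0..}))" using C(3) by fastforce
  moreover have "bounded (\<Union>t\<in>C. x ` (U t \<inter> {0..}))"
    using C U by (intro bounded_UN) auto
  ultimately show ?thesis by (rule bounded_subset[rotated])
qed

lemma convex_hull_closure_path_in_convex_bodies0:
  fixes x :: "real \<Rightarrow> 'c::euclidean_space"
  assumes "cadlag x" "x 0 = 0"
  shows "convex hull (closure (x ` {0..1})) \<in> convex_bodies0"
proof -
  have "0 \<in> x ` {0..1}" using assms(2) by (intro image_eqI[of _ _ 0]) auto
  then have "0 \<in> convex hull (closure (x ` {0..1}))"
    by (intro hull_inc subsetD[OF closure_subset])
  then show ?thesis
    using cadlag_bounded[OF assms(1), of 1]
    by (simp add: convex_bodies0_def convex_convex_hull compact_convex_hull)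
qed

text \<open>The compact closure has a finite net consisting of path values at finitely many times.
  Moving these times to a fine grid changes the values little, so the grid values come close to the
  whole closed path.\<close>

lemma cadlag_grid_hull_limit:
  fixes x :: "real \<Rightarrow> 'c::euclidean_space"
  assumes x: "cadlag x" "x 0 = 0"
  shows "(\<lambda>m. hausdorff_dist (convex hull (insert 0 ((\<lambda>j. x (real j / real m)) ` {..m})))
    (convex hull (closure (x ` {0..1})))) \<longlonglongrightarrow> 0"
proof (rule LIMSEQ_I)
  let ?D = "\<lambda>m. hausdorff_dist (convex hull (insert 0 ((\<lambda>j. x (real j / real m)) ` {..m})))
    (convex hull (closure (x ` {0..1})))"
  fix e :: real assume e: "e > 0"
  let ?R = "x ` {0..1}"
  have bdd: "bounded (closure ?R)" using cadlag_bounded[OF x(1)] by (rule bounded_closure)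
  have "compact (closure ?R)" using cadlag_bounded[OF x(1)] by simp
  then obtain C where C: "C \<subseteq> ?R" "finite C" "closure ?R \<subseteq> (\<Union>c\<in>C. ball c (e/4))"
  proof (rule compactE_image[of "closure ?R" ?R "\<lambda>c. ball c (e/4)"])
    show "closure ?R \<subseteq> (\<Union>c\<in>?R. ball c (e / 4))"
    proof
      fix y assume "y \<in> closure ?R"
      moreover have "e/4 > 0" using e by simp
      ultimately have "\<exists>c\<in>?R. dist c y < e/4"
        unfolding closure_approachable by blast
      then show "y \<in> (\<Union>c\<in>?R. ball c (e / 4))" by (simp only: UN_iff mem_ball)
    qed
  qed (use e in auto)
  \<comment> \<open>Times are rounded up because cadlag paths are continuous only from the
    right.\<close>
  have lim: "\<forall>\<^sub>F m in sequentially. dist (x (real_of_int \<lceil>t * real m\<rceil> / real m)) (x t) < e/4"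
    if t: "t \<in> {0..1}" for t
  proof -
    have grid_t: "(\<lambda>m. real_of_int \<lceil>t * real m\<rceil> / real m) \<longlonglongrightarrow> t"
    proof (rule real_tendsto_sandwich)
      show "\<forall>\<^sub>F m in sequentially. t \<le> real_of_int \<lceil>t * real m\<rceil> / real m"
        using eventually_gt_at_top[of 0] by eventually_elim (simp add: pos_le_divide_eq)
      show "\<forall>\<^sub>F m in sequentially. real_of_int \<lceil>t * real m\<rceil> / real m \<le> t + 1 / real m"
        using eventually_gt_at_top[of 0]
      proof eventually_elim
        case (elim m)
        have "real_of_int \<lceil>t * real m\<rceil> \<le> t * real m + 1" by linarith
        then show ?case using elim by (simp add: field_simps)
      qed
      show "(\<lambda>m. t + 1 / real m) \<longlonglongrightarrow> t"
        using tendsto_add[OF tendsto_const lim_1_over_n, of t] by simp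
    qed simp
    have "(x \<longlongrightarrow> x t) (at_right t)" using x t by (auto simp: cadlag_def)
    then have "\<forall>\<^sub>F s in at_right t. dist (x s) (x t) < e/4" by (rule tendstoD) (use e in simp)
    then obtain b where b: "b > t" "\<And>s. t < s \<Longrightarrow> s < b \<Longrightarrow> dist (x s) (x t) < e/4"
      by (auto simp: eventually_at_right_field)
    from grid_t b(1) have "\<forall>\<^sub>F m in sequentially. real_of_int \<lceil>t * real m\<rceil> / real m < b"
      by (rule order_tendstoD(2))
    then show ?thesis using eventually_gt_at_top[of 0]
    proof eventually_elim
      case (elim m)
      have "t \<le> real_of_int \<lceil>t * real m\<rceil> / real m" using elim by (simp add: pos_le_divide_eq)
      then show ?case using b(2)[of "real_of_int \<lceil>t * real m\<rceil> / real m"] elim e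
        by (cases "t = real_of_int \<lceil>t * real m\<rceil> / real m") auto
    qed
  qed
  obtain T where T: "T \<subseteq> {0..1}" "finite T" "C = x ` T"
    using finite_subset_image[OF C(2,1)] by blast
  have "\<forall>\<^sub>F m in sequentially. \<forall>t\<in>T. dist (x (real_of_int \<lceil>t * real m\<rceil> / real m)) (x t) < e/4"
    using lim T by (intro eventually_ball_finite) auto
  then have "\<forall>\<^sub>F m in sequentially. ?D m \<le> e / 2"
    using eventually_gt_at_top[of 0]
  proof eventually_elim
    case (elim m)
    have grid: "insert 0 ((\<lambda>j. x (real j / real m)) ` {..m}) \<subseteq> ?R"
      using elim(2) x(2) by (auto simp: divide_le_eq intro!: imageI image_eqI[of 0 x 0])
    show ?case
    proof (rule hausdorff_dist_convex_hull_le)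
      fix a assume "a \<in> insert 0 ((\<lambda>j. x (real j / real m)) ` {..m})"
      then show "\<exists>b\<in>closure ?R. dist a b \<le> e / 2"
        using grid closure_subset[of ?R] e by (intro bexI[of _ a]) auto
    next
      fix b assume "b \<in> closure ?R"
      then obtain t where t: "t \<in> T" "dist (x t) b < e/4" using C T by auto
      then have t01: "0 \<le> t" "t \<le> 1" using T by auto
      define j where "j = nat \<lceil>t * real m\<rceil>"
      have j: "real j = real_of_int \<lceil>t * real m\<rceil>" using t01 by (simp add: j_def)
      have "j \<le> m" using t01 by (simp add: j_def ceiling_le_iff mult_left_le_one_le)
      moreover have "dist (x (real j / real m)) (x t) < e/4" using elim t by (simp add: j)
      ultimately show "\<exists>a\<in>insert 0 ((\<lambda>j. x (real j / real m)) ` {..m}). dist a b \<le> e/2"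
        using t(2) dist_triangle[of "x (real j / real m)" b "x t"]
        by (intro bexI[of _ "x (real j / real m)"]) auto
    qed (use bdd x in \<open>auto simp: finite_imp_bounded\<close>)
  qed
  then obtain k where k: "\<And>m. m \<ge> k \<Longrightarrow> ?D m \<le> e / 2"
    by (auto simp: eventually_sequentially)
  show "\<exists>no. \<forall>m\<ge>no. norm (?D m - 0) < e"
  proof (intro exI allI impI)
    fix m assume "k \<le> m"
    from k[OF this] show "norm (?D m - 0) < e"
      using e by (simp add: abs_of_nonneg[OF hausdorff_dist_nonneg])
  qed
qed

section \<open>Weak convergence and characteristic functions\<close>

definition borel_prob :: "'c::euclidean_space measure \<Rightarrow> bool" where
  "borel_prob P \<longleftrightarrow> prob_space P \<and> sets P = sets borel"

definition weakly_converges :: "(nat \<Rightarrow> 'c::euclidean_space measure) \<Rightarrow> 'c measure \<Rightarrow> bool" where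
  "weakly_converges P Q \<longleftrightarrow> (\<forall>f :: 'c \<Rightarrow> real. continuous_on UNIV f \<and> bounded (range f) \<longrightarrow>
    (\<lambda>n. \<integral>x. f x \<partial>P n) \<longlonglongrightarrow> (\<integral>x. f x \<partial>Q))"

definition char_fun :: "'c::euclidean_space measure \<Rightarrow> 'c \<Rightarrow> complex" where
  "char_fun P u = (\<integral>x. cis (u \<bullet> x) \<partial>P)"

lemma borel_prob_distr:
  assumes "prob_space M" "X \<in> borel_measurable M"
  shows "borel_prob (distr M borel X)"
  using assms by (simp add: borel_prob_def prob_space.prob_space_distr)

lemma borel_prob_measurable:
  assumes "borel_prob P" shows "f \<in> borel_measurable P \<longleftrightarrow> f \<in> borel_measurable borel"
  using assms by (simp add: borel_prob_def measurable_cong_sets[of P borel borel borel])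

lemma borel_prob_integrable:
  fixes f :: "'c::euclidean_space \<Rightarrow> 'd::{banach, second_countable_topology}"
  assumes "borel_prob P" "f \<in> borel_measurable borel" "\<And>x. norm (f x) \<le> B"
  shows "integrable P f"
proof -
  interpret prob_space P using assms by (simp add: borel_prob_def)
  show ?thesis
    using assms by (intro integrable_const_bound[of _ B]) (auto simp: borel_prob_measurable)
qed

section \<open>Bounds for expectations and tails\<close>

lemma (in prob_space) expectation_diff_le:
  fixes f g h :: "'a \<Rightarrow> real"
  assumes "integrable M f" "integrable M g" "integrable M h"
    and "\<And>x. x \<in> space M \<Longrightarrow> \<bar>f x - g x\<bar> \<le> h x"
  shows "\<bar>expectation f - expectation g\<bar> \<le> expectation h"
proof -
  have "\<bar>expectation f - expectation g\<bar> = \<bar>\<integral>x. f x - g x \<partial>M\<bar>"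
    using assms by simp
  also have "\<dots> \<le> (\<integral>x. \<bar>f x - g x\<bar> \<partial>M)" by (rule integral_abs_bound)
  also have "\<dots> \<le> expectation h" using assms by (intro integral_mono) auto
  finally show ?thesis .
qed

lemma (in prob_space) prob_le_expectation:
  assumes "A \<in> events" "integrable M g"
    and "\<And>x. x \<in> space M \<Longrightarrow> 0 \<le> g x" "\<And>x. x \<in> A \<Longrightarrow> 1 \<le> g x"
  shows "prob A \<le> expectation g"
proof -
  have i: "integrable M (indicat_real A)"
    using assms(1) by (simp add: integrable_indicator_iff emeasure_eq_measure)
  have "prob A = (\<integral>x. indicator A x \<partial>M)" using assms(1) by simp
  also have "\<dots> \<le> expectation g"
    by (rule integral_mono[OF i assms(2)]) (use assms in \<open>auto simp: indicator_def\<close>)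
  finally show ?thesis .
qed

text \<open>The truncated excess is a continuous stand-in for the tail probability, so that tail
  bounds pass through weak limits.\<close>

lemma (in prob_space) truncated_tail:
  assumes [measurable]: "Z \<in> borel_measurable M" and e: "0 < e"
  obtains R :: nat where "(\<integral>x. min 1 (max 0 (Z x - real R)) \<partial>M) < e"
proof -
  have "(\<lambda>R::nat. \<integral>x. min 1 (max 0 (Z x - real R)) \<partial>M) \<longlonglongrightarrow> (\<integral>x. 0 \<partial>M)"
  proof (rule integral_dominated_convergence[where w="\<lambda>_. 1"])
    show "AE x in M. (\<lambda>R. min 1 (max 0 (Z x - real R))) \<longlonglongrightarrow> 0"
    proof (rule AE_I2, rule tendsto_eventually)
      fix x
      obtain n :: nat where "Z x \<le> real n" using real_arch_simple by blast
      then show "\<forall>\<^sub>F R in sequentially. min 1 (max 0 (Z x - real R)) = 0"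
        by (auto simp: eventually_sequentially intro!: exI[of _ n])
    qed
  qed auto
  then have "\<forall>\<^sub>F R::nat in sequentially. (\<integral>x. min 1 (max 0 (Z x - real R)) \<partial>M) < e"
    by (rule order_tendstoD) (simp add: e)
  then show thesis using that by (auto dest!: eventually_happens)
qed

lemma borel_prob_tail:
  assumes "borel_prob (Q :: 'c::euclidean_space measure)" "0 < e"
  obtains R :: nat where "(\<integral>x. min 1 (max 0 (norm x - real R)) \<partial>Q) < e"
proof -
  interpret prob_space Q using assms by (simp add: borel_prob_def)
  have "norm \<in> borel_measurable Q" by (simp add: borel_prob_measurable[OF assms(1)])
  then show thesis using assms(2) by (rule truncated_tail) (rule that)
qed

text \<open>A partition of unity over a finite cover of a large ball, fixed independently of
  \<open>f\<close>, approximates every such \<open>f\<close> by interpolation at the centres. The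
  interpolations involve finitely many weights, so convergence of their integrals settles all
  \<open>f\<close> at once. The uniformity serves characteristic functions on balls and sections of
  functions of several variables.\<close>

lemma weakly_converges_uniform:
  fixes P :: "nat \<Rightarrow> 'c::euclidean_space measure"
  assumes P: "\<And>n. borel_prob (P n)" and Q: "borel_prob Q" and w: "weakly_converges P Q" and e: "0 < e"
  shows "\<forall>\<^sub>F n in sequentially. \<forall>f :: 'c \<Rightarrow> real. (\<forall>x. \<bar>f x\<bar> \<le> B) \<and> (\<forall>x y. \<bar>f x - f y\<bar> \<le> L * dist x y) \<longrightarrow>
    \<bar>(\<integral>x. f x \<partial>P n) - (\<integral>x. f x \<partial>Q)\<bar> \<le> e"
proof -
  define K where "K = \<bar>B\<bar> + 1"
  define L' where "L' = \<bar>L\<bar> + 1"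
  have K: "K > 0" and L': "L' > 0" by (auto simp: K_def L'_def)
  \<comment> \<open>Five errors of size \<open>e / 8\<close> arise: tail and oscillation, each for
    \<open>P n\<close> and for \<open>Q\<close>, and the weight integrals. Within distance
    \<open>2 * r\<close> the function \<open>f\<close> varies by at most
    \<open>e / 8\<close>.\<close>
  define r where "r = e / (16 * L')"
  define \<eta> where "\<eta> = e / (8 * K)"
  have r: "r > 0" and \<eta>: "\<eta> > 0" using K L' e by (auto simp: r_def \<eta>_def)
  obtain R :: nat where R: "(\<integral>x. min 1 (max 0 (norm x - real R)) \<partial>Q) < \<eta>"
    using borel_prob_tail[OF Q \<eta>] .
  define \<tau> where "\<tau> x = min 1 (max 0 (norm x - real R))" for x :: 'c
  have \<tau>: "0 \<le> \<tau> x" "\<tau> x \<le> 1" for x by (auto simp: \<tau>_def)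
  have \<tau>c: "continuous_on UNIV \<tau>" unfolding \<tau>_def by (intro continuous_intros)
  obtain C :: "'c set" where C: "finite C" "cball 0 (real R + 1) \<subseteq> (\<Union>c\<in>C. ball c r)"
    by (rule compactE_image[OF compact_cball, of "UNIV :: 'c set" "\<lambda>c. ball c r" 0 "real R + 1"])
      (use r in \<open>auto intro: centre_in_ball[THEN iffD2]\<close>)
  define \<beta> where "\<beta> c x = max 0 (2 * r - dist x c)" for c x :: 'c
  define s where "s x = (\<Sum>c\<in>C. \<beta> c x)" for x
  \<comment> \<open>Where \<open>1 - \<tau> x\<close> is nonzero, \<open>x\<close> is covered, so
    \<open>s x\<close> is at least \<open>r\<close> and the maximum equals \<open>s x\<close>;
    elsewhere it prevents division by zero. The bumps reach to \<open>2 * r\<close>, twice the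
    covering radius, in order to attain height \<open>r\<close>.\<close>
  define W where "W c x = (1 - \<tau> x) * \<beta> c x / max r (s x)" for c x
  have \<beta>: "0 \<le> \<beta> c x" for c x by (simp add: \<beta>_def)
  have W0: "0 \<le> W c x" for c x unfolding W_def using \<tau>[of x] \<beta>[of c x] r by simp
  have Wc: "continuous_on UNIV (W c)" for c
    unfolding W_def s_def \<beta>_def \<tau>_def using r
    by (intro continuous_intros) (auto simp: max_def)
  have Wsum: "(\<Sum>c\<in>C. W c x) = 1 - \<tau> x" for x
  proof (cases "norm x \<le> real R + 1")
    case True
    then obtain c where c: "c \<in> C" "dist c x < r" using C(2)[THEN subsetD, of x] by (auto simp: mem_ball)
    then have "r \<le> \<beta> c x" by (simp add: \<beta>_def dist_commute)
    also have "\<dots> \<le> s x" unfolding s_def using C(1) c \<beta> by (intro member_le_sum) auto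
    finally have "max r (s x) = s x" "s x > 0" using r by auto
    then show ?thesis
      unfolding W_def by (simp flip: sum_divide_distrib sum_distrib_left s_def)
  next
    case False
    then have "\<tau> x = 1" by (simp add: \<tau>_def)
    then show ?thesis by (simp add: W_def)
  qed
  have W1: "W c x \<le> 1" if "c \<in> C" for c x
  proof -
    have "W c x \<le> (\<Sum>c\<in>C. W c x)" using C(1) that W0 by (intro member_le_sum) auto
    then show ?thesis using Wsum[of x] \<tau>[of x] by simp
  qed
  have bW: "bounded (range (W c))" if "c \<in> C" for c
    using W0[of c] W1[OF that] by (auto simp: bounded_iff intro!: exI[of _ 1])
  have "\<forall>\<^sub>F n in sequentially. \<forall>c\<in>C. \<bar>(\<integral>x. W c x \<partial>P n) - (\<integral>x. W c x \<partial>Q)\<bar> < e / (8 * K * (real (card C) + 1))"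
  proof (intro eventually_ball_finite C(1) ballI)
    fix c assume c: "c \<in> C"
    have "(\<lambda>n. \<integral>x. W c x \<partial>P n) \<longlonglongrightarrow> (\<integral>x. W c x \<partial>Q)"
      using w Wc bW[OF c] by (auto simp: weakly_converges_def)
    then show "\<forall>\<^sub>F n in sequentially. \<bar>(\<integral>x. W c x \<partial>P n) - (\<integral>x. W c x \<partial>Q)\<bar> < e / (8 * K * (real (card C) + 1))"
      unfolding dist_real_def[symmetric] by (rule tendstoD) (use e K in simp)
  qed
  moreover have "\<forall>\<^sub>F n in sequentially. (\<integral>x. \<tau> x \<partial>P n) < \<eta>"
  proof (rule order_tendstoD)
    show "(\<lambda>n. \<integral>x. \<tau> x \<partial>P n) \<longlonglongrightarrow> (\<integral>x. \<tau> x \<partial>Q)"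
      using w \<tau>c \<tau> by (auto simp: weakly_converges_def bounded_iff intro!: exI[of _ 1])
    show "(\<integral>x. \<tau> x \<partial>Q) < \<eta>" using R by (simp add: \<tau>_def)
  qed
  ultimately show ?thesis
  proof eventually_elim
    case (elim n)
    show ?case
    proof (intro allI impI)
      fix f :: "'c \<Rightarrow> real"
      assume f: "(\<forall>x. \<bar>f x\<bar> \<le> B) \<and> (\<forall>x y. \<bar>f x - f y\<bar> \<le> L * dist x y)"
      have fK: "\<bar>f x\<bar> \<le> K" for x using f[THEN conjunct1, rule_format, of x] by (simp add: K_def)
      have fL: "\<bar>f x - f y\<bar> \<le> L' * dist x y" for x y
      proof -
        have "L * dist x y \<le> L' * dist x y" by (intro mult_right_mono) (auto simp: L'_def)
        then show ?thesis using f[THEN conjunct2, rule_format, of x y] by linarith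
      qed
      have "L'-lipschitz_on UNIV f" using fL L' by (auto simp: lipschitz_on_def dist_real_def)
      then have fc: "continuous_on UNIV f" by (rule lipschitz_on_continuous_on)
      define h where "h x = (\<Sum>c\<in>C. f c * W c x)" for x
      have meas [measurable]: "f \<in> borel_measurable borel" "\<tau> \<in> borel_measurable borel" "W c \<in> borel_measurable borel" for c
        using fc \<tau>c Wc by (auto intro: borel_measurable_continuous_onI)
      have fh: "\<bar>f x - h x\<bar> \<le> K * \<tau> x + 2 * r * L'" for x
      proof -
        have "f x - h x = f x * \<tau> x + (\<Sum>c\<in>C. (f x - f c) * W c x)"
          using Wsum[of x] unfolding h_def
          by (simp add: left_diff_distrib sum_subtractf flip: sum_distrib_left) (simp add: algebra_simps)
        also have "\<bar>\<dots>\<bar> \<le> \<bar>f x\<bar> * \<tau> x + (\<Sum>c\<in>C. \<bar>f x - f c\<bar> * W c x)"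
          using \<tau>[of x] W0 by (intro order.trans[OF abs_triangle_ineq] add_mono order.trans[OF sum_abs])
            (auto simp: abs_mult)
        also have "\<dots> \<le> K * \<tau> x + (\<Sum>c\<in>C. (2 * r * L') * W c x)"
        proof (intro add_mono sum_mono)
          show "\<bar>f x\<bar> * \<tau> x \<le> K * \<tau> x" by (intro mult_right_mono fK \<tau>)
          fix c assume "c \<in> C"
          show "\<bar>f x - f c\<bar> * W c x \<le> (2 * r * L') * W c x"
          proof (cases "dist x c < 2 * r")
            case True
            have "\<bar>f x - f c\<bar> \<le> L' * dist x c" by (rule fL)
            also have "\<dots> \<le> L' * (2 * r)" using True L' by (intro mult_left_mono) auto
            finally show ?thesis using W0 by (intro mult_right_mono) (simp_all add: mult.commute)
          next
            case False
            then have "W c x = 0" by (simp add: W_def \<beta>_def)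
            then show ?thesis by simp
          qed
        qed
        also have "\<dots> \<le> K * \<tau> x + 2 * r * L'"
          using Wsum[of x] \<tau>[of x] r L' by (simp add: mult_left_le flip: sum_distrib_left)
        finally show ?thesis .
      qed
      have int: "integrable p f" "integrable p \<tau>" "\<And>c. c \<in> C \<Longrightarrow> integrable p (W c)" "integrable p h"
        if p: "borel_prob p" for p
      proof -
        show "integrable p f" by (rule borel_prob_integrable[OF p, of _ K]) (use fK in auto)
        show "integrable p \<tau>" by (rule borel_prob_integrable[OF p, of _ 1]) (use \<tau> in auto)
        show W: "integrable p (W c)" if "c \<in> C" for c
          by (rule borel_prob_integrable[OF p, of _ 1]) (use W0 W1[OF that] in auto)
        show "integrable p h" unfolding h_def using W by (auto intro!: Bochner_Integration.integrable_sum)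
      qed
      have diff: "\<bar>(\<integral>x. f x \<partial>p) - (\<integral>x. h x \<partial>p)\<bar> \<le> K * (\<integral>x. \<tau> x \<partial>p) + 2 * r * L'" if p: "borel_prob p" for p
      proof -
        interpret prob_space p using p by (simp add: borel_prob_def)
        have "\<bar>(\<integral>x. f x \<partial>p) - (\<integral>x. h x \<partial>p)\<bar> \<le> (\<integral>x. K * \<tau> x + 2 * r * L' \<partial>p)"
          using int[OF p] fh by (intro expectation_diff_le) auto
        also have "\<dots> = K * (\<integral>x. \<tau> x \<partial>p) + 2 * r * L'"
          using int[OF p] by (simp add: prob_space)
        finally show ?thesis .
      qed
      have inth: "(\<integral>x. h x \<partial>p) = (\<Sum>c\<in>C. f c * (\<integral>x. W c x \<partial>p))" if "borel_prob p" for p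
        unfolding h_def using int[OF that] by simp
      have "\<bar>(\<integral>x. h x \<partial>P n) - (\<integral>x. h x \<partial>Q)\<bar> \<le> (\<Sum>c\<in>C. \<bar>f c\<bar> * \<bar>(\<integral>x. W c x \<partial>P n) - (\<integral>x. W c x \<partial>Q)\<bar>)"
        unfolding inth[OF P] inth[OF Q] sum_subtractf[symmetric] right_diff_distrib[symmetric]
        by (rule order.trans[OF sum_abs]) (simp add: abs_mult)
      also have "\<dots> \<le> (\<Sum>c\<in>C. K * (e / (8 * K * (real (card C) + 1))))"
        using elim(1) fK K by (intro sum_mono mult_mono) (auto simp: less_imp_le)
      also have "\<dots> = real (card C) * (K * (e / (8 * K * (real (card C) + 1))))" by simp
      also have "K * (e / (8 * K * (real (card C) + 1))) = e / (8 * (real (card C) + 1))" using K by simp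
      also have "real (card C) * (e / (8 * (real (card C) + 1))) = e / 8 * (real (card C) / (real (card C) + 1))" by simp
      also have "\<dots> \<le> e / 8" using e by (intro mult_left_le) (auto simp: divide_le_eq)
      finally have hh: "\<bar>(\<integral>x. h x \<partial>P n) - (\<integral>x. h x \<partial>Q)\<bar> \<le> e / 8" .
      have "K * (\<integral>x. \<tau> x \<partial>P n) \<le> e / 8" "K * (\<integral>x. \<tau> x \<partial>Q) \<le> e / 8"
        using elim(2) R K by (auto simp: \<eta>_def \<tau>_def field_simps)
      moreover have "2 * r * L' = e / 8" using L' by (simp add: r_def)
      ultimately show "\<bar>(\<integral>x. f x \<partial>P n) - (\<integral>x. f x \<partial>Q)\<bar> \<le> e"
        using diff[OF P[of n]] diff[OF Q] hh e by linarith
    qed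
  qed
qed

text \<open>The phase lets a single constructor produce constants and sines as well, and closure
  under products becomes the product-to-sum formula.\<close>

inductive trig_poly :: "('c::euclidean_space \<Rightarrow> real) \<Rightarrow> bool" where
  cos: "trig_poly (\<lambda>x. r * cos (u \<bullet> x + c))"
| add: "trig_poly f \<Longrightarrow> trig_poly g \<Longrightarrow> trig_poly (\<lambda>x. f x + g x)"

lemma trig_poly_const: "trig_poly (\<lambda>x. c)"
  using trig_poly.cos[of c 0 0] by simp

lemma trig_poly_sin: "trig_poly (\<lambda>x. r * sin (u \<bullet> x))"
  using trig_poly.cos[of r u "- pi / 2"] by (simp add: cos_diff cos_add)

lemma trig_poly_mult:
  assumes "trig_poly f" "trig_poly g"
  shows "trig_poly (\<lambda>x. f x * g x)"
  using assms
proof (induction arbitrary: g rule: trig_poly.induct)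
  case (cos r u c)
  from cos show ?case
  proof (induction rule: trig_poly.induct)
    case (cos s v d)
    have "(\<lambda>x. r * cos (u \<bullet> x + c) * (s * cos (v \<bullet> x + d))) =
      (\<lambda>x. r * s / 2 * cos ((u - v) \<bullet> x + (c - d)) + r * s / 2 * cos ((u + v) \<bullet> x + (c + d)))"
      by (auto simp: fun_eq_iff cos_add cos_diff sin_add sin_diff inner_diff_left inner_add_left
          algebra_simps add_divide_distrib)
    then show ?case by (simp only: trig_poly.intros)
  next
    case (add f g)
    then show ?case by (simp add: distrib_left trig_poly.add)
  qed
next
  case (add f f')
  then show ?case by (simp add: distrib_right trig_poly.add)
qed

lemma trig_poly_sum:
  assumes "finite I" "\<And>i. i \<in> I \<Longrightarrow> trig_poly (f i)"
  shows "trig_poly (\<lambda>x. \<Sum>i\<in>I. f i x)"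
  using assms by (induction I rule: finite_induct) (auto intro: trig_poly_const trig_poly.add)

text \<open>A phase-shifted cosine integrates to the real part of a multiple of the characteristic
  function. Integrability is carried through the induction because splitting integrals of sums needs
  it.\<close>

lemma trig_poly_integral_tendsto:
  fixes P :: "nat \<Rightarrow> 'c::euclidean_space measure"
  assumes P: "\<And>n. borel_prob (P n)" and Q: "borel_prob Q"
    and lim: "\<And>u. (\<lambda>n. char_fun (P n) u) \<longlonglongrightarrow> char_fun Q u"
    and f: "trig_poly f"
  shows "(\<forall>p. borel_prob p \<longrightarrow> integrable p f) \<and> (\<lambda>n. \<integral>x. f x \<partial>P n) \<longlonglongrightarrow> (\<integral>x. f x \<partial>Q)"
  using f
proof (induction rule: trig_poly.induct)
  case (cos r u c)
  have eq: "r * cos (u \<bullet> x + c) = Re (complex_of_real r * cis c * cis (u \<bullet> x))" for x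
    by (simp add: cos_add algebra_simps)
  have m: "(\<lambda>x. cis (u \<bullet> x)) \<in> borel_measurable borel"
    by (intro borel_measurable_continuous_onI continuous_intros)
  have int: "integrable p (\<lambda>x. cis (u \<bullet> x))" if "borel_prob p" for p
    by (rule borel_prob_integrable[OF that m, of 1]) simp
  have "(\<integral>x. r * cos (u \<bullet> x + c) \<partial>p) = Re (complex_of_real r * cis c * char_fun p u)"
    if "borel_prob p" for p
    unfolding eq char_fun_def using int[OF that]
    by (subst integral_Re) auto
  moreover have "integrable p (\<lambda>x. r * cos (u \<bullet> x + c))" if "borel_prob p" for p
    unfolding eq using int[OF that] by (intro integrable_Re) auto
  ultimately show ?case using P Q by (auto intro!: tendsto_intros lim)
next
  case (add f g)
  then show ?case using P Q by (auto intro!: tendsto_intros)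
qed

section \<open>Tightness from characteristic functions\<close>

lemma char_fun_distr_coordinate:
  assumes "borel_prob P"
  shows "char (distr P borel (\<lambda>x. x \<bullet> b)) t = char_fun P (t *\<^sub>R b)"
proof -
  have "(\<lambda>x. x \<bullet> b) \<in> borel_measurable P"
    by (simp add: borel_prob_measurable[OF assms])
  then show ?thesis
    by (simp add: char_def char_fun_def integral_distr cis_conv_exp inner_commute mult.commute)
qed

text \<open>Projection to the coordinate axes reduces tightness to the continuity theorem on the
  real line; a vector of large norm has a large coordinate.\<close>

lemma char_fun_convergent_tight:
  fixes P :: "nat \<Rightarrow> 'c::euclidean_space measure"
  assumes P: "\<And>n. borel_prob (P n)" and Q: "borel_prob Q"
    and lim: "\<And>u. (\<lambda>n. char_fun (P n) u) \<longlonglongrightarrow> char_fun Q u" and e: "0 < e"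
  obtains R where "R > 0" "\<forall>\<^sub>F n in sequentially. measure (P n) {x. R < norm x} < e"
proof -
  have "\<exists>R\<ge>0. \<forall>\<^sub>F n in sequentially. measure (P n) {x. R < \<bar>x \<bullet> b\<bar>} < e / DIM('c)" if b: "b \<in> Basis" for b :: 'c
  proof -
    let ?D = "\<lambda>p. distr p borel (\<lambda>x. x \<bullet> b)"
    have m: "(\<lambda>x. x \<bullet> b) \<in> borel_measurable p" if "borel_prob p" for p :: "'c measure"
      by (simp add: borel_prob_measurable[OF that])
    have bp: "borel_prob (?D p)" if "borel_prob p" for p
      using that m by (intro borel_prob_distr) (auto simp: borel_prob_def)
    then have rd: "real_distribution (?D p)" if "borel_prob p" for p
      using that by (simp add: borel_prob_def real_distribution_def real_distribution_axioms_def)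
    have w: "weak_conv_m (\<lambda>n. ?D (P n)) (?D Q)"
      using rd P Q lim by (intro levy_continuity) (simp_all add: char_fun_distr_coordinate)
    have e': "e / DIM('c) > 0" using e by simp
    obtain R :: nat where R: "(\<integral>x. min 1 (max 0 (norm x - real R)) \<partial>?D Q) < e / DIM('c)"
      using borel_prob_tail[OF bp[OF Q] e'] .
    have "(\<lambda>n. \<integral>x. min 1 (max 0 (norm x - real R)) \<partial>?D (P n)) \<longlonglongrightarrow> (\<integral>x. min 1 (max 0 (norm x - real R)) \<partial>?D Q)"
      using rd P Q w by (intro weak_conv_imp_integral_bdd_continuous_conv[where B=1]) (auto intro!: continuous_intros)
    then have "\<forall>\<^sub>F n in sequentially. (\<integral>x. min 1 (max 0 (norm x - real R)) \<partial>?D (P n)) < e / DIM('c)"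
      using R by (rule order_tendstoD)
    \<comment> \<open>The truncated excess over \<open>R\<close> equals 1 from \<open>R + 1\<close>
      on, so it dominates the indicator of this event.\<close>
    then have "\<forall>\<^sub>F n in sequentially. measure (P n) {x. real R + 1 < \<bar>x \<bullet> b\<bar>} < e / DIM('c)"
    proof eventually_elim
      case (elim n)
      interpret prob_space "P n" using P by (simp add: borel_prob_def)
      have A: "{x. real R + 1 < \<bar>x \<bullet> b\<bar>} \<in> sets (P n)" using P[of n] by (simp add: borel_prob_def)
      have "measure (P n) {x. real R + 1 < \<bar>x \<bullet> b\<bar>} \<le> (\<integral>x. min 1 (max 0 (\<bar>x \<bullet> b\<bar> - real R)) \<partial>P n)"
        by (rule prob_le_expectation[OF A borel_prob_integrable[OF P, of _ 1]]) auto
      also have "\<dots> = (\<integral>x. min 1 (max 0 (norm x - real R)) \<partial>?D (P n))"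
        using m[OF P] by (simp add: integral_distr)
      finally show ?case using elim by simp
    qed
    then show ?thesis by (intro exI[of _ "real R + 1"]) auto
  qed
  then obtain R where R: "\<And>b::'c. b \<in> Basis \<Longrightarrow> 0 \<le> R b"
    "\<And>b::'c. b \<in> Basis \<Longrightarrow> \<forall>\<^sub>F n in sequentially. measure (P n) {x. R b < \<bar>x \<bullet> b\<bar>} < e / DIM('c)"
    by metis
  have "\<forall>\<^sub>F n in sequentially. \<forall>b\<in>(Basis::'c set). measure (P n) {x. R b < \<bar>x \<bullet> b\<bar>} < e / DIM('c)"
    using R(2) by (intro eventually_ball_finite) auto
  then have "\<forall>\<^sub>F n in sequentially. measure (P n) {x. (\<Sum>b\<in>Basis. R b) + 1 < norm x} < e"
  proof eventually_elim
    case (elim n)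
    interpret prob_space "P n" using P by (simp add: borel_prob_def)
    have S: "{x. R b < \<bar>x \<bullet> b\<bar>} \<in> sets (P n)" for b using P[of n] by (simp add: borel_prob_def)
    have "{x. (\<Sum>b\<in>Basis. R b) + 1 < norm x} \<subseteq> (\<Union>b\<in>Basis. {x. R b < \<bar>x \<bullet> b\<bar>})"
    proof
      fix x :: 'c assume x: "x \<in> {x. (\<Sum>b\<in>Basis. R b) + 1 < norm x}"
      have "norm x \<le> (\<Sum>b\<in>Basis. \<bar>x \<bullet> b\<bar>)" by (rule norm_le_l1)
      then have "\<not> (\<forall>b\<in>Basis. \<bar>x \<bullet> b\<bar> \<le> R b)"
        using x sum_mono[of Basis "\<lambda>b. \<bar>x \<bullet> b\<bar>" R] by fastforce
      then show "x \<in> (\<Union>b\<in>Basis. {x. R b < \<bar>x \<bullet> b\<bar>})"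
        unfolding UN_iff mem_Collect_eq not_le[symmetric] by blast
    qed
    then have "prob {x. (\<Sum>b\<in>Basis. R b) + 1 < norm x} \<le> prob (\<Union>b\<in>Basis. {x. R b < \<bar>x \<bullet> b\<bar>})"
      using S by (intro finite_measure_mono) auto
    also have "\<dots> \<le> (\<Sum>b\<in>Basis. prob {x. R b < \<bar>x \<bullet> b\<bar>})"
      using S by (intro finite_measure_subadditive_finite) auto
    also have "\<dots> < (\<Sum>b\<in>(Basis::'c set). e / DIM('c))"
      using elim by (intro sum_strict_mono) auto
    finally show ?case by simp
  qed
  \<comment> \<open>The 1 added to the radius is there for this strict positivity.\<close>
  moreover have "0 < (\<Sum>b\<in>Basis. R b) + 1" using R(1) by (simp add: add_nonneg_pos sum_nonneg)
  ultimately show thesis using that by blast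
qed

text \<open>
  The map \<open>torus_map L\<close> has a compact image, on which continuous functions are uniform limits of
  polynomials; polynomials in \<open>torus_map L x\<close> are trigonometric in \<open>x\<close>, so their integrals are
  governed by characteristic functions. As \<open>L\<close> grows, \<open>L *\<^sub>R snd (torus_map L x)\<close> tends to \<open>x\<close>.
\<close>
definition torus_map :: "real \<Rightarrow> 'c::euclidean_space \<Rightarrow> 'c \<times> 'c" where
  "torus_map L x = ((\<Sum>b\<in>Basis. cos ((x \<bullet> b) / L) *\<^sub>R b), (\<Sum>b\<in>Basis. sin ((x \<bullet> b) / L) *\<^sub>R b))"

lemma continuous_on_torus_map: "continuous_on S (torus_map L)"
proof -
  have "continuous_on S (\<lambda>x. ((\<Sum>b\<in>Basis. cos ((x \<bullet> b) * (1 / L)) *\<^sub>R b), (\<Sum>b\<in>Basis. sin ((x \<bullet> b) * (1 / L)) *\<^sub>R b)))"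
    by (intro continuous_intros)
  then show ?thesis by (simp add: torus_map_def[abs_def])
qed

lemma norm_torus_map: "norm (torus_map L (x :: 'c::euclidean_space)) \<le> 2 * DIM('c)"
proof -
  have *: "norm (\<Sum>b\<in>Basis. f b *\<^sub>R b) \<le> DIM('c)" if "\<And>b. \<bar>f b\<bar> \<le> 1" for f :: "'c \<Rightarrow> real"
  proof -
    have "norm (\<Sum>b\<in>Basis. f b *\<^sub>R b) \<le> (\<Sum>b\<in>(Basis::'c set). 1)"
      by (rule sum_norm_le) (use that in simp)
    then show ?thesis by simp
  qed
  show ?thesis
    unfolding torus_map_def by (rule order.trans[OF norm_Pair_le]) (use *[of "\<lambda>b. cos ((x \<bullet> b) / L)"] *[of "\<lambda>b. sin ((x \<bullet> b) / L)"] in simp)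
qed

lemma trig_poly_torus_map:
  fixes p :: "'c::euclidean_space \<times> 'c \<Rightarrow> real"
  assumes "real_polynomial_function p"
  shows "trig_poly (\<lambda>x. p (torus_map L x))"
  using assms
proof (induction rule: real_polynomial_function.induct)
  case (linear f)
  interpret bounded_linear f by fact
  have "f (torus_map L x) = (\<Sum>b\<in>Basis. f (b, 0) * cos (((1 / L) *\<^sub>R b) \<bullet> x + 0)) +
      (\<Sum>b\<in>Basis. f (0, b) * sin (((1 / L) *\<^sub>R b) \<bullet> x))" for x
  proof -
    have "torus_map L x = (\<Sum>b\<in>Basis. cos ((x \<bullet> b) / L) *\<^sub>R (b, 0)) + (\<Sum>b\<in>Basis. sin ((x \<bullet> b) / L) *\<^sub>R (0, b))"
      by (simp add: torus_map_def prod_eq_iff fst_sum snd_sum)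
    then show ?thesis
      by (simp only: add sum scaleR) (simp add: inner_commute mult.commute)
  qed
  then show ?case
    by (simp only:) (intro trig_poly.add trig_poly_sum trig_poly.cos trig_poly_sin finite_Basis)
next
  case (const c)
  show ?case by (rule trig_poly_const)
next
  case (add f g)
  then show ?case by (intro trig_poly.add)
next
  case (mult f g)
  then show ?case by (intro trig_poly_mult)
qed

lemma torus_map_integral_tendsto:
  fixes P :: "nat \<Rightarrow> 'c::euclidean_space measure" and g :: "'c \<times> 'c \<Rightarrow> real"
  assumes P: "\<And>n. borel_prob (P n)" and Q: "borel_prob Q"
    and lim: "\<And>u. (\<lambda>n. char_fun (P n) u) \<longlonglongrightarrow> char_fun Q u"
    and g: "continuous_on UNIV g"
  shows "(\<lambda>n. \<integral>x. g (torus_map L x) \<partial>P n) \<longlonglongrightarrow> (\<integral>x. g (torus_map L x) \<partial>Q)"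
proof (rule tendstoI)
  fix e :: real assume e: "e > 0"
  let ?C = "cball 0 (2 * DIM('c)) :: ('c \<times> 'c) set"
  have TC: "torus_map L x \<in> ?C" for x using norm_torus_map[of L x] by simp
  obtain p where p: "real_polynomial_function p" "\<And>x. x \<in> ?C \<Longrightarrow> \<bar>g x - p x\<bar> < e / 3"
    using Stone_Weierstrass_real_polynomial_function[of ?C g "e/3"] continuous_on_subset[OF g] e by auto
  note trig = trig_poly_integral_tendsto[OF P Q lim trig_poly_torus_map[OF p(1), of L]]
  have "compact (g ` ?C)" by (intro compact_continuous_image continuous_on_subset[OF g]) auto
  then obtain B where B: "\<And>x. x \<in> ?C \<Longrightarrow> \<bar>g x\<bar> \<le> B"
    using compact_imp_bounded by (fastforce simp: bounded_iff)
  have gT: "continuous_on UNIV (\<lambda>x. g (torus_map L x))"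
    by (rule continuous_on_compose2[OF g continuous_on_torus_map]) simp
  have ig: "integrable q (\<lambda>x. g (torus_map L x))" if "borel_prob q" for q
    by (rule borel_prob_integrable[OF that borel_measurable_continuous_onI[OF gT], of B]) (use B TC in simp)
  have close: "\<bar>(\<integral>x. g (torus_map L x) \<partial>q) - (\<integral>x. p (torus_map L x) \<partial>q)\<bar> \<le> e/3" if q: "borel_prob q" for q
  proof -
    interpret prob_space q using q by (simp add: borel_prob_def)
    have "\<bar>(\<integral>x. g (torus_map L x) \<partial>q) - (\<integral>x. p (torus_map L x) \<partial>q)\<bar> \<le> (\<integral>x. e / 3 \<partial>q)"
      using ig[OF q] trig q p(2)[OF TC] by (intro expectation_diff_le) (auto intro: less_imp_le)
    then show ?thesis by (simp add: prob_space)
  qed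
  have "\<forall>\<^sub>F n in sequentially. dist (\<integral>x. p (torus_map L x) \<partial>P n) (\<integral>x. p (torus_map L x) \<partial>Q) < e / 3"
    using trig e by (intro tendstoD) auto
  then show "\<forall>\<^sub>F n in sequentially. dist (\<integral>x. g (torus_map L x) \<partial>P n) (\<integral>x. g (torus_map L x) \<partial>Q) < e"
  proof eventually_elim
    case (elim n)
    then show ?case using close[OF P[of n]] close[OF Q] unfolding dist_real_def by linarith
  qed
qed

text \<open>The difference is the imaginary part of the first-order Taylor remainder of the
  exponential.\<close>

lemma abs_sin_diff_le: "\<bar>sin x - x\<bar> \<le> x\<^sup>2" for x :: real
proof -
  have "\<bar>sin x - x\<bar> \<le> cmod (iexp x - (\<Sum>k\<le>1. (\<i> * x)^k / fact k))"
    using abs_Im_le_cmod[of "iexp x - (\<Sum>k\<le>1. (\<i> * x)^k / fact k)"] by (simp add: Im_exp)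
  also have "\<dots> \<le> \<bar>x\<bar> ^ Suc 1 / fact (Suc 1)" by (rule iexp_approx1)
  also have "\<dots> \<le> x\<^sup>2" by (simp add: power2_eq_square)
  finally show ?thesis .
qed

lemma torus_map_inverse_approx:
  assumes "0 < \<delta>"
  obtains L where "L > 0" "\<And>x::'c::euclidean_space. norm x \<le> R \<Longrightarrow> norm (L *\<^sub>R snd (torus_map L x) - x) < \<delta>"
proof -
  define D where "D = real DIM('c)"
  have D: "D > 0" by (simp add: D_def)
  \<comment> \<open>The size makes \<open>D * R\<^sup>2 / L\<close> smaller than \<delta>; the
    \<open>+ 1\<close> gives the strict inequality and keeps \<open>L\<close> positive when
    \<open>R = 0\<close>.\<close>
  define L where "L = D * (R\<^sup>2 + 1) / \<delta> "
  have L: "L > 0" using D assms by (auto simp: L_def intro!: divide_pos_pos mult_pos_pos add_nonneg_pos)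
  show thesis
  proof (rule that[OF L])
    fix x :: 'c assume x: "norm x \<le> R"
    have sin: "\<bar>L * sin (y / L) - y\<bar> \<le> y\<^sup>2 / L" if "y\<^sup>2 \<le> R\<^sup>2" for y
    proof -
      have "\<bar>sin (y / L) - y / L\<bar> \<le> (y / L)\<^sup>2"
        by (rule abs_sin_diff_le)
      then have "L * \<bar>sin (y / L) - y / L\<bar> \<le> L * (y / L)\<^sup>2" using L by (intro mult_left_mono) auto
      moreover have "L * \<bar>sin (y / L) - y / L\<bar> = \<bar>L * sin (y / L) - y\<bar>"
        using L by (simp add: abs_mult_pos' right_diff_distrib)
      ultimately show ?thesis using L by (simp add: power2_eq_square)
    qed
    have "L *\<^sub>R snd (torus_map L x) - x = (\<Sum>b\<in>Basis. (L * sin ((x \<bullet> b) / L) - x \<bullet> b) *\<^sub>R b)"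
      by (simp add: torus_map_def scaleR_sum_right scaleR_left_diff_distrib sum_subtractf euclidean_representation)
    also have "norm \<dots> \<le> (\<Sum>b\<in>(Basis::'c set). R\<^sup>2 / L)"
    proof (rule sum_norm_le)
      fix b :: 'c assume b: "b \<in> Basis"
      have "\<bar>x \<bullet> b\<bar> \<le> R" using Basis_le_norm[OF b, of x] x by simp
      then have "(x \<bullet> b)\<^sup>2 \<le> R\<^sup>2" using abs_le_square_iff[of "x \<bullet> b" R] by simp
      with sin[OF this] L show "norm ((L * sin ((x \<bullet> b) / L) - x \<bullet> b) *\<^sub>R b) \<le> R\<^sup>2 / L"
        using b by (simp add: ) (meson divide_right_mono less_imp_le order_trans)
    qed
    also have "\<dots> = D * R\<^sup>2 / L" by (simp add: D_def)
    also have "\<dots> < \<delta>"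
    proof -
      have "D * R\<^sup>2 < \<delta> * L" using D assms by (simp add: L_def)
      then show ?thesis using L by (simp add: pos_divide_less_eq)
    qed
    finally show "norm (L *\<^sub>R snd (torus_map L x) - x) < \<delta>" .
  qed
qed

text \<open>Levy's continuity theorem in several dimensions. On a ball carrying almost all mass,
  \<open>x\<close> is nearly a function of \<open>torus_map L x\<close>, so \<open>f\<close> may be
  replaced by a function of the torus point, for which convergence is known. Tightness controls the
  complement of the ball.\<close>

theorem char_fun_continuity:
  fixes P :: "nat \<Rightarrow> 'c::euclidean_space measure"
  assumes P: "\<And>n. borel_prob (P n)" and Q: "borel_prob Q"
    and lim: "\<And>u. (\<lambda>n. char_fun (P n) u) \<longlonglongrightarrow> char_fun Q u"
  shows "weakly_converges P Q"
  unfolding weakly_converges_def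
proof (intro allI impI, rule tendstoI)
  fix f :: "'c \<Rightarrow> real" and e :: real
  assume f: "continuous_on UNIV f \<and> bounded (range f)" and e: "0 < e"
  then obtain B where B: "B > 0" "\<And>x. \<bar>f x\<bar> \<le> B" by (auto simp: bounded_pos)
  \<comment> \<open>Off the ball the replacement errs by at most \<open>2 * B\<close>, which costs
    \<open>2 * B * \<eta> = e / 8\<close>; on the ball uniform continuity costs another
    \<open>e / 8\<close>.\<close>
  define \<eta> where "\<eta> = e / (16 * B)"
  have \<eta>: "\<eta> > 0" using e B by (simp add: \<eta>_def)
  obtain R1 where R1: "R1 > 0" "\<forall>\<^sub>F n in sequentially. measure (P n) {x. R1 < norm x} < \<eta>"
    using char_fun_convergent_tight[OF P Q lim \<eta>] .
  \<comment> \<open>The constant sequence turns the tightness lemma into a tail bound for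
    \<open>Q\<close> itself.\<close>
  obtain R2 where R2: "R2 > 0" "\<forall>\<^sub>F n in sequentially. measure Q {x. R2 < norm x} < \<eta>"
    using char_fun_convergent_tight[of "\<lambda>_. Q" Q, OF Q Q _ \<eta>] by auto
  define R where "R = max R1 R2"
  \<comment> \<open>The radius is enlarged by 1 because the point recovered from the torus may lie
    up to distance 1 outside the ball of radius \<open>R\<close>.\<close>
  have "uniformly_continuous_on (cball 0 (R + 1)) f"
    by (rule compact_uniformly_continuous[OF continuous_on_subset[OF conjunct1[OF f]]]) auto
  then obtain \<delta> where \<delta>: "\<delta> > 0"
    "\<And>x y. x \<in> cball 0 (R + 1) \<Longrightarrow> y \<in> cball 0 (R + 1) \<Longrightarrow> dist y x < \<delta> \<Longrightarrow> dist (f y) (f x) < e / 8"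
    unfolding uniformly_continuous_on_def using e by (elim allE[of _ "e / 8"]) auto
  obtain L where L: "L > 0" "\<And>x::'c. norm x \<le> R \<Longrightarrow> norm (L *\<^sub>R snd (torus_map L x) - x) < min \<delta> 1"
    using torus_map_inverse_approx[of "min \<delta> 1" R] \<delta>(1) by auto
  define g where "g z = f (L *\<^sub>R snd z)" for z :: "'c \<times> 'c"
  have g: "continuous_on UNIV g"
    unfolding g_def using f
    by (rule continuous_on_compose2[OF conjunct1 continuous_on_scaleR[OF continuous_on_const continuous_on_snd[OF continuous_on_id]]]) simp
  have gT: "continuous_on UNIV (\<lambda>x. g (torus_map L x))"
    by (rule continuous_on_compose2[OF g continuous_on_torus_map]) simp
  have ig: "integrable q (\<lambda>x. g (torus_map L x))" "integrable q f" if "borel_prob q" for q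
  proof -
    have fm: "f \<in> borel_measurable borel" using f by (intro borel_measurable_continuous_onI) simp
    show "integrable q (\<lambda>x. g (torus_map L x))"
      by (rule borel_prob_integrable[OF that borel_measurable_continuous_onI[OF gT], of B]) (simp add: g_def B)
    show "integrable q f"
      by (rule borel_prob_integrable[OF that fm, of B]) (simp add: B)
  qed
  have close: "\<bar>(\<integral>x. f x \<partial>q) - (\<integral>x. g (torus_map L x) \<partial>q)\<bar> \<le> e/4"
    if q: "borel_prob q" and tail: "measure q {x. R < norm x} \<le> \<eta>" for q
  proof -
    interpret prob_space q using q by (simp add: borel_prob_def)
    have A: "{x. R < norm x} \<in> sets q" using q by (simp add: borel_prob_def)
    have sp: "space q = UNIV" using q sets_eq_imp_space_eq[of q borel] by (simp add: borel_prob_def)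
    have ia: "integrable q (indicat_real {x. R < norm x})"
      using A by (simp add: integrable_indicator_iff emeasure_eq_measure)
    have pw: "\<bar>f x - g (torus_map L x)\<bar> \<le> e / 8 + 2 * B * indicator {x. R < norm x} x" for x
    proof (cases "R < norm x")
      case True
      then show ?thesis using B(2)[of x] B(2)[of "L *\<^sub>R snd (torus_map L x)"] e by (simp add: g_def)
    next
      case False
      then have n: "norm (L *\<^sub>R snd (torus_map L x) - x) < min \<delta> 1" using L(2) by simp
      have "norm (L *\<^sub>R snd (torus_map L x)) \<le> norm x + norm (L *\<^sub>R snd (torus_map L x) - x)"
        by (rule norm_triangle_sub)
      then have "dist (f (L *\<^sub>R snd (torus_map L x))) (f x) < e / 8"
        using False n by (intro \<delta>(2)) (auto simp: dist_norm)
      then show ?thesis using False by (simp add: g_def dist_real_def abs_minus_commute)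
    qed
    have "\<bar>(\<integral>x. f x \<partial>q) - (\<integral>x. g (torus_map L x) \<partial>q)\<bar> \<le>
        (\<integral>x. e / 8 + 2 * B * indicator {x. R < norm x} x \<partial>q)"
      using ig[OF q] ia pw by (intro expectation_diff_le) auto
    also have "\<dots> = e / 8 + 2 * B * measure q {x. R < norm x}"
      using ia sp prob_space by simp
    also have "\<dots> \<le> e / 8 + 2 * B * \<eta>" using tail B by (intro add_mono mult_left_mono) auto
    also have "\<dots> = e / 4" using B by (simp add: \<eta>_def)
    finally show ?thesis .
  qed
  have mono: "measure q {x::'c. R < norm x} \<le> \<eta>" if "borel_prob q" "measure q {x. R' < norm x} < \<eta>" "R' \<le> R" for q R'
  proof -
    interpret prob_space q using that by (simp add: borel_prob_def)
    have "measure q {x::'c. R < norm x} \<le> measure q {x. R' < norm x}"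
      using that by (intro finite_measure_mono) (auto simp: borel_prob_def)
    then show ?thesis using that by simp
  qed
  have Qt: "measure Q {x. R2 < norm x} < \<eta>" using R2(2) by simp
  have "\<forall>\<^sub>F n in sequentially. dist (\<integral>x. g (torus_map L x) \<partial>P n) (\<integral>x. g (torus_map L x) \<partial>Q) < e / 4"
    using torus_map_integral_tendsto[OF P Q lim g] e by (intro tendstoD) auto
  with R1(2) show "\<forall>\<^sub>F n in sequentially. dist (\<integral>x. f x \<partial>P n) (\<integral>x. f x \<partial>Q) < e"
  proof eventually_elim
    case (elim n)
    then show ?case
      using close[OF P mono[OF P elim(1)]] close[OF Q mono[OF Q Qt]] e
      unfolding dist_real_def R_def by linarith
  qed
qed

section \<open>Random walks and Levy processes\<close>

lemma char_fun_distr: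
  assumes "X \<in> borel_measurable M"
  shows "char_fun (distr M borel X) u = (\<integral>\<omega>. cis (u \<bullet> X \<omega>) \<partial>M)"
  unfolding char_fun_def using assms
  by (intro integral_distr) (auto intro!: borel_measurable_continuous_onI continuous_intros)

lemma char_fun_0: "borel_prob P \<Longrightarrow> char_fun P 0 = 1"
  by (simp add: char_fun_def borel_prob_def prob_space.prob_space)

lemma continuous_on_char_fun:
  fixes P :: "'c::euclidean_space measure"
  assumes "borel_prob P"
  shows "continuous_on S (char_fun P)"
proof (rule continuous_at_imp_continuous_on, intro ballI)
  interpret prob_space P using assms by (simp add: borel_prob_def)
  fix u
  show "isCont (char_fun P) u"
    unfolding continuous_at_sequentially comp_def
  proof (intro allI impI)
    fix v assume v: "v \<longlonglongrightarrow> u"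
    show "(\<lambda>n. char_fun P (v n)) \<longlonglongrightarrow> char_fun P u"
      unfolding char_fun_def
    proof (rule integral_dominated_convergence[where w="\<lambda>_. 1"])
      have "(\<lambda>x. cis (w \<bullet> x)) \<in> borel_measurable P" for w
        unfolding borel_prob_measurable[OF assms]
        by (intro borel_measurable_continuous_onI continuous_intros)
      then show "(\<lambda>x. cis (u \<bullet> x)) \<in> borel_measurable P" "(\<lambda>x. cis (v n \<bullet> x)) \<in> borel_measurable P" for n
        by auto
      show "AE x in P. (\<lambda>n. cis (v n \<bullet> x)) \<longlonglongrightarrow> cis (u \<bullet> x)"
        by (intro AE_I2 tendsto_intros v)
    qed auto
  qed
qed

lemma (in prob_space) char_fun_indep_sum:
  fixes X :: "'i \<Rightarrow> 'a \<Rightarrow> 'c::euclidean_space"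
  assumes "indep_vars (\<lambda>_. borel) X I" "finite I"
  shows "char_fun (distr M borel (\<lambda>\<omega>. \<Sum>i\<in>I. X i \<omega>)) u = (\<Prod>i\<in>I. char_fun (distr M borel (X i)) u)"
proof -
  have m: "X i \<in> borel_measurable M" if "i \<in> I" for i
    using assms(1) that by (auto simp: indep_vars_def)
  have c: "(\<lambda>x. cis (u \<bullet> x)) \<in> borel_measurable borel"
    by (intro borel_measurable_continuous_onI continuous_intros)
  have "cis (u \<bullet> (\<Sum>i\<in>I. X i \<omega>)) = (\<Prod>i\<in>I. cis (u \<bullet> X i \<omega>))" for \<omega>
    using assms(2) by (induction I rule: finite_induct) (auto simp: inner_add_right simp flip: cis_mult)
  moreover have "(\<integral>\<omega>. (\<Prod>i\<in>I. cis (u \<bullet> X i \<omega>)) \<partial>M) = (\<Prod>i\<in>I. \<integral>\<omega>. cis (u \<bullet> X i \<omega>) \<partial>M)"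
  proof (rule indep_vars_lebesgue_integral[OF assms(2)])
    show "indep_vars (\<lambda>_. borel) (\<lambda>i \<omega>. cis (u \<bullet> X i \<omega>)) I"
      by (rule indep_vars_compose2[OF assms(1)]) (rule c)
    show "integrable M (\<lambda>\<omega>. cis (u \<bullet> X i \<omega>))" if "i \<in> I" for i
      using m[OF that] measurable_compose[OF m[OF that] c]
      by (intro integrable_const_bound[of _ 1]) auto
  qed
  ultimately show ?thesis
    using m by (subst char_fun_distr) (auto simp: char_fun_distr intro!: prod.cong)
qed

text \<open>The quotient of \<open>g\<close> by the candidate root is continuous with values in the
  finite set of \<open>n\<close>-th roots of unity, hence constant on the connected
  \<open>S\<close>, and its value at \<open>a\<close> is 1. This selects the branch of the
  root.\<close>

lemma continuous_root_eq_exp: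
  fixes g h :: "'c::topological_space \<Rightarrow> complex"
  assumes S: "connected S" "a \<in> S" and g: "continuous_on S g" and h: "continuous_on S h"
    and n: "0 < n" and eq: "\<And>x. x \<in> S \<Longrightarrow> g x ^ n = exp (h x)"
    and a: "g a = 1" "h a = 0" and x: "x \<in> S"
  shows "g x = exp (h x / of_nat n)"
proof -
  define q where "q y = g y * exp (- (h y / of_nat n))" for y
  have pow: "q y ^ n = 1" if "y \<in> S" for y
  proof -
    have "exp (- (h y / of_nat n)) ^ n = exp (of_nat n * - (h y / of_nat n))"
      by (rule exp_of_nat_mult[symmetric])
    also have "of_nat n * - (h y / of_nat n) = - h y" using n by simp
    finally show ?thesis using eq[OF that] by (simp add: q_def power_mult_distrib exp_minus)
  qed
  have "continuous_on S q"
    unfolding q_def using n by (intro continuous_intros g h) auto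
  moreover have "finite (q ` S)"
    by (rule finite_subset[OF _ finite_roots_unity[of n]]) (use pow n in auto)
  ultimately have "q constant_on S" by (rule continuous_finite_range_constant[OF S(1)])
  then have "q x = q a" using S(2) x by (auto simp: constant_on_def)
  then have "g x * exp (- (h x / of_nat n)) = 1" using a by (simp add: q_def)
  then show ?thesis by (simp add: exp_minus divide_eq_eq flip: divide_inverse)
qed

text \<open>Divided by its limit, the power becomes a function \<open>w n\<close> uniformly close to
  1, so its principal logarithm is continuous on the whole ball and corrects \<open>L\<close> to a
  logarithm of the power. Closeness must be uniform because the branch is carried from the origin to
  \<open>u\<close> through the ball.\<close>

lemma char_fun_array_log:
  fixes c :: "nat \<Rightarrow> 'c::euclidean_space \<Rightarrow> complex"
  assumes c: "\<And>n. continuous_on (cball 0 r) (c n)" "\<And>n. c n 0 = 1"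
    and L: "continuous_on (cball 0 r) L" "L 0 = 0"
    and lim: "\<And>e. e > 0 \<Longrightarrow> \<forall>\<^sub>F n in sequentially. \<forall>u\<in>cball 0 r. norm (c n u ^ n - exp (L u)) \<le> e"
    and u: "u \<in> cball 0 r"
  obtains z where "z \<longlonglongrightarrow> 0" "\<forall>\<^sub>F n in sequentially. c n u = exp ((L u + z n) / of_nat n)"
proof -
  have r0: "0 \<in> cball (0::'c) r"
  proof -
    have "0 \<le> norm u" by simp
    also have "\<dots> \<le> r" using u by simp
    finally show ?thesis by simp
  qed
  have "compact ((\<lambda>u. exp (- L u)) ` cball 0 r)"
    by (intro compact_continuous_image continuous_intros L) auto
  then obtain B where B: "B > 0" "\<And>u. u \<in> cball 0 r \<Longrightarrow> norm (exp (- L u)) \<le> B"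
    using compact_imp_bounded[of "(\<lambda>u. exp (- L u)) ` cball 0 r"] unfolding bounded_pos by auto
  define w where "w n u = c n u ^ n * exp (- L u)" for n u
  have w1: "w n u - 1 = (c n u ^ n - exp (L u)) * exp (- L u)" for n u
    by (simp add: w_def left_diff_distrib flip: exp_add)
  have w: "\<forall>\<^sub>F n in sequentially. \<forall>u\<in>cball 0 r. norm (w n u - 1) \<le> e" if "e > 0" for e
    using lim[of "e / B"] divide_pos_pos[OF that B(1)]
  proof (elim meta_impE eventually_mono)
    fix n assume *: "\<forall>u\<in>cball 0 r. norm (c n u ^ n - exp (L u)) \<le> e / B"
    show "\<forall>u\<in>cball 0 r. norm (w n u - 1) \<le> e"
    proof
      fix u :: 'c assume u: "u \<in> cball 0 r"
      have "norm (w n u - 1) \<le> (e / B) * B"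
        unfolding w1 norm_mult using * B u that by (intro mult_mono) auto
      then show "norm (w n u - 1) \<le> e" using B by simp
    qed
  qed
  define z where "z n = Ln (w n u)" for n
  show thesis
  proof (rule that)
    have "(\<lambda>n. w n u - 1) \<longlonglongrightarrow> 0"
    proof (rule tendstoI)
      fix e :: real assume "e > 0"
      then have "\<forall>\<^sub>F n in sequentially. \<forall>u\<in>cball 0 r. norm (w n u - 1) \<le> e / 2" by (intro w) simp
      then show "\<forall>\<^sub>F n in sequentially. dist (w n u - 1) 0 < e"
        by (rule eventually_mono) (use u \<open>e > 0\<close> in \<open>fastforce simp: dist_norm\<close>)
    qed
    then have "(\<lambda>n. w n u) \<longlonglongrightarrow> 1" by (simp add: LIM_zero_iff)
    then have "(\<lambda>n. Ln (w n u)) \<longlonglongrightarrow> Ln 1"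
      by (rule tendsto_Ln) simp
    then show "z \<longlonglongrightarrow> 0" by (simp add: z_def[abs_def])
    \<comment> \<open>Distance at most 1/2 from 1 keeps \<open>w n\<close> off the cut of the
      principal logarithm at every point of the ball.\<close>
    have "\<forall>\<^sub>F n in sequentially. \<forall>u\<in>cball 0 r. norm (w n u - 1) \<le> 1 / 2" by (rule w) simp
    then show "\<forall>\<^sub>F n in sequentially. c n u = exp ((L u + z n) / of_nat n)"
      using eventually_gt_at_top[of 0]
    proof eventually_elim
      case (elim n)
      have wn: "w n v \<notin> \<real>\<^sub>\<le>\<^sub>0" if "v \<in> cball 0 r" for v
      proof
        assume "w n v \<in> \<real>\<^sub>\<le>\<^sub>0"
        then have "Re (w n v) \<le> 0" by (simp add: complex_nonpos_Reals_iff)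
        moreover have "\<bar>Re (w n v - 1)\<bar> \<le> 1/2"
          using elim(1) that abs_Re_le_cmod[of "w n v - 1"] by fastforce
        ultimately show False by simp
      qed
      have "c n u = exp ((\<lambda>v. L v + Ln (w n v)) u / of_nat n)"
      proof (rule continuous_root_eq_exp[of "cball 0 r" 0 "c n" "\<lambda>v. L v + Ln (w n v)" n u])
        have "continuous_on (cball 0 r) (w n)"
          unfolding w_def by (intro continuous_intros c L)
        then show "continuous_on (cball 0 r) (\<lambda>v. L v + Ln (w n v))"
          by (intro continuous_intros L) (use wn in auto)
        show "c n v ^ n = exp (L v + Ln (w n v))" if "v \<in> cball 0 r" for v
        proof -
          have "w n v \<noteq> 0" using wn[OF that] by auto
          then have "exp (L v + Ln (w n v)) = exp (L v) * w n v" by (simp add: exp_add)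
          then show ?thesis by (simp add: w_def mult.left_commute flip: exp_add)
        qed
        show "L 0 + Ln (w n 0) = 0" by (simp add: w_def c L)
      qed (use r0 u c elim in auto)
      then show ?case by (simp add: z_def)
    qed
  qed
qed

text \<open>In logarithmic form, the power \<open>k j\<close> merely scales the limit exponent by
  \<open>k j / n j\<close>. The index sequence \<open>n\<close> is general so that the convergence
  applies along sequences of bad indices in an argument by contradiction.\<close>

lemma exp_array_power_tendsto:
  fixes c z :: "nat \<Rightarrow> complex"
  assumes z: "z \<longlonglongrightarrow> 0" and eq: "\<forall>\<^sub>F n in sequentially. c n = exp ((l + z n) / of_nat n)"
    and n: "filterlim n at_top sequentially" and k: "(\<lambda>j. real (k j) / real (n j)) \<longlonglongrightarrow> t"
  shows "(\<lambda>j. c (n j) ^ k j) \<longlonglongrightarrow> exp (of_real t * l)"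
proof -
  have "(\<lambda>j. exp (of_real (real (k j) / real (n j)) * (l + z (n j)))) \<longlonglongrightarrow> exp (of_real t * (l + 0))"
    by (intro tendsto_intros k filterlim_compose[OF z n])
  moreover have "\<forall>\<^sub>F j in sequentially. exp (of_real (real (k j) / real (n j)) * (l + z (n j))) = c (n j) ^ k j"
    using eventually_compose_filterlim[OF eq n]
  proof eventually_elim
    case (elim j)
    have "c (n j) ^ k j = exp (of_nat (k j) * ((l + z (n j)) / of_nat (n j)))"
      unfolding elim by (rule exp_of_nat_mult[symmetric])
    also have "of_nat (k j) * ((l + z (n j)) / of_nat (n j)) = of_real (real (k j) / real (n j)) * (l + z (n j))"
      by simp
    finally show ?case by (rule sym)
  qed
  ultimately show ?thesis by (auto dest: Lim_transform_eventually)
qed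

section \<open>Partial sums of i.i.d. steps\<close>

lemma prob_space_iid_steps: "iid_steps M Y \<Longrightarrow> prob_space M"
  by (simp add: iid_steps_def)

lemma iid_steps_indep: "iid_steps M Y \<Longrightarrow> prob_space.indep_vars M (\<lambda>_. borel) Y {1..}"
  unfolding iid_steps_def by (elim conjE)

lemma iid_steps_distr: "iid_steps M Y \<Longrightarrow> 1 \<le> i \<Longrightarrow> distr M borel (Y i) = distr M borel (Y 1)"
  unfolding iid_steps_def by (elim conjE) blast

lemma iid_steps_measurable:
  assumes "iid_steps M Y" "1 \<le> i"
  shows "Y i \<in> borel_measurable M"
  using iid_steps_indep[OF assms(1)] assms(2)
  unfolding prob_space.indep_vars_def[OF prob_space_iid_steps[OF assms(1)]] by auto

lemma random_walk_measurable: "iid_steps M Y \<Longrightarrow> random_walk Y n \<in> borel_measurable M"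
  unfolding random_walk_def[abs_def] by (intro borel_measurable_sum iid_steps_measurable) auto

lemma random_walk_diff:
  assumes "a \<le> b"
  shows "random_walk Y b \<omega> - random_walk Y a \<omega> = (\<Sum>i\<in>{a<..b}. Y i \<omega>)"
proof -
  have "{1..b} = {1..a} \<union> {a<..b}" using assms by auto
  then have "random_walk Y b \<omega> = random_walk Y a \<omega> + (\<Sum>i\<in>{a<..b}. Y i \<omega>)"
    unfolding random_walk_def by (simp only:) (rule sum.union_disjoint; auto)
  then show ?thesis by simp
qed

lemma char_fun_random_walk:
  assumes Y: "iid_steps M Y" and "a \<le> b"
  shows "char_fun (distr M borel (\<lambda>\<omega>. random_walk Y b \<omega> - random_walk Y a \<omega>)) u =
    char_fun (distr M borel (Y 1)) u ^ (b - a)"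
proof -
  interpret prob_space M using Y by (rule prob_space_iid_steps)
  have "indep_vars (\<lambda>_. borel) Y {a<..b}"
    by (rule indep_vars_subset[OF iid_steps_indep[OF Y]]) auto
  then have "char_fun (distr M borel (\<lambda>\<omega>. \<Sum>i\<in>{a<..b}. Y i \<omega>)) u = (\<Prod>i\<in>{a<..b}. char_fun (distr M borel (Y i)) u)"
    by (rule char_fun_indep_sum) simp
  also have "\<dots> = (\<Prod>i\<in>{a<..b}. char_fun (distr M borel (Y 1)) u)"
  proof (rule prod.cong)
    fix i assume "i \<in> {a<..b}"
    then have "distr M borel (Y i) = distr M borel (Y 1)"
      by (intro iid_steps_distr[OF Y]) simp
    then show "char_fun (distr M borel (Y i)) u = char_fun (distr M borel (Y 1)) u" by (simp only:)
  qed simp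
  finally show ?thesis using assms by (simp add: random_walk_diff)
qed

section \<open>Increments of a Levy process\<close>

lemma levy_process_measurable: "levy_process N X \<Longrightarrow> 0 \<le> t \<Longrightarrow> X t \<in> borel_measurable N"
  by (simp add: levy_process_def)

lemma levy_process_cadlag: "levy_process N X \<Longrightarrow> \<omega> \<in> space N \<Longrightarrow> cadlag (\<lambda>t. X t \<omega>)"
  by (simp add: levy_process_def)

lemma levy_process_0: "levy_process N X \<Longrightarrow> \<omega> \<in> space N \<Longrightarrow> X 0 \<omega> = 0"
  by (simp add: levy_process_def)

lemma levy_process_stationary:
  assumes "levy_process N X" "0 \<le> s" "s \<le> t"
  shows "distr N borel (\<lambda>\<omega>. X t \<omega> - X s \<omega>) = distr N borel (X (t - s))"
  using assms unfolding levy_process_def by blast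

lemma levy_process_indep:
  assumes "levy_process N X" "0 \<le> t 0" "mono t"
  shows "prob_space.indep_vars N (\<lambda>_. borel) (\<lambda>i \<omega>. X (t (Suc i)) \<omega> - X (t i) \<omega>) {..<m}"
  using assms unfolding levy_process_def by blast

lemma levy_process_indep_grid:
  assumes "levy_process N X"
  shows "prob_space.indep_vars N (\<lambda>_. borel)
    (\<lambda>i \<omega>. X (real (Suc i) / real m) \<omega> - X (real i / real m) \<omega>) {..<m}"
proof -
  have "mono (\<lambda>i. real i / real m)" by (intro monoI divide_right_mono) auto
  then show ?thesis by (intro levy_process_indep[OF assms]) auto
qed

lemma levy_process_increment:
  assumes "levy_process N X" "0 < m"
  shows "distr N borel (\<lambda>\<omega>. X (real (Suc i) / real m) \<omega> - X (real i / real m) \<omega>) = distr N borel (X (1 / real m))"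
proof -
  have "distr N borel (\<lambda>\<omega>. X (real (Suc i) / real m) \<omega> - X (real i / real m) \<omega>) =
      distr N borel (X (real (Suc i) / real m - real i / real m))"
    by (rule levy_process_stationary[OF assms(1)]) (auto intro: divide_right_mono)
  also have "real (Suc i) / real m - real i / real m = 1 / real m"
    by (simp add: diff_divide_distrib[symmetric])
  finally show ?thesis .
qed

lemma levy_process_sum_increments:
  assumes "levy_process N X" "\<omega> \<in> space N"
  shows "(\<Sum>i<j. X (real (Suc i) / real m) \<omega> - X (real i / real m) \<omega>) = X (real j / real m) \<omega>"
  using assms by (subst sum_lessThan_telescope) (auto simp: levy_process_def)

lemma borel_prob_levy: "levy_process N X \<Longrightarrow> 0 \<le> t \<Longrightarrow> borel_prob (distr N borel (X t))"
  by (auto simp: levy_process_def intro: borel_prob_distr)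

lemma char_fun_levy_root:
  assumes X: "levy_process N X" and m: "0 < m"
  shows "char_fun (distr N borel (X (1 / real m))) u ^ m = char_fun (distr N borel (X 1)) u"
proof -
  interpret prob_space N using X by (simp add: levy_process_def)
  have "distr N borel (X 1) = distr N borel (\<lambda>\<omega>. \<Sum>i<m. X (real (Suc i) / real m) \<omega> - X (real i / real m) \<omega>)"
    by (rule distr_cong) (use m levy_process_sum_increments[OF X] in auto)
  also have "char_fun \<dots> u = (\<Prod>i<m. char_fun (distr N borel (\<lambda>\<omega>. X (real (Suc i) / real m) \<omega> - X (real i / real m) \<omega>)) u)"
    by (rule char_fun_indep_sum[OF levy_process_indep_grid[OF X]]) simp
  finally show ?thesis by (simp only: levy_process_increment[OF X m]) simp
qed

text \<open>A zero at \<open>u\<close> would be shared by the laws of all \<open>X (1 / m)\<close>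
  through the root relation. By right continuity these variables tend to \<open>X 0 = 0\<close>, so
  their characteristic functions tend to 1.\<close>

lemma char_fun_levy_nonzero:
  assumes X: "levy_process N X"
  shows "char_fun (distr N borel (X 1)) u \<noteq> 0"
proof
  interpret prob_space N using X by (simp add: levy_process_def)
  assume 0: "char_fun (distr N borel (X 1)) u = 0"
  have z: "char_fun (distr N borel (X (1 / real (Suc m)))) u = 0" for m
    using char_fun_levy_root[OF X, of "Suc m" u] unfolding 0 power_eq_0_iff by simp
  have "(\<lambda>m. \<integral>\<omega>. cis (u \<bullet> X (1 / real (Suc m)) \<omega>) \<partial>N) \<longlonglongrightarrow> (\<integral>\<omega>. cis (u \<bullet> X 0 \<omega>) \<partial>N)"
  proof (rule integral_dominated_convergence[where w="\<lambda>_. 1"])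
    have [measurable]: "(\<lambda>x. cis (u \<bullet> x)) \<in> borel_measurable borel"
      by (intro borel_measurable_continuous_onI continuous_intros)
    note [measurable] = levy_process_measurable[OF X]
    have [measurable]: "X (1 / real (Suc m)) \<in> borel_measurable N" for m
      by (rule levy_process_measurable[OF X]) simp
    show "(\<lambda>\<omega>. cis (u \<bullet> X 0 \<omega>)) \<in> borel_measurable N"
      using measurable_compose[OF levy_process_measurable[OF X, of 0]] by simp
    show "(\<lambda>\<omega>. cis (u \<bullet> X (1 / real (Suc m)) \<omega>)) \<in> borel_measurable N" for m by measurable
    show "AE \<omega> in N. (\<lambda>m. cis (u \<bullet> X (1 / real (Suc m)) \<omega>)) \<longlonglongrightarrow> cis (u \<bullet> X 0 \<omega>)"
    proof (rule AE_I2)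
      fix \<omega> assume "\<omega> \<in> space N"
      then have "((\<lambda>t. X t \<omega>) \<longlongrightarrow> X 0 \<omega>) (at_right 0)"
        using levy_process_cadlag[OF X] unfolding cadlag_def by simp
      moreover have "filterlim (\<lambda>m. 1 / real (Suc m)) (at_right 0) sequentially"
        using LIMSEQ_inverse_real_of_nat
        by (auto simp: filterlim_at inverse_eq_divide)
      ultimately have "(\<lambda>m. X (1 / real (Suc m)) \<omega>) \<longlonglongrightarrow> X 0 \<omega>" by (rule filterlim_compose)
      then show "(\<lambda>m. cis (u \<bullet> X (1 / real (Suc m)) \<omega>)) \<longlonglongrightarrow> cis (u \<bullet> X 0 \<omega>)"
        by (intro tendsto_intros)
    qed
  qed auto
  moreover have "(\<integral>\<omega>. cis (u \<bullet> X (1 / real (Suc m)) \<omega>) \<partial>N) = 0" for m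
    using z[of m] by (subst (asm) char_fun_distr) (auto intro: levy_process_measurable[OF X])
  moreover have "(\<integral>\<omega>. cis (u \<bullet> X 0 \<omega>) \<partial>N) = (\<integral>\<omega>. 1 \<partial>N)"
    using X by (intro Bochner_Integration.integral_cong) (auto simp: levy_process_def)
  ultimately show False by (simp add: prob_space LIMSEQ_const_iff)
qed

section \<open>Triangular arrays with a Levy limit\<close>

lemma abs_cos_diff_le: "\<bar>cos x - cos y\<bar> \<le> \<bar>x - y\<bar>" for x y :: real
proof -
  have "\<bar>cos x - cos y\<bar> = 2 * (\<bar>sin ((x + y) / 2)\<bar> * \<bar>sin ((y - x) / 2)\<bar>)"
    unfolding cos_diff_cos by (simp add: abs_mult)
  also have "\<dots> \<le> 2 * (1 * \<bar>(y - x) / 2\<bar>)"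
    by (intro mult_left_mono mult_mono abs_sin_x_le_abs_x) auto
  finally show ?thesis by simp
qed

lemma abs_sin_minus_sin_le: "\<bar>sin x - sin y\<bar> \<le> \<bar>x - y\<bar>" for x y :: real
  using abs_cos_diff_le[of "x - pi / 2" "y - pi / 2"] by (simp add: cos_diff)

lemma weakly_convergesD:
  fixes f :: "'c::euclidean_space \<Rightarrow> real"
  assumes "weakly_converges P Q" "continuous_on UNIV f" "bounded (range f)"
  shows "(\<lambda>n. \<integral>x. f x \<partial>P n) \<longlonglongrightarrow> (\<integral>x. f x \<partial>Q)"
  using assms by (simp add: weakly_converges_def)

text \<open>The cosines and sines with frequency in the ball of radius \<open>r\<close> share the
  bound 1 and the Lipschitz constant \<open>r\<close>, so uniform weak convergence covers all of
  them together.\<close>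

lemma weakly_converges_char_fun_uniform:
  fixes P :: "nat \<Rightarrow> 'c::euclidean_space measure"
  assumes P: "\<And>n. borel_prob (P n)" and Q: "borel_prob Q" and w: "weakly_converges P Q" and e: "0 < e"
  shows "\<forall>\<^sub>F n in sequentially. \<forall>u\<in>cball 0 r. norm (char_fun (P n) u - char_fun Q u) \<le> e"
proof -
  have e2: "e / 2 > 0" using e by simp
  have parts: "Re (char_fun p u) = (\<integral>x. cos (u \<bullet> x) \<partial>p)" "Im (char_fun p u) = (\<integral>x. sin (u \<bullet> x) \<partial>p)"
    if "borel_prob p" for p :: "'c measure" and u
  proof -
    have "(\<lambda>x. cis (u \<bullet> x)) \<in> borel_measurable borel"
      by (intro borel_measurable_continuous_onI continuous_intros)
    then have "integrable p (\<lambda>x. cis (u \<bullet> x))"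
      by (rule borel_prob_integrable[OF that, of _ 1]) simp
    then show "Re (char_fun p u) = (\<integral>x. cos (u \<bullet> x) \<partial>p)" "Im (char_fun p u) = (\<integral>x. sin (u \<bullet> x) \<partial>p)"
      by (simp_all add: char_fun_def flip: integral_Re integral_Im)
  qed
  have lip: "\<bar>u \<bullet> x - u \<bullet> y\<bar> \<le> r * dist x y" if "u \<in> cball 0 r" for u x y :: 'c
  proof -
    have "\<bar>u \<bullet> x - u \<bullet> y\<bar> \<le> norm u * norm (x - y)"
      using Cauchy_Schwarz_ineq2[of u "x - y"] by (simp add: inner_diff_right)
    also have "\<dots> \<le> r * dist x y" using that by (auto simp: dist_norm intro!: mult_right_mono)
    finally show ?thesis .
  qed
  show ?thesis using weakly_converges_uniform[OF P Q w e2, of 1 r]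
  proof eventually_elim
    case (elim n)
    show ?case
    proof
      fix u :: 'c assume u: "u \<in> cball 0 r"
      have "\<bar>(\<integral>x. cos (u \<bullet> x) \<partial>P n) - (\<integral>x. cos (u \<bullet> x) \<partial>Q)\<bar> \<le> e / 2"
        by (rule elim[rule_format]) (use order.trans[OF abs_cos_diff_le lip[OF u]] in simp)
      moreover have "\<bar>(\<integral>x. sin (u \<bullet> x) \<partial>P n) - (\<integral>x. sin (u \<bullet> x) \<partial>Q)\<bar> \<le> e / 2"
        by (rule elim[rule_format]) (use order.trans[OF abs_sin_minus_sin_le lip[OF u]] in simp)
      ultimately show "norm (char_fun (P n) u - char_fun Q u) \<le> e"
        using cmod_le[of "char_fun (P n) u - char_fun Q u"] parts[OF P] parts[OF Q] by simp
    qed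
  qed
qed

lemma random_walk_0 [simp]: "random_walk Y 0 \<omega> = 0"
  by (simp add: random_walk_def)

text \<open>Row \<open>n\<close> has the steps \<open>Y n 1\<close>, \<open>Y n 2\<close> and so on.
  Only the limit law of the \<open>n\<close>-th partial sum of row \<open>n\<close> is prescribed;
  the limits of all other increments are derived from it.\<close>

locale levy_array =
  fixes M :: "'a measure" and N :: "'b measure"
    and Y :: "nat \<Rightarrow> nat \<Rightarrow> 'a \<Rightarrow> 'c::euclidean_space" and X :: "real \<Rightarrow> 'b \<Rightarrow> 'c"
  assumes steps: "\<And>n. iid_steps M (Y n)" and levy: "levy_process N X"
    and endpoint: "weakly_converges (\<lambda>n. distr M borel (random_walk (Y n) n)) (distr N borel (X 1))"
begin

sublocale M: prob_space M by (rule prob_space_iid_steps[OF steps])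
sublocale N: prob_space N using levy by (simp add: levy_process_def)

abbreviation V where "V n k \<equiv> random_walk (Y n) k"

abbreviation increment_law where
  "increment_law n a b \<equiv> distr M borel (\<lambda>\<omega>. V n b \<omega> - V n a \<omega>)"

lemma V_measurable [measurable]: "V n k \<in> borel_measurable M"
  by (rule random_walk_measurable[OF steps])

lemma X_measurable: "0 \<le> t \<Longrightarrow> X t \<in> borel_measurable N"
  by (rule levy_process_measurable[OF levy])

lemma borel_prob_V: "borel_prob (distr M borel (V n k))"
  by (intro borel_prob_distr M.prob_space_axioms V_measurable)

lemma borel_prob_increment: "borel_prob (increment_law n a b)"
  by (intro borel_prob_distr M.prob_space_axioms) measurable

text \<open>The value \<open>exp l\<close> fixes \<open>l\<close> only up to multiples of
  \<open>2 * pi * \<i>\<close>. Prescribing \<open>exp (l / m)\<close> for every \<open>m\<close>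
  pins it down, which is why \<open>l\<close> is described through the laws of
  \<open>X (1 / m)\<close>.\<close>

lemma char_fun_increment_tendsto:
  assumes n: "filterlim n at_top sequentially" and ab: "\<And>j. a j \<le> b j"
    and t: "(\<lambda>j. real (b j - a j) / real (n j)) \<longlonglongrightarrow> t"
  obtains l where "\<forall>m>0. char_fun (distr N borel (X (1 / real m))) u = exp (l / of_nat m)"
    and "(\<lambda>j. char_fun (increment_law (n j) (a j) (b j)) u) \<longlonglongrightarrow> exp (of_real t * l)"
proof -
  define r where "r = norm u"
  have u: "u \<in> cball 0 r" and r0: "0 \<in> cball (0::'c) r" by (auto simp: r_def)
  let ?\<phi> = "\<lambda>t. char_fun (distr N borel (X t))"
  have bp: "borel_prob (distr N borel (X t))" if "0 \<le> t" for t
    using that by (rule borel_prob_levy[OF levy])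
  obtain h where h: "continuous_on (cball 0 r) h" "\<And>u. u \<in> cball 0 r \<Longrightarrow> ?\<phi> 1 u = exp (h u)"
    by (rule continuous_logarithm_on_cball[of 0 r "?\<phi> 1"])
      (use continuous_on_char_fun[OF bp[of 1]] char_fun_levy_nonzero[OF levy] in auto)
  \<comment> \<open>As \<open>exp (h 0) = 1\<close>, subtracting \<open>h 0\<close> leaves a
    logarithm, now vanishing at the origin as the selection of the branch requires.\<close>
  define L where "L u = h u - h 0" for u
  have eh: "exp (h 0) = 1" using h(2)[OF r0] char_fun_0[OF bp[of 1]] by simp
  have L: "continuous_on (cball 0 r) L" "L 0 = 0" "\<And>u. u \<in> cball 0 r \<Longrightarrow> ?\<phi> 1 u = exp (L u)"
    using h by (auto simp: L_def exp_diff eh intro!: continuous_intros)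
  define c where "c n = char_fun (distr M borel (Y n 1))" for n
  have bpY: "borel_prob (distr M borel (Y n 1))" for n
    by (intro borel_prob_distr M.prob_space_axioms iid_steps_measurable[OF steps]) simp
  have c: "continuous_on (cball 0 r) (c n)" "c n 0 = 1" for n
    using continuous_on_char_fun[OF bpY] char_fun_0[OF bpY] by (auto simp: c_def)
  have cV: "char_fun (increment_law n a b) u = c n u ^ (b - a)" if "a \<le> b" for n a b u
    unfolding c_def by (rule char_fun_random_walk[OF steps that])
  have cn: "char_fun (distr M borel (V n n)) u = c n u ^ n" for n u
    using cV[of 0 n n u] by (simp only: random_walk_0 diff_zero le0)
  have unif: "\<forall>\<^sub>F n in sequentially. \<forall>u\<in>cball 0 r. norm (c n u ^ n - exp (L u)) \<le> e" if "e > 0" for e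
    using weakly_converges_char_fun_uniform[OF borel_prob_V bp[OF zero_le_one] endpoint that, of r]
  proof eventually_elim
    case (elim n)
    show ?case
    proof
      fix u :: 'c assume u: "u \<in> cball 0 r"
      show "norm (c n u ^ n - exp (L u)) \<le> e"
        using bspec[OF elim u] by (simp only: L(3)[OF u] cn)
    qed
  qed
  obtain z where z: "z \<longlonglongrightarrow> 0" "\<forall>\<^sub>F n in sequentially. c n u = exp ((L u + z n) / of_nat n)"
    by (rule char_fun_array_log[OF c L(1,2) unif u])
  show thesis
  proof (rule that)
    have "?\<phi> (1 / real m) u = exp (L u / of_nat m)" if m: "0 < m" for m
    proof (rule continuous_root_eq_exp[of "cball 0 r" 0 _ L m u])
      show "?\<phi> (1 / real m) u ^ m = exp (L u)" if "u \<in> cball 0 r" for u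
        using char_fun_levy_root[OF levy m] L(3)[OF that] by simp
    qed (use r0 L u m bp in \<open>auto intro: continuous_on_char_fun char_fun_0\<close>)
    then show "\<forall>m>0. ?\<phi> (1 / real m) u = exp (L u / of_nat m)" by blast
    have "(\<lambda>j. c (n j) u ^ (b j - a j)) \<longlonglongrightarrow> exp (of_real t * L u)"
      by (rule exp_array_power_tendsto[OF z n t])
    then show "(\<lambda>j. char_fun (increment_law (n j) (a j) (b j)) u) \<longlonglongrightarrow> exp (of_real t * L u)"
      by (simp add: cV[OF ab])
  qed
qed

text \<open>The premise \<open>char\<close> quantifies over \<open>l\<close> because the exponent is
  known only through its roots. The two cases used are \<open>t = 1 / m\<close>, for grid
  increments, and \<open>t = 0\<close>, for increments over few steps.\<close>

lemma increment_weakly_converges: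
  assumes n: "filterlim n at_top sequentially" and ab: "\<And>j. a j \<le> b j"
    and t: "(\<lambda>j. real (b j - a j) / real (n j)) \<longlonglongrightarrow> t" and Q: "borel_prob Q"
    and char: "\<And>u l. \<forall>m>0. char_fun (distr N borel (X (1 / real m))) u = exp (l / of_nat m) \<Longrightarrow>
      char_fun Q u = exp (of_real t * l)"
  shows "weakly_converges (\<lambda>j. increment_law (n j) (a j) (b j)) Q"
proof (rule char_fun_continuity[OF borel_prob_increment Q])
  fix u
  obtain l where l: "\<forall>m>0. char_fun (distr N borel (X (1 / real m))) u = exp (l / of_nat m)"
    "(\<lambda>j. char_fun (increment_law (n j) (a j) (b j)) u) \<longlonglongrightarrow> exp (of_real t * l)"
    by (rule char_fun_increment_tendsto[OF n ab t, of u])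
  show "(\<lambda>j. char_fun (increment_law (n j) (a j) (b j)) u) \<longlonglongrightarrow> char_fun Q u"
    unfolding char[OF l(1)] by (rule l(2))
qed

lemma increment_weakly_converges_levy:
  assumes "filterlim n at_top sequentially" "\<And>j. a j \<le> b j"
    and "(\<lambda>j. real (b j - a j) / real (n j)) \<longlonglongrightarrow> 1 / real m" "0 < m"
  shows "weakly_converges (\<lambda>j. increment_law (n j) (a j) (b j)) (distr N borel (X (1 / real m)))"
  by (rule increment_weakly_converges[OF assms(1-3) borel_prob_levy[OF levy]]) (use assms(4) in auto)

lemma increment_weakly_converges_0:
  assumes "filterlim n at_top sequentially" "\<And>j. a j \<le> b j"
    and "(\<lambda>j. real (b j - a j) / real (n j)) \<longlonglongrightarrow> 0"
  shows "weakly_converges (\<lambda>j. increment_law (n j) (a j) (b j)) (distr N borel (\<lambda>_. 0))"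
proof (rule increment_weakly_converges[OF assms])
  show "borel_prob (distr N borel (\<lambda>_. 0::'c))" by (intro borel_prob_distr N.prob_space_axioms) simp
  show "char_fun (distr N borel (\<lambda>_. 0::'c)) u = exp (of_real 0 * l)" for u l
    by (subst char_fun_distr) (auto simp: N.prob_space)
qed

text \<open>Uniformity in \<open>a\<close> and \<open>b\<close> is obtained by contradiction: bad
  triples \<open>n j\<close>, \<open>a j\<close>, \<open>b j\<close>, with \<open>b j - a j\<close>
  of smaller order than \<open>n j\<close>, would form a sequence of increments to which convergence
  to 0 applies.\<close>

lemma increment_small:
  assumes e: "0 < e" and \<eta>: "0 < \<eta>"
  obtains m0 :: nat where "0 < m0" "\<forall>\<^sub>F n in sequentially. \<forall>a b. a \<le> b \<and> (b - a) * m0 \<le> n \<longrightarrow>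
    M.prob {\<omega> \<in> space M. e < norm (V n b \<omega> - V n a \<omega>)} \<le> \<eta>"
proof (rule ccontr)
  assume contra: "\<not> thesis"
  \<comment> \<open>The failure is taken at level \<open>Suc j\<close> and beyond index
    \<open>j\<close>, so that \<open>n j\<close> tends to infinity and the ratios are at most
    \<open>1 / Suc j\<close>.\<close>
  have "\<exists>n a b. j \<le> n \<and> a \<le> b \<and> (b - a) * Suc j \<le> n \<and>
      \<eta> < M.prob {\<omega> \<in> space M. e < norm (V n b \<omega> - V n a \<omega>)}" (is "?E j") for j
  proof (rule ccontr)
    assume no: "\<not> ?thesis"
    have "\<forall>\<^sub>F n in sequentially. \<forall>a b. a \<le> b \<and> (b - a) * Suc j \<le> n \<longrightarrow>
      M.prob {\<omega> \<in> space M. e < norm (V n b \<omega> - V n a \<omega>)} \<le> \<eta>"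
      using eventually_ge_at_top[of j]
    proof eventually_elim
      case (elim n)
      show ?case
      proof (intro allI impI, rule ccontr)
        fix a b assume "a \<le> b \<and> (b - a) * Suc j \<le> n"
          "\<not> M.prob {\<omega> \<in> space M. e < norm (V n b \<omega> - V n a \<omega>)} \<le> \<eta>"
        then have "\<exists>n a b. j \<le> n \<and> a \<le> b \<and> (b - a) * Suc j \<le> n \<and>
            \<eta> < M.prob {\<omega> \<in> space M. e < norm (V n b \<omega> - V n a \<omega>)}"
          using elim by (intro exI[of _ n] exI[of _ a] exI[of _ b]) (simp only: not_le simp_thms)
        with no show False by (rule notE)
      qed
    qed
    with zero_less_Suc have thesis by (rule that)
    with contra show False by (rule notE)
  qed
  then have "\<forall>j. ?E j" by (rule allI)
  from this[unfolded choice_iff] obtain n a b where "\<forall>j. j \<le> n j \<and> a j \<le> b j \<and> (b j - a j) * Suc j \<le> n j \<and>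
      \<eta> < M.prob {\<omega> \<in> space M. e < norm (V (n j) (b j) \<omega> - V (n j) (a j) \<omega>)}"
    by (elim exE) (rule that)
  then have nab: "\<And>j. j \<le> n j" "\<And>j. a j \<le> b j" "\<And>j. (b j - a j) * Suc j \<le> n j"
      "\<And>j. \<eta> < M.prob {\<omega> \<in> space M. e < norm (V (n j) (b j) \<omega> - V (n j) (a j) \<omega>)}"
    by blast+
  have n: "filterlim n at_top sequentially"
    by (rule filterlim_at_top_mono[OF filterlim_ident]) (use nab(1) in auto)
  have "(\<lambda>j. real (b j - a j) / real (n j)) \<longlonglongrightarrow> 0"
  proof (rule real_tendsto_sandwich[OF _ _ tendsto_const LIMSEQ_inverse_real_of_nat])
    show "\<forall>\<^sub>F j in sequentially. real (b j - a j) / real (n j) \<le> inverse (real (Suc j))"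
    proof (rule always_eventually, rule allI)
      fix j
      show "real (b j - a j) / real (n j) \<le> inverse (real (Suc j))"
      \<comment> \<open>For \<open>n j = 0\<close> the quotient is 0 by the convention for
        division.\<close>
      proof (cases "n j = 0")
        case False
        have "real (b j - a j) * real (Suc j) \<le> real (n j)"
          using nab(3)[of j] by (metis of_nat_le_iff of_nat_mult)
        then show ?thesis using False by (simp add: field_simps)
      qed simp
    qed
  qed simp
  \<comment> \<open>\<open>min 1 (norm x / e)\<close> is a bounded continuous majorant of the
    indicator of \<open>e < norm x\<close> that vanishes at the limit point 0.\<close>
  from increment_weakly_converges_0[OF n nab(2) this]
  have "(\<lambda>j. \<integral>x. min 1 (norm x / e) \<partial>increment_law (n j) (a j) (b j))
    \<longlonglongrightarrow> (\<integral>x. min 1 (norm x / e) \<partial>distr N borel (\<lambda>_. 0::'c))"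
  proof (rule weakly_convergesD)
    show "continuous_on UNIV (\<lambda>x::'c. min 1 (norm x / e))"
      using e by (intro continuous_intros) simp
    show "bounded (range (\<lambda>x::'c. min 1 (norm x / e)))"
      using e by (auto simp: bounded_iff intro!: exI[of _ 1])
  qed
  also have "(\<integral>x. min 1 (norm x / e) \<partial>distr N borel (\<lambda>_. 0::'c)) = 0"
    by (subst integral_distr) auto
  finally have "\<forall>\<^sub>F j in sequentially.
      (\<integral>x. min 1 (norm x / e) \<partial>increment_law (n j) (a j) (b j)) < \<eta>"
    using \<eta> by (rule order_tendstoD)
  then obtain j where j: "(\<integral>x. min 1 (norm x / e) \<partial>increment_law (n j) (a j) (b j)) < \<eta>"
    by (auto dest!: eventually_happens)
  let ?A = "{\<omega> \<in> space M. e < norm (V (n j) (b j) \<omega> - V (n j) (a j) \<omega>)}"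
  have A: "?A \<in> sets M" by measurable
  have "M.prob ?A \<le> (\<integral>\<omega>. min 1 (norm (V (n j) (b j) \<omega> - V (n j) (a j) \<omega>) / e) \<partial>M)"
  proof (rule M.prob_le_expectation[OF A])
    show "integrable M (\<lambda>\<omega>. min 1 (norm (V (n j) (b j) \<omega> - V (n j) (a j) \<omega>) / e))"
      using e by (intro M.integrable_const_bound[of _ 1] AE_I2) auto
  qed (use e in \<open>auto simp: pos_le_divide_eq\<close>)
  also have "\<dots> = (\<integral>x. min 1 (norm x / e) \<partial>increment_law (n j) (a j) (b j))"
    by (simp add: integral_distr)
  finally show False using j nab(4)[of j] by simp
qed

end

section \<open>Grids and first entrance times\<close>

definition grid :: "nat \<Rightarrow> nat \<Rightarrow> nat \<Rightarrow> nat" where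
  "grid m n j = (j * n) div m"

lemma grid_0 [simp]: "grid m n 0 = 0"
  by (simp add: grid_def)

lemma grid_end: "0 < m \<Longrightarrow> grid m n m = n"
  by (simp add: grid_def)

lemma grid_mono: "i \<le> j \<Longrightarrow> grid m n i \<le> grid m n j"
  by (auto simp: grid_def intro!: div_le_mono)

text \<open>The grid time preceding the least one not below \<open>k\<close> lies below
  \<open>k\<close>, so the gap is at most \<open>n / m\<close>. The product form matches the
  condition on increments in \<open>increment_small\<close>.\<close>

lemma grid_successor:
  assumes m: "0 < m" and k: "k \<le> n"
  shows "\<exists>j\<le>m. k \<le> grid m n j \<and> (grid m n j - k) * m \<le> n"
proof -
  define j where "j = (LEAST j. k \<le> grid m n j)"
  have j: "k \<le> grid m n j" unfolding j_def by (rule LeastI[of _ m]) (simp add: grid_end m k)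
  have jm: "j \<le> m" unfolding j_def by (rule Least_le) (simp add: grid_end m k)
  have "(grid m n j - k) * m \<le> n"
  proof (cases j)
    case 0
    then show ?thesis by simp
  next
    case (Suc i)
    have "\<not> k \<le> grid m n i" using not_less_Least[of i "\<lambda>j. k \<le> grid m n j"] Suc by (simp add: j_def)
    then have "(i * n) div m < k" by (simp add: grid_def)
    then have "i * n < k * m" using m by (simp add: div_less_iff_less_mult)
    moreover have "grid m n j * m \<le> j * n" by (simp add: grid_def)
    ultimately show ?thesis using Suc by (simp add: diff_mult_distrib)
  qed
  then show ?thesis using j jm by blast
qed

lemma grid_increment_tendsto:
  assumes m: "0 < m"
  shows "(\<lambda>n. real (grid m n (Suc i) - grid m n i) / real n) \<longlonglongrightarrow> 1 / real m"
proof -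
  have gr: "real (j * n) / real m - 1 \<le> real (grid m n j)" "real (grid m n j) \<le> real (j * n) / real m" for n j
  proof -
    have "real (grid m n j) = real_of_int \<lfloor>real (j * n) / real m\<rfloor>"
      unfolding grid_def floor_divide_of_nat_eq by simp
    then show "real (j * n) / real m - 1 \<le> real (grid m n j)" "real (grid m n j) \<le> real (j * n) / real m"
      by linarith+
  qed
  have d: "real (grid m n (Suc i) - grid m n i) = real (grid m n (Suc i)) - real (grid m n i)" for n
    by (intro of_nat_diff grid_mono) simp
  have mm: "real (Suc i * n) / real m = real (i * n) / real m + real n / real m" for n
    by (simp add: distrib_right add_divide_distrib)
  show ?thesis
  proof (rule real_tendsto_sandwich)
    show "\<forall>\<^sub>F n in sequentially. 1 / real m - 1 / real n \<le> real (grid m n (Suc i) - grid m n i) / real n"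
      using eventually_gt_at_top[of 0]
    proof eventually_elim
      case (elim n)
      have "real n / real m - 1 \<le> real (grid m n (Suc i) - grid m n i)"
        unfolding d using gr(1)[of "Suc i" n] gr(2)[of n i] mm[of n] by linarith
      then have "(real n / real m - 1) / real n \<le> real (grid m n (Suc i) - grid m n i) / real n"
        by (rule divide_right_mono) simp
      then show ?case using elim by (simp add: diff_divide_distrib)
    qed
    show "\<forall>\<^sub>F n in sequentially. real (grid m n (Suc i) - grid m n i) / real n \<le> 1 / real m + 1 / real n"
      using eventually_gt_at_top[of 0]
    proof eventually_elim
      case (elim n)
      have "real (grid m n (Suc i) - grid m n i) \<le> real n / real m + 1"
        unfolding d using gr(1)[of i n] gr(2)[of n "Suc i"] mm[of n] by linarith
      then have "real (grid m n (Suc i) - grid m n i) / real n \<le> (real n / real m + 1) / real n"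
        by (rule divide_right_mono) simp
      then show ?case using elim by (simp add: add_divide_distrib)
    qed
    show "(\<lambda>n. 1 / real m - 1 / real n) \<longlonglongrightarrow> 1 / real m"
      using tendsto_diff[OF tendsto_const lim_1_over_n, of "1 / real m"] by simp
    show "(\<lambda>n. 1 / real m + 1 / real n) \<longlonglongrightarrow> 1 / real m"
      using tendsto_add[OF tendsto_const lim_1_over_n, of "1 / real m"] by simp
  qed
qed

text \<open>Entering \<open>A\<close> first at time \<open>k\<close> depends on the steps up to
  \<open>k\<close>, the increment to \<open>g k\<close> on later ones. As the entrances are
  disjoint, the total probability of a bad increment is at most \<delta>, whatever \<open>n\<close>
  is. The time found in the conclusion is that of the first visit to \<open>A\<close>, not the given
  \<open>k\<close>.\<close>

lemma first_entrance:
  fixes Y :: "nat \<Rightarrow> 'a \<Rightarrow> 'c::euclidean_space"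
  assumes Y: "iid_steps M Y" and A: "A \<in> sets borel" and g: "\<And>k. k \<le> n \<Longrightarrow> k \<le> g k"
    and \<delta>: "\<And>k. k \<le> n \<Longrightarrow>
      measure M {\<omega> \<in> space M. e < norm (random_walk Y (g k) \<omega> - random_walk Y k \<omega>)} \<le> \<delta>"
  shows "\<exists>B. B \<in> sets M \<and> measure M B \<le> \<delta> \<and>
    (\<forall>\<omega>\<in>space M - B. \<forall>k\<le>n. random_walk Y k \<omega> \<in> A \<longrightarrow>
      (\<exists>k\<le>n. random_walk Y k \<omega> \<in> A \<and> dist (random_walk Y k \<omega>) (random_walk Y (g k) \<omega>) \<le> e))"
proof -
  interpret prob_space M using Y by (rule prob_space_iid_steps)
  let ?V = "random_walk Y"
  have [measurable]: "?V k \<in> borel_measurable M" for k by (rule random_walk_measurable[OF Y])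
  note [measurable] = A
  define T where "T k = {\<omega> \<in> space M. ?V k \<omega> \<in> A \<and> (\<forall>i<k. ?V i \<omega> \<notin> A)}" for k
  define D where "D k = {\<omega> \<in> space M. e < norm (?V (g k) \<omega> - ?V k \<omega>)}" for k
  have T [measurable]: "T k \<in> sets M" for k unfolding T_def by measurable
  have D [measurable]: "D k \<in> sets M" for k unfolding D_def by measurable
  \<comment> \<open>The steps split at \<open>k\<close> into two independent blocks, and each of the
    two events is the preimage of a measurable set of values of one block.\<close>
  have indep: "prob (T k \<inter> D k) = prob (T k) * prob (D k)" if k: "k \<le> n" for k
  proof -
    let ?P = "\<lambda>\<omega>. restrict (\<lambda>i. Y i \<omega>) {1..k}" and ?F = "\<lambda>\<omega>. restrict (\<lambda>i. Y i \<omega>) {k<..g k}"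
    let ?S = "\<lambda>(x :: nat \<Rightarrow> 'c) j. \<Sum>i\<in>{1..j}. x i"
    let ?Xa = "{x \<in> space (PiM {1..k} (\<lambda>_. borel)). ?S x k \<in> A \<and> (\<forall>j<k. ?S x j \<notin> A)}"
    let ?Xb = "{x \<in> space (PiM {k<..g k} (\<lambda>_. borel :: 'c measure)). e < norm (\<Sum>i\<in>{k<..g k}. x i)}"
    have S: "(\<lambda>x. ?S x j) \<in> borel_measurable (PiM {1..k} (\<lambda>_. borel :: 'c measure))" if "j \<le> k" for j
      using that by (intro borel_measurable_sum measurable_component_singleton) auto
    have SA: "{x \<in> space (PiM {1..k} (\<lambda>_. borel)). ?S x j \<in> A} \<in> sets (PiM {1..k} (\<lambda>_. borel))" if "j \<le> k" for j
      using measurable_sets[OF S[OF that] A] by (simp add: vimage_def Int_def conj_commute)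
    have Xa: "?Xa \<in> sets (PiM {1..k} (\<lambda>_. borel))"
    proof -
      have "?Xa = {x \<in> space (PiM {1..k} (\<lambda>_. borel)). ?S x k \<in> A} -
          (\<Union>j\<in>{..<k}. {x \<in> space (PiM {1..k} (\<lambda>_. borel)). ?S x j \<in> A})"
        by (rule set_eqI) (simp, blast)
      also have "\<dots> \<in> sets (PiM {1..k} (\<lambda>_. borel))"
        by (intro sets.Diff sets.finite_UN SA) auto
      finally show ?thesis .
    qed
    have "(\<lambda>x. \<Sum>i\<in>{k<..g k}. x i) \<in> borel_measurable (PiM {k<..g k} (\<lambda>_. borel :: 'c measure))"
      by (intro borel_measurable_sum measurable_component_singleton)
    from measurable_compose[OF this borel_measurable_norm]
    have Xb: "?Xb \<in> sets (PiM {k<..g k} (\<lambda>_. borel))"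
      by (intro borel_measurable_less borel_measurable_const)
    have ind: "indep_var (PiM {1..k} (\<lambda>_. borel)) ?P (PiM {k<..g k} (\<lambda>_. borel)) ?F"
      by (rule indep_var_restrict[OF iid_steps_indep[OF Y]]) auto
    have VP: "?V j \<omega> = ?S (?P \<omega>) j" if "j \<le> k" for j \<omega>
      unfolding random_walk_def using that by (intro sum.cong) auto
    have VF: "?V (g k) \<omega> - ?V k \<omega> = (\<Sum>i\<in>{k<..g k}. ?F \<omega> i)" for \<omega>
      unfolding random_walk_diff[OF g[OF k]] by (intro sum.cong) auto
    have TP: "T k = ?P -` ?Xa \<inter> space M"
      unfolding T_def by (rule set_eqI) (auto simp: VP space_PiM)
    have DF: "D k = ?F -` ?Xb \<inter> space M"
      unfolding D_def VF by (rule set_eqI) (auto simp: space_PiM)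
    have "T k \<inter> D k = (\<lambda>x. (?P x, ?F x)) -` (?Xa \<times> ?Xb) \<inter> space M"
      unfolding TP DF by (rule set_eqI) (simp only: Int_iff vimage_eq mem_Times_iff fst_conv snd_conv, blast)
    then show ?thesis
      using indep_varD[OF ind Xa Xb] unfolding TP DF by (simp only:)
  qed
  show ?thesis
  proof (intro exI[of _ "\<Union>k\<in>{..n}. T k \<inter> D k"] conjI ballI allI impI)
    show "(\<Union>k\<in>{..n}. T k \<inter> D k) \<in> sets M" by measurable
    have \<delta>0: "0 \<le> \<delta>" using \<delta>[of 0] measure_nonneg order.trans by blast
    have "prob (\<Union>k\<in>{..n}. T k \<inter> D k) \<le> (\<Sum>k\<in>{..n}. prob (T k \<inter> D k))"
      by (rule finite_measure_subadditive_finite) auto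
    also have "\<dots> \<le> (\<Sum>k\<in>{..n}. prob (T k) * \<delta>)"
    proof (rule sum_mono)
      fix k assume "k \<in> {..n}"
      then have k: "k \<le> n" by simp
      have "prob (D k) \<le> \<delta>" unfolding D_def by (rule \<delta>[OF k])
      then show "prob (T k \<inter> D k) \<le> prob (T k) * \<delta>"
        unfolding indep[OF k] by (rule mult_left_mono) simp
    qed
    \<comment> \<open>Disjointness enters here: the entrance probabilities add up to a single
      probability, so no factor \<open>n + 1\<close> appears.\<close>
    also have "\<dots> = prob (\<Union>k\<in>{..n}. T k) * \<delta>"
    proof -
      have "disjoint_family_on T {..n}"
        unfolding disjoint_family_on_def
      proof (intro ballI impI)
        fix i j :: nat assume "i \<noteq> j"
        then show "T i \<inter> T j = {}" unfolding T_def by (cases i j rule: linorder_cases) auto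
      qed
      then have "prob (\<Union>k\<in>{..n}. T k) = (\<Sum>k\<in>{..n}. prob (T k))"
        by (intro finite_measure_finite_Union) auto
      then show ?thesis by (simp add: sum_distrib_right)
    qed
    also have "\<dots> \<le> 1 * \<delta>" using \<delta>0 by (intro mult_right_mono) auto
    finally show "prob (\<Union>k\<in>{..n}. T k \<inter> D k) \<le> \<delta>" by simp
  next
    fix \<omega> k assume \<omega>: "\<omega> \<in> space M - (\<Union>k\<in>{..n}. T k \<inter> D k)" and k: "k \<le> n" "?V k \<omega> \<in> A"
    define \<tau> where "\<tau> = (LEAST k. ?V k \<omega> \<in> A)"
    have \<tau>: "?V \<tau> \<omega> \<in> A" unfolding \<tau>_def by (rule LeastI[of _ k]) (rule k(2))
    have "\<tau> \<le> k" unfolding \<tau>_def by (rule Least_le) (rule k(2))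
    then have \<tau>n: "\<tau> \<le> n" using k(1) by simp
    have "\<omega> \<in> T \<tau>" unfolding T_def using \<tau> \<omega> not_less_Least by (auto simp: \<tau>_def)
    then have "\<omega> \<notin> D \<tau>" using \<omega> \<tau>n by auto
    then have "norm (?V (g \<tau>) \<omega> - ?V \<tau> \<omega>) \<le> e" using \<omega> by (simp add: D_def)
    then show "\<exists>k\<le>n. ?V k \<omega> \<in> A \<and> dist (?V k \<omega>) (?V (g k) \<omega>) \<le> e"
      using \<tau> \<tau>n by (intro exI[of _ \<tau>]) (simp add: dist_norm norm_minus_commute)
  qed
qed

text \<open>First entrances are applied to the balls of the cover and to the outside of the large
  ball, \<open>card C + 1\<close> sets in all. The outside is then never visited: at the first visit
  the walk would be within \<open>e \<le> 1\<close> of a grid value of norm at most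
  \<open>R + 1\<close>.\<close>

lemma walk_close_to_grid:
  fixes Y :: "nat \<Rightarrow> 'a \<Rightarrow> 'c::euclidean_space" and C :: "'c set"
  assumes Y: "iid_steps M Y" and e: "e \<le> 1" and m: "0 < m"
    and C: "finite C" "cball 0 (R + 2) \<subseteq> (\<Union>c\<in>C. ball c e)"
    and \<delta>: "\<And>a b. a \<le> b \<Longrightarrow> (b - a) * m \<le> n \<Longrightarrow>
      measure M {\<omega> \<in> space M. e < norm (random_walk Y b \<omega> - random_walk Y a \<omega>)} \<le> \<delta>"
  obtains B where "B \<in> sets M"
    "measure M B \<le> (real (card C) + 1) * \<delta> +
      measure M {\<omega> \<in> space M. \<exists>j\<le>m. R + 1 < norm (random_walk Y (grid m n j) \<omega>)}"
    "\<And>\<omega> k. \<omega> \<in> space M - B \<Longrightarrow> k \<le> n \<Longrightarrow>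
      \<exists>j\<le>m. dist (random_walk Y k \<omega>) (random_walk Y (grid m n j) \<omega>) \<le> 3 * e"
proof -
  interpret prob_space M using Y by (rule prob_space_iid_steps)
  let ?V = "random_walk Y"
  have [measurable]: "?V k \<in> borel_measurable M" for k by (rule random_walk_measurable[OF Y])
  have "\<forall>k\<in>{..n}. \<exists>j. j \<le> m \<and> k \<le> grid m n j \<and> (grid m n j - k) * m \<le> n"
    using grid_successor[OF m] by simp
  from bchoice[OF this] obtain jj where
    jj': "\<forall>k\<in>{..n}. jj k \<le> m \<and> k \<le> grid m n (jj k) \<and> (grid m n (jj k) - k) * m \<le> n" ..
  have jj: "jj k \<le> m \<and> k \<le> grid m n (jj k) \<and> (grid m n (jj k) - k) * m \<le> n" if "k \<le> n" for k
    using bspec[OF jj'] that by simp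
  define g where "g k = grid m n (jj k)" for k
  have g: "k \<le> g k" if "k \<le> n" for k using jj[OF that] by (simp add: g_def)
  have \<delta>g: "prob {\<omega> \<in> space M. e < norm (?V (g k) \<omega> - ?V k \<omega>)} \<le> \<delta>" if "k \<le> n" for k
    using jj[OF that] by (intro \<delta>) (auto simp: g_def)
  have "\<forall>A\<in>sets borel. \<exists>B. B \<in> sets M \<and> prob B \<le> \<delta> \<and>
    (\<forall>\<omega>\<in>space M - B. \<forall>k\<le>n. ?V k \<omega> \<in> A \<longrightarrow>
      (\<exists>k\<le>n. ?V k \<omega> \<in> A \<and> dist (?V k \<omega>) (?V (g k) \<omega>) \<le> e))"
    using first_entrance[OF Y _ g \<delta>g] by (intro ballI) simp
  from bchoice[OF this] obtain E where
    E': "\<forall>A\<in>sets borel. E A \<in> sets M \<and> prob (E A) \<le> \<delta> \<and>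
      (\<forall>\<omega>\<in>space M - E A. \<forall>k\<le>n. ?V k \<omega> \<in> A \<longrightarrow>
        (\<exists>k\<le>n. ?V k \<omega> \<in> A \<and> dist (?V k \<omega>) (?V (g k) \<omega>) \<le> e))" ..
  have E: "E A \<in> sets M" "prob (E A) \<le> \<delta>"
    "\<And>\<omega> k. \<omega> \<in> space M - E A \<Longrightarrow> k \<le> n \<Longrightarrow> ?V k \<omega> \<in> A \<Longrightarrow>
      \<exists>k\<le>n. ?V k \<omega> \<in> A \<and> dist (?V k \<omega>) (?V (g k) \<omega>) \<le> e"
    if "A \<in> sets borel" for A
    using bspec[OF E' that] by simp_all
  define F where "F = - cball (0::'c) (R + 2)"
  define G where "G = {\<omega> \<in> space M. \<exists>j\<le>m. R + 1 < norm (?V (grid m n j) \<omega>)}"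
  have F: "F \<in> sets borel" by (simp add: F_def)
  have b: "ball c e \<in> sets borel" for c :: 'c by simp
  have G: "G \<in> sets M" unfolding G_def by measurable
  define U where "U = (\<Union>c\<in>C. E (ball c e))"
  have U: "U \<in> sets M" unfolding U_def using E(1)[OF b] C(1) by (intro sets.finite_UN) auto
  show thesis
  proof (rule that)
    show "U \<union> E F \<union> G \<in> sets M" using U G E(1)[OF F] by (intro sets.Un)
    have "prob (U \<union> E F \<union> G) \<le> prob (U \<union> E F) + prob G"
      using U G E(1)[OF F] by (intro measure_Un_le) auto
    also have "prob (U \<union> E F) \<le> prob U + prob (E F)"
      using U E(1)[OF F] by (intro measure_Un_le) auto
    also have "prob U \<le> (\<Sum>c\<in>C. prob (E (ball c e)))"
      unfolding U_def using C(1) E(1)[OF b] by (intro finite_measure_subadditive_finite) auto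
    also have "\<dots> \<le> (\<Sum>c\<in>C. \<delta>)" by (intro sum_mono E(2) b)
    finally show "prob (U \<union> E F \<union> G) \<le> (real (card C) + 1) * \<delta> +
        prob {\<omega> \<in> space M. \<exists>j\<le>m. R + 1 < norm (?V (grid m n j) \<omega>)}"
      using E(2)[OF F] by (simp add: distrib_right G_def)
  next
    fix \<omega> k assume \<omega>: "\<omega> \<in> space M - (U \<union> E F \<union> G)" and k: "k \<le> n"
    have gr: "norm (?V (g i) \<omega>) \<le> R + 1" if "i \<le> n" for i
      using \<omega> jj[OF that] by (auto simp: G_def g_def not_less)
    have "?V k \<omega> \<notin> F"
    proof
      assume "?V k \<omega> \<in> F"
      moreover have "\<omega> \<in> space M - E F" using \<omega> by blast
      ultimately obtain i where i: "i \<le> n" "?V i \<omega> \<in> F" "dist (?V i \<omega>) (?V (g i) \<omega>) \<le> e"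
        using E(3)[OF F _ k] by blast
      have "norm (?V i \<omega>) \<le> norm (?V (g i) \<omega>) + norm (?V i \<omega> - ?V (g i) \<omega>)" by (rule norm_triangle_sub)
      then have "norm (?V i \<omega>) \<le> R + 2" using gr[OF i(1)] i(3) e by (simp add: dist_norm)
      then show False using i(2) by (simp add: F_def)
    qed
    then obtain c where c: "c \<in> C" "?V k \<omega> \<in> ball c e" using C(2) by (auto simp: F_def)
    moreover have "\<omega> \<in> space M - E (ball c e)" using \<omega> c(1) by (auto simp: U_def)
    ultimately obtain i where i: "i \<le> n" "?V i \<omega> \<in> ball c e" "dist (?V i \<omega>) (?V (g i) \<omega>) \<le> e"
      using E(3)[OF b _ k] by blast
    \<comment> \<open>One \<open>e\<close> each from the given value to the centre, from the centre
      to the entrance point of that ball, and from there to its grid value.\<close>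
    have "dist (?V k \<omega>) (?V (g i) \<omega>) \<le> dist c (?V k \<omega>) + (dist c (?V i \<omega>) + dist (?V i \<omega>) (?V (g i) \<omega>))"
      using dist_triangle3[of "?V k \<omega>" "?V (g i) \<omega>" c] dist_triangle[of c "?V (g i) \<omega>" "?V i \<omega>"] by linarith
    also have "\<dots> \<le> 3 * e" using c(2) i by simp
    finally show "\<exists>j\<le>m. dist (?V k \<omega>) (?V (grid m n j) \<omega>) \<le> 3 * e"
      using jj[OF i(1)] by (auto simp: g_def)
  qed
qed

section \<open>Finite-dimensional distributions\<close>

text \<open>Lindeberg's replacement, one coordinate at a time. Integrating out a coordinate keeps
  the bound and the Lipschitz constant in the others, so the induction hypothesis applies to the
  averaged function. The premise \<open>close\<close> covers a whole class of functions because the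
  section in coordinate \<open>i\<close> varies with the remaining coordinates.\<close>

lemma product_measure_replacement:
  fixes P Q :: "'i \<Rightarrow> 'c::euclidean_space measure" and F :: "('i \<Rightarrow> 'c) \<Rightarrow> real"
  assumes I: "finite I" and P: "\<And>i. borel_prob (P i)" and Q: "\<And>i. borel_prob (Q i)"
    and F: "F \<in> borel_measurable (PiM I (\<lambda>_. borel))" "\<And>x. \<bar>F x\<bar> \<le> B"
      "\<And>x i a b. i \<in> I \<Longrightarrow> \<bar>F (x(i := a)) - F (x(i := b))\<bar> \<le> L * dist a b"
    and close: "\<And>i f. i \<in> I \<Longrightarrow> (\<And>x. \<bar>f x\<bar> \<le> B) \<Longrightarrow> (\<And>x y. \<bar>f x - f y\<bar> \<le> L * dist x y) \<Longrightarrow>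
      \<bar>(\<integral>x. f x \<partial>P i) - (\<integral>x. f x \<partial>Q i)\<bar> \<le> \<epsilon>"
  shows "\<bar>(\<integral>x. F x \<partial>PiM I P) - (\<integral>x. F x \<partial>PiM I Q)\<bar> \<le> real (card I) * \<epsilon>"
  using I F close
proof (induction I arbitrary: F rule: finite_induct)
  case empty
  show ?case by (simp add: PiM_empty)
next
  case (insert i I)
  interpret P: product_prob_space P
    using P by (intro product_prob_spaceI) (auto simp: borel_prob_def)
  interpret Q: product_prob_space Q
    using Q by (intro product_prob_spaceI) (auto simp: borel_prob_def)
  have sPi: "sets (P j) = sets borel" "sets (Q j) = sets borel" for j
    using P Q by (auto simp: borel_prob_def)
  have sets: "sets (PiM J P) = sets (PiM J (\<lambda>_. borel))" "sets (PiM J Q) = sets (PiM J (\<lambda>_. borel))" for J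
    by (auto intro!: sets_PiM_cong simp: sPi)
  have pI: "prob_space (PiM J P)" "prob_space (PiM J Q)" for J
    by (auto intro!: prob_space_PiM P.prob_space Q.prob_space P.M.prob_space_axioms Q.M.prob_space_axioms)
  have meas: "f \<in> borel_measurable (PiM J P) \<longleftrightarrow> f \<in> borel_measurable (PiM J (\<lambda>_. borel))"
    "f \<in> borel_measurable (PiM J Q) \<longleftrightarrow> f \<in> borel_measurable (PiM J (\<lambda>_. borel))" for J and f :: "('i \<Rightarrow> 'c) \<Rightarrow> real"
    by (simp_all add: measurable_cong_sets[OF sets(1) refl] measurable_cong_sets[OF sets(2) refl])
  have int: "integrable (PiM J P) f" "integrable (PiM J Q) f"
    if "f \<in> borel_measurable (PiM J (\<lambda>_. borel))" "\<And>x. \<bar>f x\<bar> \<le> B" for f :: "('i \<Rightarrow> 'c) \<Rightarrow> real" and J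
  proof -
    interpret PJ: prob_space "PiM J P" by (rule pI)
    interpret QJ: prob_space "PiM J Q" by (rule pI)
    show "integrable (PiM J P) f" using that by (intro PJ.integrable_const_bound[of _ B]) (auto simp: meas)
    show "integrable (PiM J Q) f" using that by (intro QJ.integrable_const_bound[of _ B]) (auto simp: meas)
  qed
  define GP where "GP x = (\<integral>y. F (x(i := y)) \<partial>P i)" for x
  define GQ where "GQ x = (\<integral>y. F (x(i := y)) \<partial>Q i)" for x
  have F2: "(\<lambda>(x, y). F (x(i := y))) \<in> borel_measurable (PiM I (\<lambda>_. borel) \<Otimes>\<^sub>M R)"
    if "sets R = sets borel" for R
  proof -
    have "(\<lambda>(x, y). x(i := y)) \<in> PiM I (\<lambda>_. borel) \<Otimes>\<^sub>M R \<rightarrow>\<^sub>M PiM (insert i I) (\<lambda>_. borel)"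
      unfolding measurable_cong_sets[OF sets_pair_measure_cong[OF refl that] refl]
      by (rule measurable_add_dim)
    from measurable_compose[OF this insert.prems(1)] show ?thesis by (simp only: case_prod_beta case_prod_beta')
  qed
  have G: "GP \<in> borel_measurable (PiM I (\<lambda>_. borel))" "GQ \<in> borel_measurable (PiM I (\<lambda>_. borel))"
    unfolding GP_def[abs_def] GQ_def[abs_def]
    using P.M.borel_measurable_lebesgue_integral[OF F2[OF sPi(1)]] Q.M.borel_measurable_lebesgue_integral[OF F2[OF sPi(2)]]
    by auto
  have Fi: "\<bar>F (x(i := y))\<bar> \<le> B" "\<bar>F (x(i := a)) - F (x(i := b))\<bar> \<le> L * dist a b" for x y a b
    by (rule insert.prems(2), rule insert.prems(3), simp)
  have Lc: "continuous_on UNIV (\<lambda>y. F (x(i := y)))" for x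
  proof -
    have "\<bar>L\<bar>-lipschitz_on UNIV (\<lambda>y. F (x(i := y)))"
    proof (rule lipschitz_onI)
      fix a b :: 'c
      have "L * dist a b \<le> \<bar>L\<bar> * dist a b" by (intro mult_right_mono) auto
      then show "dist (F (x(i := a))) (F (x(i := b))) \<le> \<bar>L\<bar> * dist a b"
        using Fi(2)[of x a b] by (simp add: dist_real_def)
    qed simp
    then show ?thesis by (rule lipschitz_on_continuous_on)
  qed
  have Fint: "integrable p (\<lambda>y. F (x(i := y)))" if "borel_prob p" for p x
    by (rule borel_prob_integrable[OF that borel_measurable_continuous_onI[OF Lc], where B=B]) (simp add: Fi del: fun_upd_apply)
  have Gb: "\<bar>\<integral>y. F (x(i := y)) \<partial>p\<bar> \<le> B" if "borel_prob p" for x p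
  proof -
    interpret prob_space p using that by (simp add: borel_prob_def)
    have "\<bar>\<integral>y. F (x(i := y)) \<partial>p\<bar> \<le> (\<integral>y. \<bar>F (x(i := y))\<bar> \<partial>p)" by (rule integral_abs_bound)
    also have "\<dots> \<le> (\<integral>y. B \<partial>p)" using Fint[OF that] Fi(1) by (intro integral_mono) auto
    finally show ?thesis by (simp add: prob_space)
  qed
  have GL: "\<bar>GQ (x(j := a)) - GQ (x(j := b))\<bar> \<le> L * dist a b" if "j \<in> I" for j x a b
  proof -
    have ji: "j \<noteq> i" using that insert.hyps by auto
    have "\<bar>GQ (x(j := a)) - GQ (x(j := b))\<bar> \<le> (\<integral>y. L * dist a b \<partial>Q i)"
      unfolding GQ_def
    proof (rule Q.M.expectation_diff_le)
      show "\<bar>F (x(j := a, i := y)) - F (x(j := b, i := y))\<bar> \<le> L * dist a b" for y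
        unfolding fun_upd_twist[OF ji] using that by (intro insert.prems(3)) simp
    qed (use Fint[OF Q] in auto)
    then show ?thesis by (simp add: Q.M.prob_space)
  qed
  \<comment> \<open>The chain runs from \<open>GP\<close> under \<open>P\<close> to
    \<open>GQ\<close> under \<open>P\<close> and on to \<open>GQ\<close> under \<open>Q\<close>;
    this is its second link.\<close>
  have IH: "\<bar>(\<integral>x. GQ x \<partial>PiM I P) - (\<integral>x. GQ x \<partial>PiM I Q)\<bar> \<le> real (card I) * \<epsilon>"
  proof (rule insert.IH[OF G(2)])
    show "\<bar>GQ x\<bar> \<le> B" for x unfolding GQ_def by (rule Gb[OF Q])
    show "\<bar>(\<integral>x. f x \<partial>P j) - (\<integral>x. f x \<partial>Q j)\<bar> \<le> \<epsilon>"
      if "j \<in> I" "\<And>x. \<bar>f x\<bar> \<le> B" "\<And>x y. \<bar>f x - f y\<bar> \<le> L * dist x y" for j f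
      by (rule insert.prems(4)[OF insertI2[OF that(1)] that(2,3)])
  qed (rule GL)
  have PQ: "\<bar>GP x - GQ x\<bar> \<le> \<epsilon>" for x
    unfolding GP_def GQ_def by (rule insert.prems(4)[OF insertI1 Fi(1) Fi(2)])
  interpret PI: prob_space "PiM I P" by (rule pI)
  have GPi: "integrable (PiM I P) GP" "integrable (PiM I P) GQ"
    using G Gb[OF P] Gb[OF Q] by (auto intro!: int simp: GP_def GQ_def)
  have step: "\<bar>(\<integral>x. GP x \<partial>PiM I P) - (\<integral>x. GQ x \<partial>PiM I P)\<bar> \<le> \<epsilon>"
    using PI.expectation_diff_le[OF GPi, of "\<lambda>_. \<epsilon>"] PQ by (simp add: PI.prob_space)
  have eqP: "(\<integral>x. F x \<partial>PiM (insert i I) P) = (\<integral>x. GP x \<partial>PiM I P)"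
    unfolding GP_def by (intro P.product_integral_insert int insert.hyps insert.prems)
  have eqQ: "(\<integral>x. F x \<partial>PiM (insert i I) Q) = (\<integral>x. GQ x \<partial>PiM I Q)"
    unfolding GQ_def by (intro Q.product_integral_insert int insert.hyps insert.prems)
  have "real (card (insert i I)) * \<epsilon> = \<epsilon> + real (card I) * \<epsilon>"
    using insert.hyps by (simp add: distrib_right)
  then show ?case unfolding eqP eqQ using IH step by linarith
qed

lemma (in prob_space) expectation_indep_vars:
  fixes F :: "('i \<Rightarrow> 'c) \<Rightarrow> real"
  assumes "indep_vars K Z I" "I \<noteq> {}" "\<And>i. Z i \<in> M \<rightarrow>\<^sub>M K i" "F \<in> borel_measurable (PiM I K)"
  shows "expectation (\<lambda>\<omega>. F (\<lambda>i\<in>I. Z i \<omega>)) = (\<integral>x. F x \<partial>PiM I (\<lambda>i. distr M (K i) (Z i)))"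
proof -
  have "expectation (\<lambda>\<omega>. F (\<lambda>i\<in>I. Z i \<omega>)) = (\<integral>x. F x \<partial>distr M (PiM I K) (\<lambda>\<omega>. \<lambda>i\<in>I. Z i \<omega>))"
    using assms by (intro integral_distr[symmetric] measurable_restrict) auto
  then show ?thesis
    using assms(1) indep_vars_iff_distr_eq_PiM[OF assms(2,3)] by simp
qed

text \<open>The hull is written as a function of increments because these are the independent
  coordinates: its expectations become integrals against a product measure.\<close>

definition partial_sum_hull :: "nat \<Rightarrow> (nat \<Rightarrow> 'c::euclidean_space) \<Rightarrow> 'c set" where
  "partial_sum_hull m x = convex hull (insert 0 ((\<lambda>j. \<Sum>i<j. x i) ` {..m}))"

lemma partial_sum_hull_in_convex_bodies0: "partial_sum_hull m x \<in> convex_bodies0"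
  unfolding partial_sum_hull_def by (rule convex_hull_finite_in_convex_bodies0) simp

lemma partial_sum_hull_cong:
  "(\<And>i. i < m \<Longrightarrow> x i = y i) \<Longrightarrow> partial_sum_hull m x = partial_sum_hull m y"
  unfolding partial_sum_hull_def
  by (intro arg_cong[where f="\<lambda>S. convex hull (insert 0 S)"] image_cong sum.cong) auto

lemma partial_sum_hull_measurable:
  "partial_sum_hull m \<in> PiM {..<m} (\<lambda>_. borel :: 'c::euclidean_space measure)
    \<rightarrow>\<^sub>M borel_sigma (mtopology_of convex_body_metric)"
  unfolding partial_sum_hull_def[abs_def]
  by (intro measurable_convex_hull borel_measurable_sum measurable_component_singleton) auto

text \<open>Changing one increment translates all later partial sums by the same vector and leaves
  the earlier ones alone.\<close>

lemma partial_sum_hull_fun_upd: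
  "hausdorff_dist (partial_sum_hull m (x(i := a))) (partial_sum_hull m (x(i := b))) \<le> dist a b"
  unfolding partial_sum_hull_def
proof (rule hausdorff_dist_convex_hull_image_le)
  fix j
  have "(\<Sum>k<j. (x(i := a)) k) - (\<Sum>k<j. (x(i := b)) k) = (\<Sum>k<j. if k = i then a - b else 0)"
    unfolding sum_subtractf[symmetric] by (rule sum.cong) auto
  also have "\<dots> = (if i < j then a - b else 0)" by (simp add: sum.delta)
  finally show "dist (\<Sum>k<j. (x(i := a)) k) (\<Sum>k<j. (x(i := b)) k) \<le> dist a b"
    by (simp add: dist_norm)
qed simp_all

lemma convex_body_Lipschitz_measurable:
  fixes f :: "'c::euclidean_space set \<Rightarrow> real"
  assumes "\<And>K K'. K \<in> convex_bodies0 \<Longrightarrow> K' \<in> convex_bodies0 \<Longrightarrow> \<bar>f K - f K'\<bar> \<le> L * hausdorff_dist K K'"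
  shows "f \<in> borel_measurable (borel_sigma (mtopology_of convex_body_metric))"
proof -
  interpret K: Metric_space "convex_bodies0 :: 'c set set" hausdorff_dist
    by (rule Metric_space_convex_bodies0)
  have "mtopology_of (convex_body_metric :: 'c set metric) = K.mtopology"
    by (simp add: mtopology_of_def)
  then show ?thesis
    using K.continuous_map_Lipschitz[OF assms] by (simp add: continuous_map_borel_sigma_measurable)
qed

context levy_array
begin

abbreviation walk_hull where
  "walk_hull n \<omega> \<equiv> convex hull (insert 0 ((\<lambda>k. V n k \<omega>) ` {..n}))"

abbreviation grid_hull where
  "grid_hull m n \<omega> \<equiv> convex hull (insert 0 ((\<lambda>j. V n (grid m n j) \<omega>) ` {..m}))"

abbreviation path_hull where
  "path_hull \<omega> \<equiv> convex hull (closure ((\<lambda>t. X t \<omega>) ` {0..1}))"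

abbreviation path_grid_hull where
  "path_grid_hull m \<omega> \<equiv> convex hull (insert 0 ((\<lambda>j. X (real j / real m) \<omega>) ` {..m}))"

lemma V_grid:
  "V n (grid m n j) \<omega> = (\<Sum>i<j. V n (grid m n (Suc i)) \<omega> - V n (grid m n i) \<omega>)"
  by (subst sum_lessThan_telescope) simp

text \<open>Grid increments are sums over disjoint blocks of steps.\<close>

lemma increments_indep:
  "M.indep_vars (\<lambda>_. borel) (\<lambda>i \<omega>. V n (grid m n (Suc i)) \<omega> - V n (grid m n i) \<omega>) J"
proof -
  let ?K = "\<lambda>i. {grid m n i<..grid m n (Suc i)}"
  have "disjoint_family_on ?K J"
    unfolding disjoint_family_on_def
  proof (intro ballI impI)
    fix i j :: nat assume "i \<noteq> j"
    then have "Suc i \<le> j \<or> Suc j \<le> i" by auto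
    then have "grid m n (Suc i) \<le> grid m n j \<or> grid m n (Suc j) \<le> grid m n i"
      using grid_mono by blast
    then show "?K i \<inter> ?K j = {}" by auto
  qed
  then have "M.indep_vars (\<lambda>i. PiM (?K i) (\<lambda>_. borel)) (\<lambda>i \<omega>. restrict (\<lambda>l. Y n l \<omega>) (?K i)) J"
    by (intro M.indep_vars_restrict[OF iid_steps_indep[OF steps]]) auto
  then have "M.indep_vars (\<lambda>_. borel) (\<lambda>i \<omega>. (\<lambda>x. \<Sum>l\<in>?K i. x l) (restrict (\<lambda>l. Y n l \<omega>) (?K i))) J"
    by (rule M.indep_vars_compose2) (intro borel_measurable_sum measurable_component_singleton)
  moreover have "(\<Sum>l\<in>?K i. restrict (\<lambda>l. Y n l \<omega>) (?K i) l) = V n (grid m n (Suc i)) \<omega> - V n (grid m n i) \<omega>" for i \<omega>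
    unfolding random_walk_diff[OF grid_mono[OF le_SucI[OF order_refl]]] by (intro sum.cong) auto
  ultimately show ?thesis by simp
qed

text \<open>Walk and limit path enter through the same function \<open>F\<close> of \<open>m\<close>
  independent increments, so two product measures are to be compared. Replacing the factors one by
  one leaves \<open>m\<close> errors, each small uniformly over bounded Lipschitz functions of one
  increment.\<close>

lemma grid_expectation_tendsto:
  fixes f :: "'c set \<Rightarrow> real"
  assumes m: "0 < m"
    and lip: "\<And>K K'. K \<in> convex_bodies0 \<Longrightarrow> K' \<in> convex_bodies0 \<Longrightarrow> \<bar>f K - f K'\<bar> \<le> L * hausdorff_dist K K'"
    and bd: "\<And>K. K \<in> convex_bodies0 \<Longrightarrow> \<bar>f K\<bar> \<le> B"
  shows "(\<lambda>n. \<integral>\<omega>. f (grid_hull m n \<omega>) \<partial>M)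
    \<longlonglongrightarrow> (\<integral>\<omega>. f (path_grid_hull m \<omega>) \<partial>N)"
proof -
  let ?I = "{..<m}"
  define F where "F x = f (partial_sum_hull m x)" for x
  define \<Delta> where "\<Delta> n i \<omega> = V n (grid m n (Suc i)) \<omega> - V n (grid m n i) \<omega>" for n i \<omega>
  define \<Xi> where "\<Xi> i \<omega> = X (real (Suc i) / real m) \<omega> - X (real i / real m) \<omega>" for i \<omega>
  have Fm: "F \<in> borel_measurable (PiM ?I (\<lambda>_. borel))"
    unfolding F_def[abs_def]
    by (rule measurable_compose[OF partial_sum_hull_measurable convex_body_Lipschitz_measurable[OF lip]])
  have Fb: "\<bar>F x\<bar> \<le> B" for x unfolding F_def by (rule bd[OF partial_sum_hull_in_convex_bodies0])
  \<comment> \<open>\<open>L\<close> may be negative, and then only the bound with its absolute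
    value is monotone in the distance.\<close>
  have L: "L * r \<le> \<bar>L\<bar> * s" if "0 \<le> r" "r \<le> s" for r s
    using that by (meson abs_ge_self abs_ge_zero mult_mono order_trans)
  have FL: "\<bar>F (x(i := a)) - F (x(i := b))\<bar> \<le> \<bar>L\<bar> * dist a b" for x i a b
    unfolding F_def
    by (rule order.trans[OF lip[OF partial_sum_hull_in_convex_bodies0 partial_sum_hull_in_convex_bodies0]])
      (rule L[OF hausdorff_dist_nonneg partial_sum_hull_fun_upd])
  have \<Delta>m: "\<Delta> n i \<in> borel_measurable M" for n i unfolding \<Delta>_def[abs_def] by measurable
  have \<Xi>m: "\<Xi> i \<in> borel_measurable N" for i
    unfolding \<Xi>_def[abs_def] by (intro borel_measurable_diff X_measurable) auto
  have ne: "?I \<noteq> {}" using m by auto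
  have EM: "(\<integral>\<omega>. f (grid_hull m n \<omega>) \<partial>M) =
      (\<integral>x. F x \<partial>PiM ?I (\<lambda>i. distr M borel (\<Delta> n i)))" for n
  proof -
    have "f (grid_hull m n \<omega>) = F (\<lambda>i\<in>?I. \<Delta> n i \<omega>)" for \<omega>
    proof -
      have "F (\<lambda>i\<in>?I. \<Delta> n i \<omega>) = f (partial_sum_hull m (\<lambda>i. \<Delta> n i \<omega>))"
        unfolding F_def by (intro arg_cong[where f=f] partial_sum_hull_cong) simp
      also have "partial_sum_hull m (\<lambda>i. \<Delta> n i \<omega>) = grid_hull m n \<omega>"
        unfolding partial_sum_hull_def \<Delta>_def V_grid[symmetric] ..
      finally show ?thesis ..
    qed
    moreover have "(\<integral>\<omega>. F (\<lambda>i\<in>?I. \<Delta> n i \<omega>) \<partial>M) = (\<integral>x. F x \<partial>PiM ?I (\<lambda>i. distr M borel (\<Delta> n i)))"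
      by (rule M.expectation_indep_vars[OF _ ne \<Delta>m Fm])
        (use increments_indep[of n m ?I] in \<open>simp add: \<Delta>_def[abs_def]\<close>)
    ultimately show ?thesis by (simp only:)
  qed
  have EN: "(\<integral>\<omega>. f (path_grid_hull m \<omega>) \<partial>N) =
      (\<integral>x. F x \<partial>PiM ?I (\<lambda>i. distr N borel (\<Xi> i)))"
  proof -
    have "(\<integral>\<omega>. f (path_grid_hull m \<omega>) \<partial>N) = (\<integral>\<omega>. F (\<lambda>i\<in>?I. \<Xi> i \<omega>) \<partial>N)"
    proof (rule Bochner_Integration.integral_cong[OF refl])
      fix \<omega> assume \<omega>: "\<omega> \<in> space N"
      have "F (\<lambda>i\<in>?I. \<Xi> i \<omega>) = f (partial_sum_hull m (\<lambda>i. \<Xi> i \<omega>))"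
        unfolding F_def by (intro arg_cong[where f=f] partial_sum_hull_cong) simp
      also have "partial_sum_hull m (\<lambda>i. \<Xi> i \<omega>) = path_grid_hull m \<omega>"
        unfolding partial_sum_hull_def \<Xi>_def levy_process_sum_increments[OF levy \<omega>] ..
      finally show "f (path_grid_hull m \<omega>) = F (\<lambda>i\<in>?I. \<Xi> i \<omega>)" ..
    qed
    moreover have "(\<integral>\<omega>. F (\<lambda>i\<in>?I. \<Xi> i \<omega>) \<partial>N) = (\<integral>x. F x \<partial>PiM ?I (\<lambda>i. distr N borel (\<Xi> i)))"
      by (rule N.expectation_indep_vars[OF _ ne \<Xi>m Fm])
        (use levy_process_indep_grid[OF levy, of m] in \<open>simp add: \<Xi>_def[abs_def]\<close>)
    ultimately show ?thesis by (simp only:)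
  qed
  show ?thesis unfolding EM EN
  proof (rule tendstoI)
    fix e :: real assume e: "e > 0"
    \<comment> \<open>The \<open>m\<close> replacements together cost \<open>e / 2\<close>.\<close>
    define \<epsilon> where "\<epsilon> = e / (2 * real m)"
    have \<epsilon>: "\<epsilon> > 0" using e m by (simp add: \<epsilon>_def)
    have bp: "borel_prob (distr M borel (\<Delta> n i))" "borel_prob (distr N borel (\<Xi> i))" for n i
      using \<Delta>m \<Xi>m by (auto intro: borel_prob_distr M.prob_space_axioms N.prob_space_axioms)
    have "\<forall>\<^sub>F n in sequentially. \<forall>f. (\<forall>x. \<bar>f x\<bar> \<le> B) \<and> (\<forall>x y. \<bar>f x - f y\<bar> \<le> \<bar>L\<bar> * dist x y) \<longrightarrow>
        \<bar>(\<integral>x. f x \<partial>distr M borel (\<Delta> n i)) - (\<integral>x. f x \<partial>distr N borel (\<Xi> i))\<bar> \<le> \<epsilon>" for i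
    proof (rule weakly_converges_uniform[OF bp(1) bp(2) _ \<epsilon>])
      have "weakly_converges (\<lambda>n. distr M borel (\<Delta> n i)) (distr N borel (X (1 / real m)))"
        unfolding \<Delta>_def[abs_def]
        by (rule increment_weakly_converges_levy[OF filterlim_ident grid_mono grid_increment_tendsto[OF m] m]) simp
      then show "weakly_converges (\<lambda>n. distr M borel (\<Delta> n i)) (distr N borel (\<Xi> i))"
        unfolding \<Xi>_def[abs_def] levy_process_increment[OF levy m] .
    qed
    then have "\<forall>\<^sub>F n in sequentially. \<forall>i\<in>?I. \<forall>f. (\<forall>x. \<bar>f x\<bar> \<le> B) \<and> (\<forall>x y. \<bar>f x - f y\<bar> \<le> \<bar>L\<bar> * dist x y) \<longrightarrow>
        \<bar>(\<integral>x. f x \<partial>distr M borel (\<Delta> n i)) - (\<integral>x. f x \<partial>distr N borel (\<Xi> i))\<bar> \<le> \<epsilon>"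
      by (intro eventually_ball_finite) auto
    then show "\<forall>\<^sub>F n in sequentially. dist (\<integral>x. F x \<partial>PiM ?I (\<lambda>i. distr M borel (\<Delta> n i)))
        (\<integral>x. F x \<partial>PiM ?I (\<lambda>i. distr N borel (\<Xi> i))) < e"
    proof eventually_elim
      case (elim n)
      have "\<bar>(\<integral>x. F x \<partial>PiM ?I (\<lambda>i. distr M borel (\<Delta> n i))) - (\<integral>x. F x \<partial>PiM ?I (\<lambda>i. distr N borel (\<Xi> i)))\<bar>
          \<le> real (card ?I) * \<epsilon>"
        by (rule product_measure_replacement[OF _ bp(1) bp(2) Fm Fb FL]) (use elim in auto)
      also have "\<dots> < e" using e m by (simp add: \<epsilon>_def)
      finally show ?case by (simp add: dist_real_def)
    qed
  qed
qed

end

section \<open>Convergence of the hulls\<close>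

lemma hausdorff_dist_0_Lipschitz:
  fixes K K' :: "'c::euclidean_space set"
  assumes "K \<in> convex_bodies0" "K' \<in> convex_bodies0"
  shows "\<bar>hausdorff_dist {0} K - hausdorff_dist {0} K'\<bar> \<le> hausdorff_dist K K'"
proof -
  interpret K: Metric_space "convex_bodies0 :: 'c set set" hausdorff_dist
    by (rule Metric_space_convex_bodies0)
  have 0: "{0} \<in> (convex_bodies0 :: 'c set set)" by (simp add: convex_bodies0_def)
  show ?thesis
    using K.triangle[OF 0 assms] K.triangle[OF 0 assms(2,1)] K.commute[of K K'] by linarith
qed

context levy_array
begin

lemma hulls_in_bodies0:
  "walk_hull n \<omega> \<in> convex_bodies0" "grid_hull m n \<omega> \<in> convex_bodies0"
  "path_grid_hull m \<omega>' \<in> convex_bodies0" "\<omega>' \<in> space N \<Longrightarrow> path_hull \<omega>' \<in> convex_bodies0"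
  by (auto intro!: convex_hull_finite_in_convex_bodies0 convex_hull_closure_path_in_convex_bodies0
      levy_process_cadlag[OF levy] levy_process_0[OF levy])

lemma hulls_measurable:
  "walk_hull n \<in> M \<rightarrow>\<^sub>M borel_sigma (mtopology_of convex_body_metric)"
  "grid_hull m n \<in> M \<rightarrow>\<^sub>M borel_sigma (mtopology_of convex_body_metric)"
  "path_grid_hull m \<in> N \<rightarrow>\<^sub>M borel_sigma (mtopology_of convex_body_metric)"
  by (intro measurable_convex_hull V_measurable X_measurable; simp)+

lemma path_grid_hull_tendsto:
  "\<omega> \<in> space N \<Longrightarrow> (\<lambda>m. hausdorff_dist (path_grid_hull m \<omega>) (path_hull \<omega>)) \<longlonglongrightarrow> 0"
  by (intro cadlag_grid_hull_limit levy_process_cadlag[OF levy] levy_process_0[OF levy])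

lemma path_hull_measurable: "path_hull \<in> N \<rightarrow>\<^sub>M borel_sigma (mtopology_of convex_body_metric)"
proof -
  interpret K: Metric_space "convex_bodies0 :: 'c set set" hausdorff_dist
    by (rule Metric_space_convex_bodies0)
  have top: "mtopology_of (convex_body_metric :: 'c set metric) = K.mtopology"
    by (simp add: mtopology_of_def)
  show ?thesis
    unfolding top
    by (rule K.measurable_borel_sigma_limit[OF hulls_measurable(3)[unfolded top] hulls_in_bodies0(4) path_grid_hull_tendsto])
qed

lemma hull_functional_integrable:
  assumes lip: "\<And>K K'. K \<in> convex_bodies0 \<Longrightarrow> K' \<in> convex_bodies0 \<Longrightarrow> \<bar>f K - f K'\<bar> \<le> L * hausdorff_dist K K'"
    and bd: "\<And>K. K \<in> convex_bodies0 \<Longrightarrow> \<bar>f K\<bar> \<le> B"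
  shows "integrable M (\<lambda>\<omega>. f (walk_hull n \<omega>))" "integrable M (\<lambda>\<omega>. f (grid_hull m n \<omega>))"
    "integrable N (\<lambda>\<omega>. f (path_grid_hull m \<omega>))" "integrable N (\<lambda>\<omega>. f (path_hull \<omega>))"
proof -
  note fm = convex_body_Lipschitz_measurable[OF lip]
  show "integrable M (\<lambda>\<omega>. f (walk_hull n \<omega>))" "integrable M (\<lambda>\<omega>. f (grid_hull m n \<omega>))"
    by (rule M.integrable_const_bound[of _ B]; simp add: bd hulls_in_bodies0 measurable_compose[OF hulls_measurable(1) fm] measurable_compose[OF hulls_measurable(2) fm])+
  show "integrable N (\<lambda>\<omega>. f (path_grid_hull m \<omega>))" "integrable N (\<lambda>\<omega>. f (path_hull \<omega>))"
    by (rule N.integrable_const_bound[of _ B]; simp add: bd hulls_in_bodies0 measurable_compose[OF hulls_measurable(3) fm] measurable_compose[OF path_hull_measurable fm])+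
qed

lemma path_hull_norm_tail:
  assumes "0 < \<eta>"
  obtains R :: nat where "(\<integral>\<omega>. min 1 (max 0 (hausdorff_dist {0} (path_hull \<omega>) - real R)) \<partial>N) < \<eta>"
proof -
  have lip: "\<bar>hausdorff_dist {0} K - hausdorff_dist {0} K'\<bar> \<le> 1 * hausdorff_dist K K'"
    if "K \<in> convex_bodies0" "K' \<in> convex_bodies0" for K K' :: "'c set"
    using hausdorff_dist_0_Lipschitz[OF that] by simp
  have "(\<lambda>\<omega>. hausdorff_dist {0} (path_hull \<omega>)) \<in> borel_measurable N"
    by (rule measurable_compose[OF path_hull_measurable convex_body_Lipschitz_measurable[OF lip]])
  then show thesis using assms by (rule N.truncated_tail) (rule that)
qed

text \<open>Through this inclusion a tail bound for the whole path serves all grids at once,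
  independently of \<open>m\<close>.\<close>

lemma path_grid_hull_subset:
  assumes "\<omega> \<in> space N"
  shows "path_grid_hull m \<omega> \<subseteq> path_hull \<omega>"
proof (rule hull_mono)
  have "X (real j / real m) \<omega> \<in> (\<lambda>t. X t \<omega>) ` {0..1}" if "j \<le> m" for j
    using that by (intro imageI) (auto simp: divide_le_eq)
  moreover have "0 \<in> (\<lambda>t. X t \<omega>) ` {0..1}"
    using levy_process_0[OF levy assms] by (intro image_eqI[of _ _ 0]) auto
  ultimately have "insert 0 ((\<lambda>j. X (real j / real m) \<omega>) ` {..m}) \<subseteq> (\<lambda>t. X t \<omega>) ` {0..1}" by auto
  then show "insert 0 ((\<lambda>j. X (real j / real m) \<omega>) ` {..m}) \<subseteq> closure ((\<lambda>t. X t \<omega>) ` {0..1})"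
    using closure_subset by (rule order.trans)
qed

text \<open>The cover and \<delta> depend on the radius, and \<open>m0\<close> on \<delta>, so the
  radius must be found before \<open>m\<close>. It comes from the tail of the limit path and is
  transferred to the grid values of the walk, for each fixed \<open>m\<close>, by convergence of
  expectations.\<close>

lemma walk_hull_close_to_grid_hull:
  assumes e: "0 < e" "e \<le> 1" and \<eta>: "0 < \<eta>"
  obtains m0 :: nat where "0 < m0" "\<forall>m\<ge>m0. \<forall>\<^sub>F n in sequentially. \<exists>A\<in>sets M. M.prob A \<le> \<eta> \<and>
    (\<forall>\<omega>\<in>space M - A. hausdorff_dist (walk_hull n \<omega>) (grid_hull m n \<omega>) \<le> 3 * e)"
proof -
  have \<eta>2: "\<eta> / 2 > 0" using \<eta> by simp
  obtain R :: nat where R: "(\<integral>\<omega>. min 1 (max 0 (hausdorff_dist {0} (path_hull \<omega>) - real R)) \<partial>N) < \<eta> / 2"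
    using path_hull_norm_tail[OF \<eta>2] .
  \<comment> \<open>A Lipschitz substitute for an indicator: 0 while the body stays within radius
    \<open>R\<close>, and 1 once it reaches radius \<open>R + 1\<close>.\<close>
  define \<theta> where "\<theta> K = min 1 (max 0 (hausdorff_dist {0} K - real R))" for K :: "'c set"
  have \<theta>lip: "\<bar>\<theta> K - \<theta> K'\<bar> \<le> 1 * hausdorff_dist K K'"
    if "K \<in> convex_bodies0" "K' \<in> convex_bodies0" for K K'
    using hausdorff_dist_0_Lipschitz[OF that] unfolding \<theta>_def by linarith
  have \<theta>b: "\<bar>\<theta> K\<bar> \<le> 1" "0 \<le> \<theta> K" for K unfolding \<theta>_def by auto
  note \<theta>int = hull_functional_integrable[of \<theta> 1 1, OF \<theta>lip \<theta>b(1)]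
  obtain C :: "'c set" where C: "finite C" "cball 0 (real R + 2) \<subseteq> (\<Union>c\<in>C. ball c e)"
  proof (rule compactE_image[OF compact_cball, of "UNIV :: 'c set" "\<lambda>c. ball c e" 0 "real R + 2"])
    show "cball 0 (real R + 2) \<subseteq> (\<Union>c\<in>UNIV. ball c e)"
      using e(1) by (auto intro: centre_in_ball[THEN iffD2])
  qed auto
  \<comment> \<open>Half of \<eta> pays for the \<open>card C + 1\<close> entrance events, the other
    half for grid values outside the ball.\<close>
  define \<delta> where "\<delta> = \<eta> / (2 * (real (card C) + 1))"
  have \<delta>: "\<delta> > 0" using \<eta> by (simp add: \<delta>_def)
  obtain m0 :: nat where m0: "0 < m0" "\<forall>\<^sub>F n in sequentially. \<forall>a b. a \<le> b \<and> (b - a) * m0 \<le> n \<longrightarrow>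
    M.prob {\<omega> \<in> space M. e < norm (V n b \<omega> - V n a \<omega>)} \<le> \<delta>"
    using increment_small[OF e(1) \<delta>] .
  show thesis
  proof (rule that[OF m0(1)], intro allI impI)
    fix m assume m: "m0 \<le> m"
    then have mpos: "0 < m" using m0(1) by simp
    have "(\<integral>\<omega>. \<theta> (path_grid_hull m \<omega>) \<partial>N) \<le> (\<integral>\<omega>. \<theta> (path_hull \<omega>) \<partial>N)"
    proof (rule integral_mono[OF \<theta>int(3,4)])
      fix \<omega> assume \<omega>: "\<omega> \<in> space N"
      have "hausdorff_dist {0} (path_grid_hull m \<omega>) \<le> hausdorff_dist {0} (path_hull \<omega>)"
        using path_grid_hull_subset[OF \<omega>, of m] hulls_in_bodies0
        by (intro hausdorff_dist_0_le norm_le_hausdorff_dist_0[OF hulls_in_bodies0(4)[OF \<omega>]]) auto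
      then show "\<theta> (path_grid_hull m \<omega>) \<le> \<theta> (path_hull \<omega>)" unfolding \<theta>_def by linarith
    qed
    also have "\<dots> < \<eta> / 2" using R by (simp add: \<theta>_def)
    finally have "(\<integral>\<omega>. \<theta> (path_grid_hull m \<omega>) \<partial>N) < \<eta> / 2" .
    moreover have "(\<lambda>n. \<integral>\<omega>. \<theta> (grid_hull m n \<omega>) \<partial>M) \<longlonglongrightarrow> (\<integral>\<omega>. \<theta> (path_grid_hull m \<omega>) \<partial>N)"
      using mpos \<theta>lip \<theta>b(1) by (rule grid_expectation_tendsto)
    ultimately have "\<forall>\<^sub>F n in sequentially. (\<integral>\<omega>. \<theta> (grid_hull m n \<omega>) \<partial>M) < \<eta> / 2"
      by (rule order_tendstoD(2)[rotated])
    with m0(2) show "\<forall>\<^sub>F n in sequentially. \<exists>A\<in>sets M. M.prob A \<le> \<eta> \<and>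
      (\<forall>\<omega>\<in>space M - A. hausdorff_dist (walk_hull n \<omega>) (grid_hull m n \<omega>) \<le> 3 * e)"
    proof eventually_elim
      case (elim n)
      let ?G = "{\<omega> \<in> space M. \<exists>j\<le>m. real R + 1 < norm (V n (grid m n j) \<omega>)}"
      have G: "?G \<in> sets M" by measurable
      have "M.prob ?G \<le> (\<integral>\<omega>. \<theta> (grid_hull m n \<omega>) \<partial>M)"
      proof (rule M.prob_le_expectation[OF G \<theta>int(2) \<theta>b(2)])
        fix \<omega> assume "\<omega> \<in> ?G"
        then obtain j where j: "j \<le> m" "real R + 1 < norm (V n (grid m n j) \<omega>)" by blast
        have "norm (V n (grid m n j) \<omega>) \<le> hausdorff_dist {0} (grid_hull m n \<omega>)"
          using j(1) by (intro norm_le_hausdorff_dist_0 hulls_in_bodies0 hull_inc) auto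
        then show "1 \<le> \<theta> (grid_hull m n \<omega>)" using j(2) unfolding \<theta>_def by linarith
      qed
      then have PG: "M.prob ?G \<le> \<eta> / 2" using elim(2) by simp
      have \<delta>m: "M.prob {\<omega> \<in> space M. e < norm (V n b \<omega> - V n a \<omega>)} \<le> \<delta>"
        if "a \<le> b" "(b - a) * m \<le> n" for a b
      proof -
        \<comment> \<open>A finer grid only shortens the increments that have to be small.\<close>
        have "(b - a) * m0 \<le> (b - a) * m" using m by simp
        then show ?thesis using elim(1) that by (meson order_trans)
      qed
      show ?case
      proof (rule walk_close_to_grid[OF steps e(2) mpos C \<delta>m])
        fix A assume A: "A \<in> sets M" "M.prob A \<le> (real (card C) + 1) * \<delta> + M.prob ?G"
          "\<And>\<omega> k. \<omega> \<in> space M - A \<Longrightarrow> k \<le> n \<Longrightarrow> \<exists>j\<le>m. dist (V n k \<omega>) (V n (grid m n j) \<omega>) \<le> 3 * e"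
        show ?thesis
        proof (intro bexI[OF _ A(1)] conjI ballI)
          have "(real (card C) + 1) * \<delta> = \<eta> / 2" by (simp add: \<delta>_def field_simps)
          then show "M.prob A \<le> \<eta>" using A(2) PG by linarith
          fix \<omega> assume \<omega>: "\<omega> \<in> space M - A"
          show "hausdorff_dist (walk_hull n \<omega>) (grid_hull m n \<omega>) \<le> 3 * e"
          proof (rule hausdorff_dist_convex_hull_le)
            fix a assume "a \<in> insert 0 ((\<lambda>k. V n k \<omega>) ` {..n})"
            then obtain k where k: "k \<le> n" "a = V n k \<omega>" by (auto intro: that[of 0])
            then show "\<exists>b\<in>insert 0 ((\<lambda>j. V n (grid m n j) \<omega>) ` {..m}). dist a b \<le> 3 * e"
              using A(3)[OF \<omega> k(1)] by auto
          next
            fix b assume "b \<in> insert 0 ((\<lambda>j. V n (grid m n j) \<omega>) ` {..m})"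
            then obtain j where j: "j \<le> m" "b = V n (grid m n j) \<omega>" by (auto intro: that[of 0])
            have "grid m n j \<le> n" using grid_mono[OF j(1), of m n] grid_end[OF mpos, of n] by simp
            then show "\<exists>a\<in>insert 0 ((\<lambda>k. V n k \<omega>) ` {..n}). dist a b \<le> 3 * e"
              using j(2) e by (intro bexI[of _ b]) auto
          qed (auto intro: finite_imp_bounded)
        qed
      qed
    qed
  qed
qed

text \<open>The walk is compared with its grid, the grid with the grid of the limit path, and that
  with the path. The number \<open>m\<close> is fixed first, large enough for the outer two
  comparisons, and only then does \<open>n\<close> grow.\<close>

lemma walk_hull_expectation_tendsto:
  fixes f :: "'c set \<Rightarrow> real"
  assumes lip: "\<And>K K'. K \<in> convex_bodies0 \<Longrightarrow> K' \<in> convex_bodies0 \<Longrightarrow> \<bar>f K - f K'\<bar> \<le> L * hausdorff_dist K K'"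
    and bd: "\<And>K. K \<in> convex_bodies0 \<Longrightarrow> \<bar>f K\<bar> \<le> B"
  shows "(\<lambda>n. \<integral>\<omega>. f (walk_hull n \<omega>) \<partial>M) \<longlonglongrightarrow> (\<integral>\<omega>. f (path_hull \<omega>) \<partial>N)"
proof (rule tendstoI)
  fix \<epsilon> :: real assume \<epsilon>: "\<epsilon> > 0"
  define L' where "L' = \<bar>L\<bar> + 1"
  define B' where "B' = \<bar>B\<bar> + 1"
  have L': "L' > 0" and B': "B' > 0" by (auto simp: L'_def B'_def)
  \<comment> \<open>The first comparison then costs \<open>3 * \<epsilon> / 16\<close> off the
    exceptional set and \<open>2 * \<epsilon> / 16\<close> on it; the other two cost
    \<open>\<epsilon> / 4\<close> each.\<close>
  define e where "e = min 1 (\<epsilon> / (16 * L'))"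
  define \<eta> where "\<eta> = \<epsilon> / (16 * B')"
  have e: "0 < e" "e \<le> 1" "e \<le> \<epsilon> / (16 * L')" and \<eta>: "\<eta> > 0" using \<epsilon> L' B' by (auto simp: e_def \<eta>_def)
  note int = hull_functional_integrable[of f L B, OF lip bd]
  obtain m0 :: nat where m0: "0 < m0" "\<forall>m\<ge>m0. \<forall>\<^sub>F n in sequentially. \<exists>A\<in>sets M. M.prob A \<le> \<eta> \<and>
    (\<forall>\<omega>\<in>space M - A. hausdorff_dist (walk_hull n \<omega>) (grid_hull m n \<omega>) \<le> 3 * e)"
    using walk_hull_close_to_grid_hull[OF e(1,2) \<eta>] .
  have "(\<lambda>m. \<integral>\<omega>. f (path_grid_hull m \<omega>) \<partial>N) \<longlonglongrightarrow> (\<integral>\<omega>. f (path_hull \<omega>) \<partial>N)"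
  proof (rule integral_dominated_convergence[where w="\<lambda>_. B"])
    show "AE \<omega> in N. (\<lambda>m. f (path_grid_hull m \<omega>)) \<longlonglongrightarrow> f (path_hull \<omega>)"
    proof (rule AE_I2)
      fix \<omega> assume \<omega>: "\<omega> \<in> space N"
      have "(\<lambda>m. L * hausdorff_dist (path_grid_hull m \<omega>) (path_hull \<omega>)) \<longlonglongrightarrow> L * 0"
        by (intro tendsto_intros path_grid_hull_tendsto[OF \<omega>])
      then have lim0: "(\<lambda>m. L * hausdorff_dist (path_grid_hull m \<omega>) (path_hull \<omega>)) \<longlonglongrightarrow> 0" by simp
      have "(\<lambda>m. f (path_grid_hull m \<omega>) - f (path_hull \<omega>)) \<longlonglongrightarrow> 0"
        by (rule Lim_null_comparison[OF always_eventually lim0])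
          (use lip[OF hulls_in_bodies0(3) hulls_in_bodies0(4)[OF \<omega>]] in simp)
      then show "(\<lambda>m. f (path_grid_hull m \<omega>)) \<longlonglongrightarrow> f (path_hull \<omega>)" by (simp add: LIM_zero_iff)
    qed
  qed (use int in \<open>auto simp: bd hulls_in_bodies0 intro: borel_measurable_integrable\<close>)
  then have "\<forall>\<^sub>F m in sequentially. dist (\<integral>\<omega>. f (path_grid_hull m \<omega>) \<partial>N) (\<integral>\<omega>. f (path_hull \<omega>) \<partial>N) < \<epsilon> / 4"
    by (rule tendstoD) (use \<epsilon> in simp)
  then have "\<forall>\<^sub>F m in sequentially. m0 \<le> m \<and> dist (\<integral>\<omega>. f (path_grid_hull m \<omega>) \<partial>N) (\<integral>\<omega>. f (path_hull \<omega>) \<partial>N) < \<epsilon> / 4"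
    using eventually_ge_at_top[of m0] by eventually_elim (rule conjI)
  then obtain m where m: "m0 \<le> m" "dist (\<integral>\<omega>. f (path_grid_hull m \<omega>) \<partial>N) (\<integral>\<omega>. f (path_hull \<omega>) \<partial>N) < \<epsilon> / 4"
    by (auto dest!: eventually_happens)
  have mpos: "0 < m" using m m0(1) by simp
  have "\<forall>\<^sub>F n in sequentially. dist (\<integral>\<omega>. f (grid_hull m n \<omega>) \<partial>M) (\<integral>\<omega>. f (path_grid_hull m \<omega>) \<partial>N) < \<epsilon> / 4"
  proof (rule tendstoD)
    show "(\<lambda>n. \<integral>\<omega>. f (grid_hull m n \<omega>) \<partial>M) \<longlonglongrightarrow> (\<integral>\<omega>. f (path_grid_hull m \<omega>) \<partial>N)"
      using mpos lip bd by (rule grid_expectation_tendsto)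
  qed (use \<epsilon> in simp)
  with m0(2)[rule_format, OF m(1)]
  show "\<forall>\<^sub>F n in sequentially. dist (\<integral>\<omega>. f (walk_hull n \<omega>) \<partial>M) (\<integral>\<omega>. f (path_hull \<omega>) \<partial>N) < \<epsilon>"
  proof eventually_elim
    case (elim n)
    from elim(1) obtain A where A: "A \<in> sets M" "M.prob A \<le> \<eta>"
      "\<forall>\<omega>\<in>space M - A. hausdorff_dist (walk_hull n \<omega>) (grid_hull m n \<omega>) \<le> 3 * e" by blast
    have ia: "integrable M (indicat_real A)" using A(1) by (simp add: integrable_indicator_iff M.emeasure_eq_measure)
    have pw: "\<bar>f (walk_hull n \<omega>) - f (grid_hull m n \<omega>)\<bar> \<le> L' * (3 * e) + 2 * B' * indicator A \<omega>" if "\<omega> \<in> space M" for \<omega>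
    proof (cases "\<omega> \<in> A")
      case True
      have "0 \<le> L' * (3 * e)" using L' e by simp
      then show ?thesis
        using True bd[OF hulls_in_bodies0(1), of n \<omega>] bd[OF hulls_in_bodies0(2), of n m \<omega>]
        unfolding B'_def by (simp add: indicator_def)
    next
      case False
      have "L * hausdorff_dist (walk_hull n \<omega>) (grid_hull m n \<omega>) \<le> L' * hausdorff_dist (walk_hull n \<omega>) (grid_hull m n \<omega>)"
        by (intro mult_right_mono hausdorff_dist_nonneg) (simp add: L'_def)
      also have "\<dots> \<le> L' * (3 * e)" using A(3) False that L' by (intro mult_left_mono) auto
      finally show ?thesis
        using lip[OF hulls_in_bodies0(1,2), of n \<omega> n m \<omega>] False by simp
    qed
    have "\<bar>(\<integral>\<omega>. f (walk_hull n \<omega>) \<partial>M) - (\<integral>\<omega>. f (grid_hull m n \<omega>) \<partial>M)\<bar> \<le>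
        (\<integral>\<omega>. L' * (3 * e) + 2 * B' * indicator A \<omega> \<partial>M)"
      using int ia pw by (intro M.expectation_diff_le) auto
    also have "\<dots> = L' * (3 * e) + 2 * B' * M.prob A" using ia A(1) by (simp add: M.prob_space)
    also have "\<dots> \<le> L' * (3 * (\<epsilon> / (16 * L'))) + 2 * B' * \<eta>"
      using e A(2) L' B' by (intro add_mono mult_left_mono) auto
    also have "\<dots> = 5 * \<epsilon> / 16" using L' B' by (simp add: \<eta>_def)
    finally show ?case using elim(2) m(2) \<epsilon> unfolding dist_real_def by linarith
  qed
qed

theorem walk_hull_converges:
  "converges_in_distribution (mtopology_of convex_body_metric)
    M (\<lambda>n \<omega>. convex hull {V n k \<omega> | k. k \<le> n})
    N (\<lambda>\<omega>. convex hull (closure {X t \<omega> | t. t \<in> {0..1}}))"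
proof -
  interpret K: Metric_space "convex_bodies0 :: 'c set set" hausdorff_dist
    by (rule Metric_space_convex_bodies0)
  have top: "mtopology_of (convex_body_metric :: 'c set metric) = K.mtopology"
    by (simp add: mtopology_of_def)
  \<comment> \<open>Time 0 supplies the origin, so inserting 0 does not change the set.\<close>
  have "{V n k \<omega> | k. k \<le> n} = insert 0 ((\<lambda>k. V n k \<omega>) ` {..n})" for n \<omega>
    by (auto intro: exI[of _ "0::nat"])
  moreover have "{X t \<omega> | t. t \<in> {0..1}} = (\<lambda>t. X t \<omega>) ` {0..1}" for \<omega> by auto
  moreover have "converges_in_distribution K.mtopology M walk_hull N path_hull"
    by (rule K.converges_in_distribution_Lipschitz[OF M.prob_space_axioms N.prob_space_axioms
          hulls_measurable(1)[unfolded top] path_hull_measurable[unfolded top] walk_hull_expectation_tendsto])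
  ultimately show ?thesis by (simp only: top)
qed

end

section \<open>The anisotropic rescaling\<close>

text \<open>The linear bound supplies an integrable majorant when only a first moment is available,
  the quadratic one the pointwise limit.\<close>

lemma cis_remainder_le: "norm (cis x - 1 - \<i> * x) \<le> 2 * \<bar>x\<bar>" "norm (cis x - 1 - \<i> * x) \<le> x\<^sup>2"
proof -
  have eq: "cis x - 1 - \<i> * x = iexp x - (\<Sum>k\<le>1. (\<i> * x) ^ k / fact k)"
    by (simp add: cis_conv_exp)
  show "norm (cis x - 1 - \<i> * x) \<le> 2 * \<bar>x\<bar>" unfolding eq using iexp_approx2[of x 1] by simp
  have "norm (cis x - 1 - \<i> * x) \<le> \<bar>x\<bar> ^ Suc 1 / fact (Suc 1)" unfolding eq by (rule iexp_approx1)
  also have "\<dots> \<le> x\<^sup>2" by (simp add: power2_eq_square)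
  finally show "norm (cis x - 1 - \<i> * x) \<le> x\<^sup>2" .
qed

text \<open>\<open>g n\<close> is \<open>n\<close> times the first-order remainder. Since
  \<open>a\<close> is the mean, the linear parts for \<open>Z\<close> and for \<open>a\<close>
  cancel, so the remainders control \<open>n\<close> times the distance between the two factors, and
  hence the distance between their \<open>n\<close>-th powers in the unit disc.\<close>

lemma (in prob_space) cis_mean_power_tendsto:
  fixes Z :: "'a \<Rightarrow> real"
  assumes Z: "integrable M Z"
  shows "(\<lambda>n. (\<integral>\<omega>. cis (Z \<omega> / real n) \<partial>M) ^ n) \<longlonglongrightarrow> cis (\<integral>\<omega>. Z \<omega> \<partial>M)"
proof -
  have Zm [measurable]: "Z \<in> borel_measurable M" using Z by simp
  have cism [measurable]: "(\<lambda>\<omega>. cis (Z \<omega> / real n)) \<in> borel_measurable M" for n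
    using measurable_compose[OF borel_measurable_divide[OF Zm borel_measurable_const] borel_measurable_continuous_onI[of cis]]
    by (simp add: continuous_on_cis)
  define a where "a = (\<integral>\<omega>. Z \<omega> \<partial>M)"
  define g where "g n x = of_nat n * (cis (x / real n) - 1 - \<i> * complex_of_real (x / real n))" for n and x :: real
  have g1: "norm (g n x) \<le> 2 * \<bar>x\<bar>" for n x
  proof (cases "n = 0")
    case False
    have "norm (g n x) \<le> real n * (2 * \<bar>x / real n\<bar>)"
      unfolding g_def norm_mult by (intro mult_mono cis_remainder_le) auto
    then show ?thesis using False by simp
  qed (simp add: g_def)
  have g2: "norm (g n x) \<le> x\<^sup>2 * (1 / real n)" for n x
  proof (cases "n = 0")
    case False
    have "norm (g n x) \<le> real n * (x / real n)\<^sup>2"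
      unfolding g_def norm_mult by (intro mult_mono cis_remainder_le) auto
    then show ?thesis using False by (simp add: power2_eq_square)
  qed (simp add: g_def)
  have g0: "(\<lambda>n. g n x) \<longlonglongrightarrow> 0" for x
  proof (rule Lim_null_comparison[OF always_eventually])
    show "\<forall>n. norm (g n x) \<le> x\<^sup>2 * (1 / real n)" using g2 by blast
    show "(\<lambda>n. x\<^sup>2 * (1 / real n)) \<longlonglongrightarrow> 0"
      using tendsto_mult_right_zero[OF lim_1_over_n] by blast
  qed
  have gm [measurable]: "(\<lambda>\<omega>. g n (Z \<omega>)) \<in> borel_measurable M" for n
    unfolding g_def by measurable
  have "(\<lambda>n. \<integral>\<omega>. g n (Z \<omega>) \<partial>M) \<longlonglongrightarrow> (\<integral>\<omega>. 0 \<partial>M)"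
    by (rule integral_dominated_convergence[where w="\<lambda>\<omega>. 2 * \<bar>Z \<omega>\<bar>"])
      (use Z g0 g1 in auto)
  then have lim: "(\<lambda>n. (\<integral>\<omega>. g n (Z \<omega>) \<partial>M) - g n a) \<longlonglongrightarrow> 0"
    using tendsto_diff[OF _ g0[of a]] by fastforce
  have bound: "norm ((\<integral>\<omega>. cis (Z \<omega> / real n) \<partial>M) ^ n - cis a) \<le> norm ((\<integral>\<omega>. g n (Z \<omega>) \<partial>M) - g n a)"
    if n: "0 < n" for n
  proof -
    have ci: "integrable M (\<lambda>\<omega>. cis (Z \<omega> / real n))"
      by (rule integrable_const_bound[of _ 1]) auto
    have "(\<integral>\<omega>. g n (Z \<omega>) \<partial>M) =
        of_nat n * ((\<integral>\<omega>. cis (Z \<omega> / real n) \<partial>M) - 1 - \<i> * complex_of_real (a / real n))"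
    proof -
      have "(\<integral>\<omega>. complex_of_real (Z \<omega> / real n) \<partial>M) = complex_of_real (a / real n)"
        using Z by (simp add: a_def integral_complex_of_real del: of_real_divide)
      then show ?thesis
        unfolding g_def using ci Z by (simp add: prob_space del: of_real_divide)
    qed
    then have diff: "(\<integral>\<omega>. g n (Z \<omega>) \<partial>M) - g n a = of_nat n * ((\<integral>\<omega>. cis (Z \<omega> / real n) \<partial>M) - cis (a / real n))"
      by (simp add: g_def algebra_simps)
    have n1: "norm (\<integral>\<omega>. cis (Z \<omega> / real n) \<partial>M) \<le> 1"
    proof -
      have "norm (\<integral>\<omega>. cis (Z \<omega> / real n) \<partial>M) \<le> (\<integral>\<omega>. norm (cis (Z \<omega> / real n)) \<partial>M)"
        by (rule integral_norm_bound)
      then show ?thesis by (simp add: prob_space)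
    qed
    have "cis (a / real n) ^ n = cis (real n * (a / real n))" by (rule Complex.DeMoivre)
    also have "real n * (a / real n) = a" using n by simp
    finally have "norm ((\<integral>\<omega>. cis (Z \<omega> / real n) \<partial>M) ^ n - cis a) \<le> real n * norm ((\<integral>\<omega>. cis (Z \<omega> / real n) \<partial>M) - cis (a / real n))"
      using norm_power_diff[OF n1, of "cis (a / real n)" n] by simp
    also have "\<dots> = norm ((\<integral>\<omega>. g n (Z \<omega>) \<partial>M) - g n a)" unfolding diff norm_mult by simp
    finally show ?thesis .
  qed
  have "(\<lambda>n. (\<integral>\<omega>. cis (Z \<omega> / real n) \<partial>M) ^ n - cis a) \<longlonglongrightarrow> 0"
  proof (rule Lim_null_comparison)
    show "\<forall>\<^sub>F n in sequentially. norm ((\<integral>\<omega>. cis (Z \<omega> / real n) \<partial>M) ^ n - cis a) \<le> norm ((\<integral>\<omega>. g n (Z \<omega>) \<partial>M) - g n a)"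
      using eventually_gt_at_top[of 0] by eventually_elim (rule bound)
    show "(\<lambda>n. norm ((\<integral>\<omega>. g n (Z \<omega>) \<partial>M) - g n a)) \<longlonglongrightarrow> 0"
      using lim by (rule tendsto_norm_zero)
  qed
  then show ?thesis by (simp add: LIM_zero_iff a_def)
qed

lemma weak_law_of_large_numbers_cis:
  fixes Y :: "nat \<Rightarrow> 'a \<Rightarrow> 'c::euclidean_space"
  assumes Y: "iid_steps M Y" and int: "integrable M (Y 1)"
  shows "(\<lambda>n. \<integral>\<omega>. cis (v \<bullet> random_walk Y n \<omega> / real n) \<partial>M) \<longlonglongrightarrow> cis (v \<bullet> (\<integral>\<omega>. Y 1 \<omega> \<partial>M))"
proof -
  interpret prob_space M using Y by (rule prob_space_iid_steps)
  have "(\<integral>\<omega>. cis (v \<bullet> random_walk Y n \<omega> / real n) \<partial>M) = (\<integral>\<omega>. cis (v \<bullet> Y 1 \<omega> / real n) \<partial>M) ^ n" for n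
  proof -
    have e: "v \<bullet> x / real n = ((1 / real n) *\<^sub>R v) \<bullet> x" for x by simp
    have "(\<integral>\<omega>. cis (v \<bullet> random_walk Y n \<omega> / real n) \<partial>M) = char_fun (distr M borel (random_walk Y n)) ((1 / real n) *\<^sub>R v)"
      unfolding e by (rule char_fun_distr[OF random_walk_measurable[OF Y], symmetric])
    also have "\<dots> = char_fun (distr M borel (Y 1)) ((1 / real n) *\<^sub>R v) ^ n"
      using char_fun_random_walk[OF Y le0, of n "(1 / real n) *\<^sub>R v"]
      by (simp only: random_walk_0 diff_zero)
    also have "char_fun (distr M borel (Y 1)) ((1 / real n) *\<^sub>R v) = (\<integral>\<omega>. cis (v \<bullet> Y 1 \<omega> / real n) \<partial>M)"
      unfolding e by (rule char_fun_distr[OF iid_steps_measurable[OF Y order_refl]])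
    finally show ?thesis .
  qed
  moreover have "(\<integral>\<omega>. v \<bullet> Y 1 \<omega> \<partial>M) = v \<bullet> (\<integral>\<omega>. Y 1 \<omega> \<partial>M)" using int by simp
  ultimately show ?thesis
    using cis_mean_power_tendsto[of "\<lambda>\<omega>. v \<bullet> Y 1 \<omega>"] int by simp
qed

text \<open>On the unit circle the squared distance to \<open>cis a\<close> is affine in
  \<open>cis x\<close>, so convergence of the mean to a point of the circle forces convergence in
  mean square.\<close>

lemma (in prob_space) cis_converges_in_mean:
  fixes A :: "nat \<Rightarrow> 'a \<Rightarrow> real"
  assumes A: "\<And>n. A n \<in> borel_measurable M"
    and lim: "(\<lambda>n. \<integral>\<omega>. cis (A n \<omega>) \<partial>M) \<longlonglongrightarrow> cis a"
  shows "(\<lambda>n. \<integral>\<omega>. norm (cis (A n \<omega>) - cis a) \<partial>M) \<longlonglongrightarrow> 0"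
proof (rule tendstoI)
  fix e :: real assume e: "e > 0"
  have cm: "(\<lambda>\<omega>. cis (A n \<omega>)) \<in> borel_measurable M" for n
    by (rule measurable_compose[OF A borel_measurable_continuous_onI]) (simp add: continuous_on_cis)
  have ci: "integrable M (\<lambda>\<omega>. cis (A n \<omega>))" for n
    using cm by (intro integrable_const_bound[of _ 1]) auto
  have ni: "integrable M (\<lambda>\<omega>. norm (cis (A n \<omega>) - cis a))" for n
    using ci by (intro integrable_norm Bochner_Integration.integrable_diff) auto
  have sq: "(norm (cis x - cis a))\<^sup>2 = 2 - 2 * Re (cis (- a) * cis x)" for x
  proof -
    have "(norm (cis x - cis a))\<^sup>2 = (cos x - cos a)\<^sup>2 + (sin x - sin a)\<^sup>2"
      by (simp add: cmod_power2)
    also have "\<dots> = 2 - 2 * (cos x * cos a + sin x * sin a)"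
      using sin_cos_squared_add[of x] sin_cos_squared_add[of a] by (simp add: power2_diff algebra_simps)
    finally show ?thesis by (simp add: cis_mult cos_diff algebra_simps)
  qed
  \<comment> \<open>The inequality \<open>2 * e * z \<le> e\<^sup>2 + z\<^sup>2\<close> trades the
    norm for its square, whose mean is known.\<close>
  have amgm: "norm (cis x - cis a) \<le> e / 2 + (1 - Re (cis (- a) * cis x)) / e" for x
  proof -
    let ?z = "norm (cis x - cis a)"
    have "0 \<le> (?z - e)\<^sup>2" by simp
    then have "2 * e * ?z \<le> e\<^sup>2 + ?z\<^sup>2" by (simp add: power2_diff algebra_simps)
    then have "2 * e * ?z \<le> 2 * e * (e / 2 + (1 - Re (cis (- a) * cis x)) / e)"
    proof -
      have "2 * e * (e / 2 + (1 - R) / e) = e\<^sup>2 + (2 - 2 * R)" for R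
        using e by (simp add: power2_eq_square distrib_left)
      with \<open>2 * e * ?z \<le> e\<^sup>2 + ?z\<^sup>2\<close> show ?thesis unfolding sq by (simp only:)
    qed
    then show ?thesis using e by simp
  qed
  have "(\<lambda>n. Re (cis (- a) * (\<integral>\<omega>. cis (A n \<omega>) \<partial>M))) \<longlonglongrightarrow> Re (cis (- a) * cis a)"
    by (intro tendsto_intros lim)
  then have "(\<lambda>n. Re (cis (- a) * (\<integral>\<omega>. cis (A n \<omega>) \<partial>M))) \<longlonglongrightarrow> 1" by (simp add: cis_mult)
  then have "\<forall>\<^sub>F n in sequentially. 1 - e\<^sup>2 / 2 < Re (cis (- a) * (\<integral>\<omega>. cis (A n \<omega>) \<partial>M))"
    by (rule order_tendstoD) (use e in simp)
  then show "\<forall>\<^sub>F n in sequentially. dist (\<integral>\<omega>. norm (cis (A n \<omega>) - cis a) \<partial>M) 0 < e"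
  proof eventually_elim
    case (elim n)
    have ri: "integrable M (\<lambda>\<omega>. Re (cis (- a) * cis (A n \<omega>)))"
      using ci[of n] by (intro integrable_Re integrable_mult_right) auto
    have "(\<integral>\<omega>. norm (cis (A n \<omega>) - cis a) \<partial>M) \<le> (\<integral>\<omega>. e / 2 + (1 - Re (cis (- a) * cis (A n \<omega>))) / e \<partial>M)"
      using ni ri amgm by (intro integral_mono) auto
    also have "\<dots> = e / 2 + (1 - (\<integral>\<omega>. Re (cis (- a) * cis (A n \<omega>)) \<partial>M)) / e"
      using ri by (simp add: prob_space)
    also have "(\<integral>\<omega>. Re (cis (- a) * cis (A n \<omega>)) \<partial>M) = Re (cis (- a) * (\<integral>\<omega>. cis (A n \<omega>) \<partial>M))"
      using ci[of n] by (subst integral_Re) auto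
    also have "e / 2 + (1 - Re (cis (- a) * (\<integral>\<omega>. cis (A n \<omega>) \<partial>M))) / e < e"
    proof -
      have "(1 - Re (cis (- a) * (\<integral>\<omega>. cis (A n \<omega>) \<partial>M))) / e < (e\<^sup>2 / 2) / e"
        using elim e by (intro divide_strict_right_mono) auto
      also have "(e\<^sup>2 / 2) / e = e / 2" using e by (simp add: power2_eq_square)
      finally show ?thesis by linarith
    qed
    finally have "(\<integral>\<omega>. norm (cis (A n \<omega>) - cis a) \<partial>M) < e" .
    moreover have "0 \<le> (\<integral>\<omega>. norm (cis (A n \<omega>) - cis a) \<partial>M)" by simp
    ultimately show ?case by (simp add: dist_real_def)
  qed
qed

section \<open>Coordinates and images of the walk and of the Levy process\<close>

lemma rescale_nth:
  assumes "orthonormal_basis e"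
  shows "rescale e o1 b n x $ i = (x \<bullet> e i) / (if i = o1 then real n else b n)"
proof -
  have "rescale e o1 b n x $ i = (\<Sum>j\<in>UNIV. ((x \<bullet> e j) / (if j = o1 then real n else b n)) * (e j \<bullet> e i))"
    by (simp add: rescale_def basis_coords_def inner_sum_left)
  also have "\<dots> = (\<Sum>j\<in>UNIV. if j = i then (x \<bullet> e j) / (if j = o1 then real n else b n) else 0)"
    using assms by (intro sum.cong) (auto simp: orthonormal_basis_def)
  finally show ?thesis by simp
qed

lemma linear_rescale:
  assumes "orthonormal_basis e"
  shows "linear (rescale e o1 b n)"
  by (rule linearI) (simp_all add: vec_eq_iff rescale_nth[OF assms] inner_add_left add_divide_distrib)

lemma iid_steps_linear_image:
  fixes Y :: "nat \<Rightarrow> 'a \<Rightarrow> 'c::euclidean_space" and g :: "'c \<Rightarrow> 'd::euclidean_space"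
  assumes Y: "iid_steps M Y" and g: "linear g"
  shows "iid_steps M (\<lambda>i \<omega>. g (Y i \<omega>))" "random_walk (\<lambda>i \<omega>. g (Y i \<omega>)) k \<omega> = g (random_walk Y k \<omega>)"
proof -
  interpret prob_space M using Y by (rule prob_space_iid_steps)
  have gm: "g \<in> borel_measurable borel"
    by (intro borel_measurable_continuous_onI linear_continuous_on linear_conv_bounded_linear[THEN iffD1] g)
  have "distr M borel (\<lambda>\<omega>. g (Y i \<omega>)) = distr (distr M borel (Y i)) borel g" if "1 \<le> i" for i
    using distr_distr[OF gm iid_steps_measurable[OF Y that]] by (simp add: comp_def)
  then have "distr M borel (\<lambda>\<omega>. g (Y i \<omega>)) = distr M borel (\<lambda>\<omega>. g (Y 1 \<omega>))" if "1 \<le> i" for i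
    using iid_steps_distr[OF Y that] that by (metis order_refl)
  then show "iid_steps M (\<lambda>i \<omega>. g (Y i \<omega>))"
    unfolding iid_steps_def using prob_space_axioms
    by (intro conjI allI impI indep_vars_compose2[OF iid_steps_indep[OF Y]] gm)
  show "random_walk (\<lambda>i \<omega>. g (Y i \<omega>)) k \<omega> = g (random_walk Y k \<omega>)"
    by (simp add: random_walk_def linear_sum[OF g])
qed

text \<open>An increment from \<open>s\<close> to \<open>t\<close> is the image of the increment of
  \<open>X\<close> under a map that depends on \<open>t - s\<close> alone, so independence and
  stationarity carry over.\<close>

lemma levy_process_limit_process:
  fixes X :: "real \<Rightarrow> 'b \<Rightarrow> real ^ 'n::finite"
  assumes X: "levy_process N X"
  shows "levy_process N (limit_process e o1 \<mu> X)"
proof -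
  interpret prob_space N using X by (simp add: levy_process_def)
  let ?Z = "limit_process e o1 \<mu> X"
  define h where "h t x = (\<chi> i. if i = o1 then norm \<mu> * t else x \<bullet> e i)" for t and x :: "real ^ 'n"
  have hm: "h t \<in> borel_measurable borel" for t
    unfolding h_def[abs_def]
  proof (intro borel_measurable_continuous_onI continuous_on_vec_lambda)
    show "continuous_on UNIV (\<lambda>x. if i = o1 then norm \<mu> * t else x \<bullet> e i)" for i
      by (cases "i = o1") (auto intro!: continuous_intros)
  qed
  have diff: "?Z t \<omega> - ?Z s \<omega> = h (t - s) (X t \<omega> - X s \<omega>)" for s t \<omega>
    by (simp add: limit_process_def h_def vec_eq_iff right_diff_distrib inner_diff_left)
  have Zh: "?Z t = (\<lambda>\<omega>. h t (X t \<omega>))" for t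
    by (simp add: limit_process_def h_def fun_eq_iff)
  have Xm: "X t \<in> borel_measurable N" if "0 \<le> t" for t by (rule levy_process_measurable[OF X that])
  show ?thesis
    unfolding levy_process_def
  proof (intro conjI allI impI ballI)
    show "prob_space N" by (rule prob_space_axioms)
    show "?Z t \<in> borel_measurable N" if "0 \<le> t" for t
      unfolding Zh by (rule measurable_compose[OF Xm[OF that] hm])
  next
    fix \<omega> assume \<omega>: "\<omega> \<in> space N"
    show "?Z 0 \<omega> = 0"
      by (simp add: limit_process_def levy_process_0[OF X \<omega>] vec_eq_iff)
    have c: "cadlag (\<lambda>t. X t \<omega>)" by (rule levy_process_cadlag[OF X \<omega>])
    have tz: "((\<lambda>t. ?Z t \<omega>) \<longlongrightarrow> (\<chi> i. if i = o1 then norm \<mu> * s else l \<bullet> e i)) F"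
      if "((\<lambda>t. X t \<omega>) \<longlongrightarrow> l) F" "((\<lambda>t. t) \<longlongrightarrow> s) F" for l s F
      unfolding limit_process_def
    proof (rule tendsto_vec_lambda)
      show "((\<lambda>t. if i = o1 then norm \<mu> * t else X t \<omega> \<bullet> e i) \<longlongrightarrow> (if i = o1 then norm \<mu> * s else l \<bullet> e i)) F" for i
        by (cases "i = o1") (auto intro!: tendsto_intros that)
    qed
    show "cadlag (\<lambda>t. ?Z t \<omega>)"
      unfolding cadlag_def
    proof (intro conjI allI impI)
      fix t :: real assume "0 \<le> t"
      then have "((\<lambda>t. X t \<omega>) \<longlongrightarrow> X t \<omega>) (at_right t)" using c by (simp add: cadlag_def)
      from tz[OF this tendsto_ident_at] show "((\<lambda>t. ?Z t \<omega>) \<longlongrightarrow> ?Z t \<omega>) (at_right t)"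
        by (simp add: limit_process_def)
    next
      fix t :: real assume "0 < t"
      then obtain l where "((\<lambda>t. X t \<omega>) \<longlongrightarrow> l) (at_left t)" using c by (auto simp: cadlag_def)
      from tz[OF this tendsto_ident_at] show "\<exists>l. ((\<lambda>t. ?Z t \<omega>) \<longlongrightarrow> l) (at_left t)" by blast
    qed
  next
    fix m :: nat and t :: "nat \<Rightarrow> real" assume t: "0 \<le> t 0 \<and> mono t"
    show "indep_vars (\<lambda>_. borel) (\<lambda>i \<omega>. ?Z (t (Suc i)) \<omega> - ?Z (t i) \<omega>) {..<m}"
      unfolding diff by (rule indep_vars_compose2[OF levy_process_indep[OF X]]) (use t hm in auto)
  next
    fix s t :: real assume st: "0 \<le> s \<and> s \<le> t"
    have "distr N borel (\<lambda>\<omega>. ?Z t \<omega> - ?Z s \<omega>) = distr (distr N borel (\<lambda>\<omega>. X t \<omega> - X s \<omega>)) borel (h (t - s))"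
      unfolding diff using st Xm hm by (subst distr_distr) (auto simp: comp_def)
    also have "distr N borel (\<lambda>\<omega>. X t \<omega> - X s \<omega>) = distr N borel (X (t - s))"
      using st by (intro levy_process_stationary[OF X]) auto
    also have "distr (distr N borel (X (t - s))) borel (h (t - s)) = distr N borel (?Z (t - s))"
      unfolding Zh using st Xm[of "t - s"] hm by (subst distr_distr) (auto simp: comp_def)
    finally show "distr N borel (\<lambda>\<omega>. ?Z t \<omega> - ?Z s \<omega>) = distr N borel (?Z (t - s))" .
  qed
qed

text \<open>Slutsky's argument in terms of characteristic functions. Along \<open>e o1\<close> the
  law of large numbers gives a constant limit, so the corresponding factor may be replaced by a
  constant. In the other directions, orthogonal to the drift, the centring has no effect and the
  assumed limit theorem applies.\<close>

lemma rescaled_endpoint_converges: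
  fixes Y :: "nat \<Rightarrow> 'a \<Rightarrow> real ^ 'n::finite" and X :: "real \<Rightarrow> 'b \<Rightarrow> real ^ 'n"
  assumes Y: "iid_steps M Y" "integrable M (Y 1)" and \<mu>: "\<mu> = (\<integral>\<omega>. Y 1 \<omega> \<partial>M)" "\<mu> \<noteq> 0"
    and X: "levy_process N X"
    and conv: "converges_in_distribution euclidean
      M (\<lambda>n \<omega>. (random_walk Y n \<omega> - real n *\<^sub>R \<mu>) /\<^sub>R b n) N (X 1)"
    and e: "orthonormal_basis e" "e o1 = \<mu> /\<^sub>R norm \<mu>"
  shows "weakly_converges (\<lambda>n. distr M borel (\<lambda>\<omega>. rescale e o1 b n (random_walk Y n \<omega>)))
    (distr N borel (limit_process e o1 \<mu> X 1))"
proof -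
  interpret M: prob_space M using Y(1) by (rule prob_space_iid_steps)
  interpret N: prob_space N using X by (simp add: levy_process_def)
  let ?S = "random_walk Y" and ?Z = "limit_process e o1 \<mu> X"
  define D where "D n \<omega> = (?S n \<omega> - real n *\<^sub>R \<mu>) /\<^sub>R b n" for n \<omega>
  have Sm [measurable]: "?S n \<in> borel_measurable M" for n by (rule random_walk_measurable[OF Y(1)])
  have Dm [measurable]: "D n \<in> borel_measurable M" for n unfolding D_def[abs_def] by measurable
  have Xm [measurable]: "X 1 \<in> borel_measurable N" by (rule levy_process_measurable[OF X]) simp
  have Dw: "weakly_converges (\<lambda>n. distr M borel (D n)) (distr N borel (X 1))"
    unfolding weakly_converges_def
  proof (intro allI impI)
    fix f :: "real ^ 'n \<Rightarrow> real" assume f: "continuous_on UNIV f \<and> bounded (range f)"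
    then have "f \<in> borel_measurable borel" by (intro borel_measurable_continuous_onI) simp
    then show "(\<lambda>n. \<integral>x. f x \<partial>distr M borel (D n)) \<longlonglongrightarrow> (\<integral>x. f x \<partial>distr N borel (X 1))"
      using conv f unfolding converges_in_distribution_def
      by (simp add: integral_distr D_def[abs_def] Dm[unfolded D_def[abs_def]])
  qed
  \<comment> \<open>Weak convergence speaks of real test functions; the uniform statement on the
    ball of radius \<open>norm v\<close> carries it over to the complex exponential.\<close>
  have Dchar: "(\<lambda>n. \<integral>\<omega>. cis (v \<bullet> D n \<omega>) \<partial>M) \<longlonglongrightarrow> (\<integral>\<omega>. cis (v \<bullet> X 1 \<omega>) \<partial>N)" for v
  proof (rule tendstoI)
    fix \<epsilon> :: real assume \<epsilon>: "\<epsilon> > 0"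
    then have "\<epsilon> / 2 > 0" by simp
    from weakly_converges_char_fun_uniform[OF borel_prob_distr[OF M.prob_space_axioms Dm] borel_prob_distr[OF N.prob_space_axioms Xm] Dw this, of "norm v"]
    show "\<forall>\<^sub>F n in sequentially. dist (\<integral>\<omega>. cis (v \<bullet> D n \<omega>) \<partial>M) (\<integral>\<omega>. cis (v \<bullet> X 1 \<omega>) \<partial>N) < \<epsilon>"
    proof eventually_elim
      case (elim n)
      from bspec[OF elim, of v] \<epsilon> show ?case
        by (simp add: char_fun_distr[OF Dm] char_fun_distr[OF Xm] dist_norm)
    qed
  qed
  show ?thesis
  proof (rule char_fun_continuity)
    have resm: "(\<lambda>\<omega>. rescale e o1 b n (?S n \<omega>)) \<in> borel_measurable M" for n
      by (rule measurable_compose[OF Sm borel_measurable_continuous_onI[OF linear_continuous_on[OF linear_conv_bounded_linear[THEN iffD1, OF linear_rescale[OF e(1)]]]]])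
    have Zm: "?Z 1 \<in> borel_measurable N"
      by (rule levy_process_measurable[OF levy_process_limit_process[OF X]]) simp
    show "borel_prob (distr M borel (\<lambda>\<omega>. rescale e o1 b n (?S n \<omega>)))" for n
      by (rule borel_prob_distr[OF M.prob_space_axioms resm])
    show "borel_prob (distr N borel (?Z 1))" by (rule borel_prob_distr[OF N.prob_space_axioms Zm])
    fix u :: "real ^ 'n"
    \<comment> \<open>The frequency \<open>u\<close> is pulled back to the original coordinates in
      two parts: \<open>w\<close>, along the drift, pairs with the walk divided by \<open>n\<close>,
      and \<open>v\<close>, orthogonal to it, with the centred walk divided by
      \<open>b n\<close>.\<close>
    define v where "v = (\<Sum>i\<in>UNIV - {o1}. u $ i *\<^sub>R e i)"
    define w where "w = u $ o1 *\<^sub>R e o1"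
    have \<mu>e: "\<mu> = norm \<mu> *\<^sub>R e o1" using \<mu>(2) e(2) by simp
    have e\<mu>: "e i \<bullet> \<mu> = (if i = o1 then norm \<mu> else 0)" for i
      by (subst \<mu>e) (use e(1) in \<open>auto simp: orthonormal_basis_def\<close>)
    have split: "u \<bullet> y = u $ o1 * y $ o1 + (\<Sum>i\<in>UNIV - {o1}. u $ i * y $ i)" for y
      by (simp add: inner_vec_def sum.remove[of UNIV o1])
    have uV: "u \<bullet> rescale e o1 b n (?S n \<omega>) = w \<bullet> ?S n \<omega> / real n + v \<bullet> D n \<omega>" for n \<omega>
    proof -
      have "v \<bullet> D n \<omega> = (\<Sum>i\<in>UNIV - {o1}. u $ i * (?S n \<omega> \<bullet> e i / b n))"
        unfolding v_def inner_sum_left D_def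
        by (intro sum.cong) (auto simp: inner_diff_right e\<mu> inner_commute[of "?S n \<omega>"] divide_inverse mult.commute)
      then show ?thesis
        unfolding split rescale_nth[OF e(1)] by (simp add: w_def inner_commute)
    qed
    have uZ: "u \<bullet> ?Z 1 \<omega> = w \<bullet> \<mu> + v \<bullet> X 1 \<omega>" for \<omega>
    proof -
      have "v \<bullet> X 1 \<omega> = (\<Sum>i\<in>UNIV - {o1}. u $ i * (X 1 \<omega> \<bullet> e i))"
        unfolding v_def inner_sum_left by (intro sum.cong) (auto simp: inner_commute)
      then show ?thesis unfolding split by (simp add: limit_process_def w_def e\<mu>)
    qed
    let ?A = "\<lambda>n \<omega>. w \<bullet> ?S n \<omega> / real n"
    have Am: "?A n \<in> borel_measurable M" for n by measurable
    have cm: "(\<lambda>\<omega>. cis (B \<omega>)) \<in> borel_measurable M" if "B \<in> borel_measurable M" for B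
      by (rule measurable_compose[OF that borel_measurable_continuous_onI]) (simp add: continuous_on_cis)
    have vDm: "(\<lambda>\<omega>. v \<bullet> D n \<omega>) \<in> borel_measurable M" for n by measurable
    have ci: "integrable M (\<lambda>\<omega>. cis (B \<omega>))" if "B \<in> borel_measurable M" for B
      using cm[OF that] by (intro M.integrable_const_bound[of _ 1]) auto
    have A0: "(\<lambda>n. \<integral>\<omega>. norm (cis (?A n \<omega>) - cis (w \<bullet> \<mu>)) \<partial>M) \<longlonglongrightarrow> 0"
      using weak_law_of_large_numbers_cis[OF Y, of w] by (intro M.cis_converges_in_mean Am) (simp add: \<mu>(1))
    \<comment> \<open>The factor with \<open>v\<close> has modulus 1, so the replacement costs at
      most the mean distance of the factor with \<open>w\<close> from its limit.\<close>
    have "(\<lambda>n. (\<integral>\<omega>. cis (?A n \<omega> + v \<bullet> D n \<omega>) \<partial>M) - cis (w \<bullet> \<mu>) * (\<integral>\<omega>. cis (v \<bullet> D n \<omega>) \<partial>M)) \<longlonglongrightarrow> 0"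
    proof (rule Lim_null_comparison[OF always_eventually A0], rule allI)
      fix n
      have i1: "integrable M (\<lambda>\<omega>. cis (?A n \<omega> + v \<bullet> D n \<omega>))"
        by (rule ci) (use Am vDm in measurable)
      have i2: "integrable M (\<lambda>\<omega>. cis (w \<bullet> \<mu>) * cis (v \<bullet> D n \<omega>))"
        by (intro integrable_mult_right ci vDm)
      have "(\<integral>\<omega>. cis (?A n \<omega> + v \<bullet> D n \<omega>) \<partial>M) - cis (w \<bullet> \<mu>) * (\<integral>\<omega>. cis (v \<bullet> D n \<omega>) \<partial>M) =
          (\<integral>\<omega>. cis (?A n \<omega> + v \<bullet> D n \<omega>) - cis (w \<bullet> \<mu>) * cis (v \<bullet> D n \<omega>) \<partial>M)"
        using i1 i2 by simp
      also have "norm \<dots> \<le> (\<integral>\<omega>. norm (cis (?A n \<omega> + v \<bullet> D n \<omega>) - cis (w \<bullet> \<mu>) * cis (v \<bullet> D n \<omega>)) \<partial>M)"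
        by (rule integral_norm_bound)
      also have "\<dots> = (\<integral>\<omega>. norm (cis (?A n \<omega>) - cis (w \<bullet> \<mu>)) \<partial>M)"
      proof (rule Bochner_Integration.integral_cong[OF refl])
        fix \<omega>
        have "cis (?A n \<omega> + v \<bullet> D n \<omega>) - cis (w \<bullet> \<mu>) * cis (v \<bullet> D n \<omega>) = (cis (?A n \<omega>) - cis (w \<bullet> \<mu>)) * cis (v \<bullet> D n \<omega>)"
          by (simp add: left_diff_distrib flip: cis_mult)
        then show "norm (cis (?A n \<omega> + v \<bullet> D n \<omega>) - cis (w \<bullet> \<mu>) * cis (v \<bullet> D n \<omega>)) = norm (cis (?A n \<omega>) - cis (w \<bullet> \<mu>))"
          by (simp add: norm_mult)
      qed
      finally show "norm ((\<integral>\<omega>. cis (?A n \<omega> + v \<bullet> D n \<omega>) \<partial>M) - cis (w \<bullet> \<mu>) * (\<integral>\<omega>. cis (v \<bullet> D n \<omega>) \<partial>M)) \<le>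
          (\<integral>\<omega>. norm (cis (?A n \<omega>) - cis (w \<bullet> \<mu>)) \<partial>M)" .
    qed
    from tendsto_add[OF this tendsto_mult[OF tendsto_const Dchar[of v]], of "cis (w \<bullet> \<mu>)"]
    have "(\<lambda>n. \<integral>\<omega>. cis (?A n \<omega> + v \<bullet> D n \<omega>) \<partial>M) \<longlonglongrightarrow> cis (w \<bullet> \<mu>) * (\<integral>\<omega>. cis (v \<bullet> X 1 \<omega>) \<partial>N)" by simp
    then show "(\<lambda>n. char_fun (distr M borel (\<lambda>\<omega>. rescale e o1 b n (?S n \<omega>))) u) \<longlonglongrightarrow> char_fun (distr N borel (?Z 1)) u"
      by (simp add: char_fun_distr[OF resm] char_fun_distr[OF Zm] uV uZ flip: cis_mult)
  qed
qed

theorem proposition2p4: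
  fixes M :: "'a measure" and N :: "'b measure"
    and Y :: "nat \<Rightarrow> 'a \<Rightarrow> real ^ 'n::finite" and S :: "nat \<Rightarrow> 'a \<Rightarrow> real ^ 'n"
    and X Xt :: "real \<Rightarrow> 'b \<Rightarrow> real ^ 'n"
    and \<mu> :: "real ^ 'n" and b :: "nat \<Rightarrow> real" and l :: "real \<Rightarrow> real" and \<alpha> :: real
    and e :: "'n \<Rightarrow> real ^ 'n" and o1 :: 'n
    and \<psi> :: "nat \<Rightarrow> real ^ 'n \<Rightarrow> real ^ 'n"
  assumes "1 < \<alpha>" and "\<alpha> \<le> 2"
    and "iid_steps M Y"
    and "integrable M (Y 1)" and "\<mu> = (\<integral>\<omega>. Y 1 \<omega> \<partial>M)" and "\<mu> \<noteq> 0"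
    and "S = random_walk Y"
    and "\<And>n. 1 \<le> n \<Longrightarrow> 0 < b n"
    and "slowly_varying l"
    and "\<And>n. 1 \<le> n \<Longrightarrow> b n = real n powr (1 / \<alpha>) * l (real n)"
    and "stable_levy_process \<alpha> N X"
    and "converges_in_distribution euclidean
           M (\<lambda>n \<omega>. (S n \<omega> - real n *\<^sub>R \<mu>) /\<^sub>R b n) N (X 1)"
    and "orthonormal_basis e" and "e o1 = \<mu> /\<^sub>R norm \<mu>"
    and "\<psi> = rescale e o1 b"
    and "Xt = limit_process e o1 \<mu> X"
  shows "converges_in_distribution (mtopology_of convex_body_metric)
           M (\<lambda>n \<omega>. \<psi> n ` (convex hull {S k \<omega> | k. k \<le> n}))
           N (\<lambda>\<omega>. convex hull (closure {Xt t \<omega> | t. t \<in> {0..1}}))"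
proof -
  note Y = \<open>iid_steps M Y\<close> and e = \<open>orthonormal_basis e\<close>
  have X: "levy_process N X" using \<open>stable_levy_process \<alpha> N X\<close> by (simp add: stable_levy_process_def)
  note lin = linear_rescale[OF e, of o1 b]
  have walk: "random_walk (\<lambda>i \<omega>. rescale e o1 b n (Y i \<omega>)) k = (\<lambda>\<omega>. rescale e o1 b n (random_walk Y k \<omega>))" for n k
    by (rule ext) (rule iid_steps_linear_image(2)[OF Y lin])
  \<comment> \<open>The rescaling changes with \<open>n\<close>, so the rescaled walks form an array
    with one row of steps per \<open>n\<close>. Linearity carries the map inside the partial sums
    and inside the hull.\<close>
  interpret levy_array M N "\<lambda>n i \<omega>. rescale e o1 b n (Y i \<omega>)" Xt
  proof
    show "iid_steps M (\<lambda>i \<omega>. rescale e o1 b n (Y i \<omega>))" for n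
      by (rule iid_steps_linear_image(1)[OF Y lin])
    show "levy_process N Xt"
      unfolding \<open>Xt = _\<close> by (rule levy_process_limit_process[OF X])
    show "weakly_converges (\<lambda>n. distr M borel (random_walk (\<lambda>i \<omega>. rescale e o1 b n (Y i \<omega>)) n)) (distr N borel (Xt 1))"
      unfolding walk \<open>Xt = _\<close>
      using assms by (intro rescaled_endpoint_converges[OF Y _ _ _ X _ e]) simp_all
  qed
  have "\<psi> n ` (convex hull {S k \<omega> | k. k \<le> n}) = convex hull {V n k \<omega> | k. k \<le> n}" for n \<omega>
  proof -
    have "\<psi> n ` (convex hull {S k \<omega> | k. k \<le> n}) = convex hull (\<psi> n ` {S k \<omega> | k. k \<le> n})"
      unfolding \<open>\<psi> = _\<close> by (rule convex_hull_linear_image[OF lin])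
    also have "\<psi> n ` {S k \<omega> | k. k \<le> n} = {V n k \<omega> | k. k \<le> n}"
      unfolding walk \<open>\<psi> = _\<close> \<open>S = _\<close> by auto
    finally show ?thesis .
  qed
  then show ?thesis using walk_hull_converges by (simp only:)
qed

end
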